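(* Let $d\in\mathbb{N}$, $d\ge2$, $\beta\ge1$, $\ell$ the largest integer strictly smaller than $\beta$, $L_0,\dots,L_\ell,L_\beta>0$, $C_{\mathsf{noise}},C_{\mathsf{cvrtm}}>0$, and $p\in[1,\infty)$. There is a constant $C>0$ large enough, depending only on $\beta,d,L_0,\dots,L_\ell,L_\beta,C_{\mathsf{noise}},C_{\mathsf{cvrtm}},p$, with the following property. Consider the snake model described in the context with parameters $n\in\mathbb{N}$, $\delta>0$, $T_{\mathsf{sum}}>0$, satisfying (Noise) and (CoverTime). Assume $$C\max\Big(\Big(\frac{T_{\mathsf{sum}}}{n}\Big)^{2\beta+d+1},\,T_{\mathsf{sum}}^{-1}\Big)\le\delta^{d-1}\le C^{-1}\min\Big(1,\frac{n}{T_{\mathsf{sum}}}\Big).$$ Then $$\forall x_0\in[0,1]^d:\ \inf_{\hat f}\sup_{\theta^\star\in\Theta^{\mathsf{snake}}_{d,\beta}}\mathbf{P}_{\theta^\star}\Big(C\|\hat f(x_0)-f_{\theta^\star}(x_0)\|_2\ge\big(\delta^{-(d-1)}T_{\mathsf{sum}}^{-1}n\big)^{-\frac{\beta}{2(\beta+1)+d}}\Big)\ge\tfrac14,$$ $$\inf_{\hat f}\sup_{\theta^\star\in\Theta^{\mathsf{snake}}_{d,\beta}}\mathbf{P}_{\theta^\star}\bigg(C\sup_{x\in[0,1]^d}\|\hat f(x)-f_{\theta^\star}(x)\|_2\ge\Big(\frac{\delta^{-(d-1)}T_{\mathsf{sum}}^{-1}n}{\log(\delta^{-(d-1)}T_{\mathsf{sum}}^{-1}n)}\Big)^{-\frac{\beta}{2(\beta+1)+d}}\bigg)\ge\tfrac14,$$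 $$\inf_{\hat f}\sup_{\theta^\star\in\Theta^{\mathsf{snake}}_{d,\beta}}\mathbf{P}_{\theta^\star}\Big(C\,\big\|\,\|\hat f-f_{\theta^\star}\|_2\,\big\|_{L^p([0,1]^d)}\ge\big(\delta^{-(d-1)}T_{\mathsf{sum}}^{-1}n\big)^{-\frac{\beta}{2(\beta+1)+d}}\Big)\ge\tfrac14,$$ where the infima range over all estimators $\hat f$ of $f_{\theta^\star}$ based on the observations $(Y_{j,i})$.
   Context: Smoothness class: $\mathcal{F}_{d,\beta}$ is the set of functions $f=(f_1,\dots,f_d):\mathbb{R}^d\to\mathbb{R}^d$ such that each component $f_j$ is $\ell$ times differentiable, $\sup_x\|D^kf_j(x)\|_{\mathsf{op}}\le L_k$ for $k=0,\dots,\ell$, and $\|D^\ell f_j(x)-D^\ell f_j(\tilde x)\|_{\mathsf{op}}\le L_\beta\|x-\tilde x\|_2^{\beta-\ell}$ for all $x,\tilde x\in\mathbb{R}^d$. Here $D^k f_j(x)$ is the $k$-th derivative as a symmetric $k$-linear form and $\|A\|_{\mathsf{op}}=\sup\{|A(v_1,\dots,v_k)|:\|v_i\|_2=1\}$; $\|\cdot\|_2$ is the Euclidean norm. Flow: for Lipschitz $f:\mathbb{R}^d\to\mathbb{R}^d$ and $x\in\mathbb{R}^d$, $t\mapsto U(f,x,t)$ is the solution of $\dot u(t)=f(u(t))$, $u(0)=x$. Tube: for continuously differentiable $u:[0,T]\to\mathbb{R}^d$ and $\delta>0$, $$\mathcal{T}(u,\delta)=\bigcup_{t\in[0,T]}\{u(t)+v:\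 \dot u(t)\ne0,\ v^\top\dot u(t)=0,\ \|v\|_2\le\delta\}.$$ Tube distance: for $\theta=(f,(x_j)_{j=1}^m,(T_j)_{j=1}^m)$ with $f$ Lipschitz, $x_j\in\mathbb{R}^d$, $T_j>0$, let $u_j=U(f,x_j,\cdot):[0,T_j]\to\mathbb{R}^d$; for $A\subseteq\mathbb{R}^d$, $d_{\mathcal{T}}(A,\theta)=\inf\{\delta>0:\ A\subseteq\bigcup_{j=1}^m\mathcal{T}(u_j,\delta)\}$. Snake parameter class: $\Theta^{\mathsf{snake}}_{d,\beta}$ (depending on $L_0,\dots,L_\ell,L_\beta,\delta,T_{\mathsf{sum}}$) is the set of all $\theta=(f,(x_j)_{j=1}^m,(T_j)_{j=1}^m)\in\mathcal{F}_{d,\beta}\times(\mathbb{R}^d)^m\times(0,\infty)^m$ with $m\in\mathbb{N}$, $\sum_{j=1}^mT_j=T_{\mathsf{sum}}$, and $d_{\mathcal{T}}([0,1]^d,\theta)\le\delta$. Write $f_\theta=f$. Observation model: for $\theta^\star=(f^\star,(x_j)_{j=1}^m,(T_j)_{j=1}^m)\in\Theta^{\mathsf{snake}}_{d,\beta}$ one observes $$Y_{j,i}=U(f^\star,x_j,t_{j,i})+\varepsilon_{j,i},\qquad j\in\{1,\dots,m\},\ i\in\{1,\dots,n_j\},$$ where $n_1,\dots,n_m\in\mathbb{N}$ with $\sum_jn_j=n$ (so $m\le n$), the observation times satisfy $0\le t_{j,1}\le\dots\le t_{j,n_j}=T_j$, and $\varepsilon_{j,i}$ are i.i.d. centered $\mathbb{R}^d$-valued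 with distribution $P^\varepsilon$. The design $(n_j),(t_{j,i})$ is fixed for each $(m,(T_j)_{j=1}^m)$. The initial conditions $x_j$ and times $t_{j,i}$ are known; only $f^\star$ is unknown. $\mathbf{P}_{\theta^\star}$ is the law. (Noise): for all $v_1,v_2\in\mathbb{R}^d$, $\mathrm{KL}(v_1+P^\varepsilon,v_2+P^\varepsilon)\le C_{\mathsf{noise}}\|v_1-v_2\|_2^2$, with $\mathrm{KL}$ the Kullback–Leibler divergence and $v+P$ the distribution $P$ shifted by $v$. (CoverTime): for all $j$ and all $a,b\in[0,T_j]$ with $a<b$, $\#\{i\in\{1,\dots,n_j\}:t_{j,i}\in[a,b]\}\le\max\big(1,\,C_{\mathsf{cvrtm}}(b-a)\frac{n}{T_{\mathsf{sum}}}\big)$; this holds for every design in the model with the same constant. *)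

theory Defs
  imports "HOL-Probability.Probability"
begin

section \<open>Smoothness class\<close>

text \<open>
  A $k$-linear form is represented by its action on lists of length $k$.
  In finite dimension $g$ is $k$ times differentiable iff, for all fixed directions, the iterated
  derivatives of order less than $k$ are Frechet differentiable; then
  \<open>iter_deriv g [v\<^sub>1, \<dots>, v\<^sub>k] x\<close> is $D^k g(x)(v_1,\dots,v_k)$.
\<close>

primrec iter_deriv :: "('a::real_normed_vector \<Rightarrow> real) \<Rightarrow> 'a list \<Rightarrow> 'a \<Rightarrow> real" where
  "iter_deriv g [] = g"
| "iter_deriv g (v # vs) = (\<lambda>x. frechet_derivative (iter_deriv g vs) (at x) v)"

definition times_differentiable :: "nat \<Rightarrow> ('a::real_normed_vector \<Rightarrow> real) \<Rightarrow> bool" where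
  "times_differentiable k g \<longleftrightarrow>
     (\<forall>vs x. length vs < k \<longrightarrow> iter_deriv g vs differentiable (at x))"

definition form_norm :: "nat \<Rightarrow> ('a::real_normed_vector list \<Rightarrow> real) \<Rightarrow> ereal" where
  "form_norm k A = (SUP vs\<in>{vs. length vs = k \<and> (\<forall>v\<in>set vs. norm v = 1)}. ereal \<bar>A vs\<bar>)"

definition smooth_class ::
  "real \<Rightarrow> nat \<Rightarrow> (nat \<Rightarrow> real) \<Rightarrow> real \<Rightarrow> (real^'d \<Rightarrow> real^'d) set" where
  "smooth_class \<beta> l L L\<beta> = {f. \<forall>j. let g = (\<lambda>x. f x $ j) in
     times_differentiable l g \<and>
     (\<forall>k\<le>l. (SUP x. form_norm k (\<lambda>vs. iter_deriv g vs x)) \<le> ereal (L k)) \<and>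
     (\<forall>x x'. form_norm l (\<lambda>vs. iter_deriv g vs x - iter_deriv g vs x')
              \<le> ereal (L\<beta> * norm (x - x') powr (\<beta> - real l)))}"


section \<open>Flow, tube, and snake parameter class\<close>

text \<open>For Lipschitz $f$ the global solution exists on all of $\mathbb{R}$ and is unique.\<close>

definition flow :: "('a::real_normed_vector \<Rightarrow> 'a) \<Rightarrow> 'a \<Rightarrow> real \<Rightarrow> 'a" where
  "flow f x = (THE u. u 0 = x \<and> (\<forall>t. (u has_vector_derivative f (u t)) (at t)))"

definition tube :: "real \<Rightarrow> (real \<Rightarrow> 'a::real_inner) \<Rightarrow> real \<Rightarrow> 'a set" where
  "tube T u \<delta> = (\<Union>t\<in>{0..T}. {u t + v | v.
     vector_derivative u (at t within {0..T}) \<noteq> 0 \<and>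
     v \<bullet> vector_derivative u (at t within {0..T}) = 0 \<and> norm v \<le> \<delta>})"

text \<open>
  A parameter $(f,(x_j)_{j=1}^m,(T_j)_{j=1}^m)$; both lists have length $m$ and are indexed from 0.
\<close>

type_synonym 'd param = "(real^'d \<Rightarrow> real^'d) \<times> (real^'d) list \<times> real list"

text \<open>The infimum of the empty set is \<open>\<infinity>\<close>.\<close>

fun tube_dist :: "(real^'d) set \<Rightarrow> 'd param \<Rightarrow> ereal" where
  "tube_dist A (f, xs, Ts) =
     Inf (ereal ` {\<delta>. \<delta> > 0 \<and> A \<subseteq> (\<Union>j<length Ts. tube (Ts ! j) (flow f (xs ! j)) \<delta>)})"

definition snake_class ::
  "real \<Rightarrow> nat \<Rightarrow> (nat \<Rightarrow> real) \<Rightarrow> real \<Rightarrow> real \<Rightarrow> real \<Rightarrow> 'd::finite param set" where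
  "snake_class \<beta> l L L\<beta> \<delta> Tsum = {(f, xs, Ts).
     f \<in> smooth_class \<beta> l L L\<beta> \<and> Ts \<noteq> [] \<and> length xs = length Ts \<and> (\<forall>T\<in>set Ts. T > 0) \<and>
     sum_list Ts = Tsum \<and> tube_dist (cbox 0 1) (f, xs, Ts) \<le> ereal \<delta>}"

text \<open>
  Every trajectory carries at least one of the $n$ observations, so the model with $n$
  observations is only defined for parameters with $m \le n$.
\<close>

definition snake_model_class ::
  "real \<Rightarrow> nat \<Rightarrow> (nat \<Rightarrow> real) \<Rightarrow> real \<Rightarrow> real \<Rightarrow> real \<Rightarrow> nat \<Rightarrow> 'd::finite param set" where
  "snake_model_class \<beta> l L L\<beta> \<delta> Tsum n =
     {(f, xs, Ts) \<in> snake_class \<beta> l L L\<beta> \<delta> Tsum. length Ts \<le> n}"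


section \<open>Observation model\<close>

text \<open>
  A design assigns to $(m,(T_j)_{j=1}^m)$, i.e. to a list of durations, the list of the lists
  $(t_{j,1},\dots,t_{j,n_j})$ of observation times.
\<close>

type_synonym design = "real list \<Rightarrow> real list list"

definition valid_times :: "nat \<Rightarrow> real list \<Rightarrow> real list list \<Rightarrow> bool" where
  "valid_times n Ts ts \<longleftrightarrow> length ts = length Ts \<and> sum_list (map length ts) = n \<and>
     (\<forall>j<length Ts. ts ! j \<noteq> [] \<and> sorted (ts ! j) \<and> 0 \<le> hd (ts ! j) \<and> last (ts ! j) = Ts ! j)"

definition cover_time :: "real \<Rightarrow> nat \<Rightarrow> real \<Rightarrow> real list \<Rightarrow> real list list \<Rightarrow> bool" where
  "cover_time C n Tsum Ts ts \<longleftrightarrow> (\<forall>j<length Ts. \<forall>a b. 0 \<le> a \<and> a < b \<and> b \<le> Ts ! j \<longrightarrow>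
     real (card {i. i < length (ts ! j) \<and> ts ! j ! i \<in> {a..b}})
       \<le> max 1 (C * (b - a) * (real n / Tsum)))"

definition obs_index :: "real list list \<Rightarrow> (nat \<times> nat) set" where
  "obs_index ts = (SIGMA j:{..<length ts}. {..<length (ts ! j)})"

definition obs_space :: "real list list \<Rightarrow> (nat \<times> nat \<Rightarrow> real^'d) measure" where
  "obs_space ts = (\<Pi>\<^sub>M k\<in>obs_index ts. borel)"

text \<open>The law of $Y_{j,i} = U(f,x_j,t_{j,i}) + \varepsilon_{j,i}$ with i.i.d. errors of law $P$.\<close>

fun obs_law :: "(real^'d) measure \<Rightarrow> design \<Rightarrow> 'd param \<Rightarrow> (nat \<times> nat \<Rightarrow> real^'d) measure" where
  "obs_law P D (f, xs, Ts) =
     distr (\<Pi>\<^sub>M k\<in>obs_index (D Ts). P) (obs_space (D Ts))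
       (\<lambda>\<epsilon>. \<lambda>(j, i)\<in>obs_index (D Ts). flow f (xs ! j) (D Ts ! j ! i) + \<epsilon> (j, i))"

definition centered_noise :: "(real^'d) measure \<Rightarrow> bool" where
  "centered_noise P \<longleftrightarrow> prob_space P \<and> sets P = sets borel \<and>
     integrable P (\<lambda>v. v) \<and> (\<integral>v. v \<partial>P) = 0"

text \<open>
  The library's \<open>KL_divergence b M N\<close> is the divergence of \<open>N\<close> from \<open>M\<close> and is only meaningful if
  \<open>N\<close> is absolutely continuous with integrable log-density; otherwise the divergence is infinite
  (the negative part of the log-density is always integrable).
\<close>

definition KL :: "'a measure \<Rightarrow> 'a measure \<Rightarrow> ereal" where
  "KL P Q = (if absolutely_continuous Q P \<and> integrable P (entropy_density (exp 1) Q P)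
             then ereal (KL_divergence (exp 1) Q P) else \<infinity>)"

definition noise_condition :: "real \<Rightarrow> (real^'d) measure \<Rightarrow> bool" where
  "noise_condition C P \<longleftrightarrow> (\<forall>v1 v2.
     KL (distr P borel (\<lambda>e. v1 + e)) (distr P borel (\<lambda>e. v2 + e)) \<le> ereal (C * (norm (v1 - v2))\<^sup>2))"


section \<open>Estimators and minimax probabilities\<close>

text \<open>
  An estimator may use the initial conditions, the durations (hence the observation times), and
  the observations. Joint measurability in observation and evaluation point makes the
  pointwise and $L^p$ losses measurable functions of the observation.
\<close>

type_synonym 'd estimator =
  "(real^'d) list \<Rightarrow> real list \<Rightarrow> (nat \<times> nat \<Rightarrow> real^'d) \<Rightarrow> real^'d \<Rightarrow> real^'d"

definition estimators :: "design \<Rightarrow> 'd::finite estimator set" where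
  "estimators D = {F. \<forall>xs Ts.
     (\<lambda>(y, x). F xs Ts y x) \<in> borel_measurable (obs_space (D Ts) \<Otimes>\<^sub>M borel)}"

definition pointwise_loss ::
  "real^'d \<Rightarrow> (real^'d \<Rightarrow> real^'d) \<Rightarrow> (real^'d \<Rightarrow> real^'d) \<Rightarrow> ennreal" where
  "pointwise_loss x0 g f = ennreal (norm (g x0 - f x0))"

definition sup_loss :: "(real^'d \<Rightarrow> real^'d) \<Rightarrow> (real^'d \<Rightarrow> real^'d) \<Rightarrow> ennreal" where
  "sup_loss g f = (SUP x\<in>cbox 0 1. ennreal (norm (g x - f x)))"

definition Lp_loss :: "real \<Rightarrow> (real^'d \<Rightarrow> real^'d) \<Rightarrow> (real^'d \<Rightarrow> real^'d) \<Rightarrow> ennreal" where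
  "Lp_loss p g f =
     (let I = (\<integral>\<^sup>+x\<in>cbox 0 1. ennreal (norm (g x - f x) powr p) \<partial>lborel)
      in if I = \<infinity> then \<infinity> else ennreal (enn2real I powr (1 / p)))"

text \<open>
  $\mathbf{P}_\theta(C \cdot \mathit{loss}(\hat f, f_\theta) \ge r)$. A supremum over uncountably many
  points need not give a Borel event (only one in the completion), hence the outer measure; it
  agrees with \<open>emeasure\<close> on all measurable events.
\<close>

fun exceed_prob ::
  "(real^'d) measure \<Rightarrow> design \<Rightarrow> ((real^'d \<Rightarrow> real^'d) \<Rightarrow> (real^'d \<Rightarrow> real^'d) \<Rightarrow> ennreal) \<Rightarrow>
   real \<Rightarrow> real \<Rightarrow> 'd::finite estimator \<Rightarrow> 'd param \<Rightarrow> ennreal" where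
  "exceed_prob P D loss C r F (f, xs, Ts) =
     outer_measure_of (obs_law P D (f, xs, Ts))
       {y \<in> space (obs_space (D Ts)). ennreal C * loss (F xs Ts y) f \<ge> ennreal r}"

definition minimax_prob ::
  "(real^'d) measure \<Rightarrow> design \<Rightarrow> 'd param set \<Rightarrow>
   ((real^'d \<Rightarrow> real^'d) \<Rightarrow> (real^'d \<Rightarrow> real^'d) \<Rightarrow> ennreal) \<Rightarrow> real \<Rightarrow> real \<Rightarrow> ennreal" where
  "minimax_prob P D \<Theta> loss C r =
     (INF F\<in>estimators D. SUP \<theta>\<in>\<Theta>. exceed_prob P D loss C r F \<theta>)"

end

theory Submission
  imports Defs "HOL-Computational_Algebra.Polynomial"
begin

text \<open>
  All hypotheses are perturbations of a constant field in one coordinate direction. A perturbation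
  changes only the speed and not the direction, so every trajectory is a straight line whose position
  solves a scalar autonomous equation, the tubes do not depend on the perturbation, and after time
  $t$ two trajectories with speeds in $[c, c + e]$ and the same starting point are at most $e t$ apart.
  The snake is cut into short pieces: with cells of side $H$ carrying a bump of height of order
  $H^\beta$, each piece runs for a time $H / c$. A bump is then seen by order $(H/\delta)^{d-1}$
  pieces, with order $H n / T_{\mathsf{sum}}$ observations each that move by at most order
  $H^{\beta+1}$, which gives the divergence $\delta^{-(d-1)} T_{\mathsf{sum}}^{-1} n H^{2(\beta+1)+d}$. If this would
  require cells smaller than the spacing of the lines, the bumps are placed between the lines and
  are not seen at all.

  On the statistical side, Young's inequality for $g \log g - g$ bounds $a P(A)$ by
  $\mathrm{KL}(P, Q) + (e^a - 1) Q(A)$. A small constant $a$ gives the two-point bound, which is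
  averaged over the vertices of a hypercube and over space for the $L^p$ loss; the logarithm of the
  number of cells as $a$ gives the bound for the supremum loss.
\<close>

section \<open>Divergence bounds for product laws\<close>

text \<open>Starting points and durations are known to the estimator and the design may depend on
  the durations, so all hypotheses must share one snake that satisfies the tube condition for each
  of them; then their laws differ through the flow alone. Restarting from known points resets the
  deviation of two flows, at the price of many trajectories, and this is where the assumptions
  enter. The lower bound of \<delta>^(d-1) by a multiple of 1/Tsum leaves enough time for the pieces
  to cover the cube; surplus time goes into one more trajectory that starts far away and meets no
  bump. With N = n / (\<delta>^(d-1) Tsum), the lower bound by (Tsum/n)^(2\<beta>+d+1) yields N
  \<le> (n/Tsum)^(2(\<beta>+1)+d). Hence h n/Tsum \<ge> 1 at the scale h where N h^(2(\<beta>+1)+d)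
  = 1: this keeps the number of trajectories below n and absorbs the maximum with 1 in the cover
  condition. The upper bound makes N and 1/\<delta> large. Since the claims are about probabilities
  and not expected losses, the averaging argument for the L^p loss ends with a reverse Markov
  step.\<close>

lemma fenchel_entropy:
  fixes a g :: real
  assumes "g \<ge> 0"
  shows "a * g \<le> g * ln g - g + exp a"
proof (cases "g = 0")
  case False
  then have "g > 0" using assms by simp
  have "1 + (a - ln g) \<le> exp (a - ln g)" by (rule exp_ge_add_one_self)
  also have "\<dots> = exp a / g" using \<open>g > 0\<close> by (simp add: exp_diff)
  finally show ?thesis using \<open>g > 0\<close> by (simp add: field_simps)
qed simp

text \<open>The Donsker-Varadhan bound for \<open>a\<close> times the indicator of \<open>A\<close>,
  with log (1 + u) replaced by u. Being linear in the mass of \<open>A\<close> under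
  \<open>Q\<close>, it can be summed over disjoint events, and \<open>K\<close> may be any upper
  bound for the divergence.\<close>

definition tilt_bounded :: "real \<Rightarrow> 'a measure \<Rightarrow> 'a measure \<Rightarrow> bool" where
  "tilt_bounded K P Q \<longleftrightarrow>
     (\<forall>A\<in>sets Q. \<forall>a\<ge>0. a * measure P A \<le> K + (exp a - 1) * measure Q A)"

lemma tilt_bounded_mono:
  assumes "tilt_bounded K P Q" "K \<le> K'"
  shows "tilt_bounded K' P Q"
  unfolding tilt_bounded_def
proof (intro ballI allI impI)
  fix A and a :: real assume "A \<in> sets Q" "0 \<le> a"
  then have "a * measure P A \<le> K + (exp a - 1) * measure Q A"
    using assms(1) unfolding tilt_bounded_def by blast
  then show "a * measure P A \<le> K' + (exp a - 1) * measure Q A" using assms(2) by linarith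
qed

lemma tilt_bounded_density:
  fixes g :: "'a \<Rightarrow> real"
  assumes Q: "prob_space Q" and P: "prob_space (density Q g)"
    and g[measurable]: "g \<in> borel_measurable Q" and nonneg: "\<And>x. g x \<ge> 0"
    and int: "integrable (density Q g) (\<lambda>x. ln (g x))"
    and K: "(\<integral>x. ln (g x) \<partial>density Q g) \<le> K"
  shows "tilt_bounded K (density Q g) Q"
  unfolding tilt_bounded_def
proof safe
  fix A a assume A[measurable]: "A \<in> sets Q" and "(a::real) \<ge> 0"
  interpret Q: prob_space Q by fact
  interpret P: prob_space "density Q g" by fact
  have int1: "integrable Q (\<lambda>x. g x * ln (g x))"
    using int by (subst (asm) integrable_real_density) (auto simp: nonneg)
  have eq1: "(\<integral>x. g x * ln (g x) \<partial>Q) \<le> K"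
    using K by (subst (asm) integral_real_density) (auto simp: nonneg)
  have "integrable (density Q g) (\<lambda>x. 1::real)" by simp
  then have int2: "integrable Q g"
    by (subst (asm) integrable_real_density) (auto simp: nonneg)
  have "(\<integral>x. 1 \<partial>density Q g) = (1::real)" using P.prob_space by simp
  then have eq2: "(\<integral>x. g x \<partial>Q) = 1"
    by (subst (asm) integral_real_density) (auto simp: nonneg)
  have int3: "integrable Q (\<lambda>x. g x * indicator A x)"
    using int2 by (rule integrable_real_mult_indicator[OF A])
  have "measure (density Q g) A = (\<integral>x. indicator A x \<partial>density Q g)"
    by simp
  also have "\<dots> = (\<integral>x. g x * indicator A x \<partial>Q)"
    by (subst integral_real_density) (auto simp: nonneg)
  finally have "a * measure (density Q g) A = (\<integral>x. a * (g x * indicator A x) \<partial>Q)"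
    by simp
  also have "\<dots> \<le> (\<integral>x. (g x * ln (g x) - g x + 1) + (exp a - 1) * indicator A x \<partial>Q)"
  proof (rule integral_mono)
    show "integrable Q (\<lambda>x. a * (g x * indicat_real A x))" using int3 by simp
    show "integrable Q (\<lambda>x. g x * ln (g x) - g x + 1 + (exp a - 1) * indicat_real A x)"
      using int1 int2 by (intro Bochner_Integration.integrable_add
        Bochner_Integration.integrable_diff integrable_mult_right)
        (auto simp: Q.emeasure_eq_measure)
    \<comment> \<open>Young's inequality with parameter \<open>a\<close> on \<open>A\<close> and
      with parameter 0 off \<open>A\<close>; the right-hand sides differ exactly by
      \<open>exp a - 1\<close>.\<close>
    show "a * (g x * indicat_real A x) \<le> g x * ln (g x) - g x + 1 + (exp a - 1) * indicat_real A x"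
      for x using fenchel_entropy[OF nonneg[of x], of a] fenchel_entropy[OF nonneg[of x], of 0]
      by (auto simp: indicator_def)
  qed
  also have "\<dots> = (\<integral>x. g x * ln (g x) \<partial>Q) - 1 + 1 + (exp a - 1) * measure Q A"
    using int1 int2 eq2 Q.prob_space by (simp add: Q.emeasure_eq_measure)
  finally show "a * measure (density Q g) A \<le> K + (exp a - 1) * measure Q A"
    using eq1 by simp
qed

lemma PiM_density:
  fixes g :: "'i \<Rightarrow> 'a \<Rightarrow> real"
  assumes I: "finite I" and Q: "\<And>i. prob_space (Q i)"
    and P: "\<And>i. prob_space (density (Q i) (g i))"
    and g: "\<And>i. g i \<in> borel_measurable (Q i)" and nonneg: "\<And>i x. g i x \<ge> 0"
  shows "PiM I (\<lambda>i. density (Q i) (g i)) = density (PiM I Q) (\<lambda>y. \<Prod>i\<in>I. g i (y i))"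
proof (rule product_sigma_finite.PiM_eqI[symmetric, OF _ I])
  note g[measurable]
  interpret Q: product_prob_space Q by (simp add: product_prob_spaceI Q)
  interpret P: product_prob_space "\<lambda>i. density (Q i) (g i)" by (simp add: product_prob_spaceI P)
  show "product_sigma_finite (\<lambda>i. density (Q i) (g i))" by unfold_locales
  show "sets (density (PiM I Q) (\<lambda>y. \<Prod>i\<in>I. g i (y i))) = sets (PiM I (\<lambda>i. density (Q i) (g i)))"
    by (simp cong: sets_PiM_cong)
  fix A assume A: "\<And>i. i \<in> I \<Longrightarrow> A i \<in> sets (density (Q i) (g i))"
  then have A'[measurable]: "\<And>i. i \<in> I \<Longrightarrow> A i \<in> sets (Q i)" by simp
  have 1: "(\<lambda>y. \<Prod>i\<in>I. ennreal (g i (y i))) \<in> borel_measurable (PiM I Q)"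
    by measurable
  have [measurable]: "Pi\<^sub>E I A \<in> sets (PiM I Q)" using I A' by (rule sets_PiM_I_finite)
  have "emeasure (density (PiM I Q) (\<lambda>y. \<Prod>i\<in>I. g i (y i))) (Pi\<^sub>E I A)
      = (\<integral>\<^sup>+y. (\<Prod>i\<in>I. ennreal (g i (y i))) * indicator (Pi\<^sub>E I A) y \<partial>PiM I Q)"
    using 1 by (simp add: emeasure_density prod_ennreal[symmetric] nonneg)
  also have "\<dots> = (\<integral>\<^sup>+y. (\<Prod>i\<in>I. ennreal (g i (y i)) * indicator (A i) (y i)) \<partial>PiM I Q)"
  proof (rule nn_integral_cong)
    fix y assume y: "y \<in> space (PiM I Q)"
    have "indicator (Pi\<^sub>E I A) y = (\<Prod>i\<in>I. indicator (A i) (y i) :: ennreal)"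
    proof (cases "y \<in> Pi\<^sub>E I A")
      case True then show ?thesis by (auto simp: PiE_iff)
    next
      case False
      then obtain i where "i \<in> I" "y i \<notin> A i" using y by (auto simp: PiE_iff space_PiM)
      then have "(\<Prod>i\<in>I. indicator (A i) (y i) :: ennreal) = 0"
        using I by (intro prod_zero) (auto intro!: bexI[of _ i])
      then show ?thesis using False by simp
    qed
    then show "(\<Prod>i\<in>I. ennreal (g i (y i))) * indicator (Pi\<^sub>E I A) y
        = (\<Prod>i\<in>I. ennreal (g i (y i)) * indicator (A i) (y i))"
      by (simp add: prod.distrib)
  qed
  also have "\<dots> = (\<Prod>i\<in>I. (\<integral>\<^sup>+x. ennreal (g i x) * indicator (A i) x \<partial>Q i))"
    using I by (subst Q.product_nn_integral_prod) auto
  also have "\<dots> = (\<Prod>i\<in>I. emeasure (density (Q i) (g i)) (A i))"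
    by (intro prod.cong) (auto simp: emeasure_density)
  finally show "emeasure (density (PiM I Q) (\<lambda>y. ennreal (\<Prod>i\<in>I. g i (y i)))) (Pi\<^sub>E I A) =
    (\<Prod>i\<in>I. emeasure (density (Q i) (\<lambda>x. ennreal (g i x))) (A i))" .
qed

text \<open>Divergences add over a product: the log-density of the product is the sum of those of
  the factors, and the marginals of the product are the factors.\<close>

lemma tilt_bounded_PiM_density:
  fixes g :: "'i \<Rightarrow> 'a \<Rightarrow> real"
  assumes I: "finite I" and Q: "\<And>i. prob_space (Q i)"
    and P: "\<And>i. prob_space (density (Q i) (g i))"
    and g: "\<And>i. g i \<in> borel_measurable (Q i)" and nonneg: "\<And>i x. g i x \<ge> 0"
    and int: "\<And>i. i \<in> I \<Longrightarrow> integrable (density (Q i) (g i)) (\<lambda>x. ln (g i x))"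
    and K: "\<And>i. i \<in> I \<Longrightarrow> (\<integral>x. ln (g i x) \<partial>density (Q i) (g i)) \<le> K i"
  shows "tilt_bounded (\<Sum>i\<in>I. K i) (PiM I (\<lambda>i. density (Q i) (g i))) (PiM I Q)"
proof -
  note g[measurable]
  let ?P = "\<lambda>i. density (Q i) (g i)"
  have eq: "PiM I ?P = density (PiM I Q) (\<lambda>y. \<Prod>i\<in>I. g i (y i))"
    by (rule PiM_density[OF I Q P g nonneg])
  have comp: "distr (PiM I ?P) (?P i) (\<lambda>y. y i) = ?P i" if "i \<in> I" for i
    using P that by (intro distr_PiM_component) auto
  have int': "integrable (PiM I ?P) (\<lambda>y. ln (g i (y i)))"
    and K': "(\<integral>y. ln (g i (y i)) \<partial>PiM I ?P) \<le> K i" if i: "i \<in> I" for i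
  proof -
    have m: "(\<lambda>y. y i) \<in> PiM I ?P \<rightarrow>\<^sub>M ?P i" using i by simp
    have l: "(\<lambda>x. ln (g i x)) \<in> borel_measurable (?P i)" by measurable
    show "integrable (PiM I ?P) (\<lambda>y. ln (g i (y i)))"
      using integrable_distr_eq[OF m l] comp[OF i] int[OF i] by simp
    show "(\<integral>y. ln (g i (y i)) \<partial>PiM I ?P) \<le> K i"
      using integral_distr[OF m l] comp[OF i] K[OF i] by simp
  qed
  \<comment> \<open>The measure with density \<open>g i\<close> does not charge the zeros of
    \<open>g i\<close>, so the value of \<open>ln\<close> at 0 does not matter: almost surely all
    factors are positive and the logarithm of the product splits.\<close>
  have "AE x in ?P i. g i x > 0" for i
    using nonneg[of i] by (subst AE_density) (auto simp: order.strict_iff_order)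
  then have "AE y in PiM I ?P. g i (y i) > 0" if "i \<in> I" for i
    using P that by (intro AE_PiM_component) auto
  then have "AE y in PiM I ?P. \<forall>i\<in>I. g i (y i) > 0"
    using I by (intro AE_finite_allI) auto
  then have ae: "AE y in PiM I ?P. ln (\<Prod>i\<in>I. g i (y i)) = (\<Sum>i\<in>I. ln (g i (y i)))"
    by eventually_elim (use I in \<open>auto intro!: ln_prod\<close>)
  have sets_eq: "sets (PiM I ?P) = sets (PiM I Q)" by (simp cong: sets_PiM_cong)
  have mQ: "(\<lambda>y. \<Prod>i\<in>I. g i (y i)) \<in> borel_measurable (PiM I Q)" by measurable
  then have m1: "(\<lambda>y. ln (\<Prod>i\<in>I. g i (y i))) \<in> borel_measurable (PiM I ?P)"
    by (simp add: measurable_cong_sets[OF sets_eq refl])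
  have intS: "integrable (PiM I ?P) (\<lambda>y. \<Sum>i\<in>I. ln (g i (y i)))"
    using int' by (intro Bochner_Integration.integrable_sum) auto
  have intL: "integrable (PiM I ?P) (\<lambda>y. ln (\<Prod>i\<in>I. g i (y i)))"
    using intS by (rule integrable_cong_AE_imp) (use m1 ae in auto)
  have "(\<integral>y. ln (\<Prod>i\<in>I. g i (y i)) \<partial>PiM I ?P) = (\<integral>y. (\<Sum>i\<in>I. ln (g i (y i))) \<partial>PiM I ?P)"
    using m1 intS ae by (intro integral_cong_AE) auto
  also have "\<dots> = (\<Sum>i\<in>I. (\<integral>y. ln (g i (y i)) \<partial>PiM I ?P))"
    using int' by (intro Bochner_Integration.integral_sum) auto
  also have "\<dots> \<le> (\<Sum>i\<in>I. K i)" using K' by (intro sum_mono) auto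
  finally have "tilt_bounded (\<Sum>i\<in>I. K i) (density (PiM I Q) (\<lambda>y. \<Prod>i\<in>I. g i (y i))) (PiM I Q)"
    using intL Q P mQ unfolding eq
    by (intro tilt_bounded_density)
       (auto intro!: prod_nonneg nonneg prob_space_PiM simp: eq[symmetric])
  then show ?thesis by (simp add: eq)
qed

text \<open>A finite bound rules out the infinite branch of \<open>KL\<close>, and the Radon-Nikodym
  derivative of a finite measure is finite almost everywhere, so it may be taken real
  valued.\<close>

lemma KL_le_imp_density:
  assumes P: "prob_space P" and Q: "prob_space Q" and sets: "sets P = sets Q"
    and KL: "KL P Q \<le> ereal K"
  obtains g :: "'a \<Rightarrow> real" where "P = density Q g" "g \<in> borel_measurable Q" "\<And>x. g x \<ge> 0"
    "integrable P (\<lambda>x. ln (g x))" "(\<integral>x. ln (g x) \<partial>P) \<le> K"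
proof
  interpret P: prob_space P by fact
  interpret Q: prob_space Q by fact
  let ?g = "\<lambda>x. enn2real (RN_deriv Q P x)"
  have ac: "absolutely_continuous Q P" and int: "integrable P (entropy_density (exp 1) Q P)"
    and K: "KL_divergence (exp 1) Q P \<le> K"
    using KL by (auto simp: KL_def split: if_splits)
  have dens: "density Q (RN_deriv Q P) = P"
    using Q.density_RN_deriv[OF ac] sets by simp
  have "AE x in Q. RN_deriv Q P x \<noteq> \<infinity>"
    using Q.RN_deriv_finite[OF _ ac] sets P.sigma_finite_measure_axioms by simp
  then have "AE x in Q. RN_deriv Q P x = ennreal (?g x)"
    by eventually_elim (simp add: less_top)
  then have "density Q (RN_deriv Q P) = density Q ?g"
    by (intro density_cong) auto
  then show "P = density Q ?g" using dens by simp
  have ed: "entropy_density (exp 1) Q P = (\<lambda>x. ln (?g x))"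
    by (auto simp: entropy_density_def log_def)
  show "integrable P (\<lambda>x. ln (?g x))" "(\<integral>x. ln (?g x) \<partial>P) \<le> K"
    using int K by (simp_all add: ed KL_divergence_def)
qed auto

lemma tilt_bounded_PiM:
  assumes I: "finite I" and P: "\<And>i. prob_space (P i)" and Q: "\<And>i. prob_space (Q i)"
    and sets: "\<And>i. sets (P i) = sets (Q i)" and KL: "\<And>i. KL (P i) (Q i) \<le> ereal (K i)"
  shows "tilt_bounded (\<Sum>i\<in>I. K i) (PiM I P) (PiM I Q)"
proof -
  have "\<forall>i. \<exists>g :: 'b \<Rightarrow> real. P i = density (Q i) g \<and> g \<in> borel_measurable (Q i) \<and> (\<forall>x. g x \<ge> 0) \<and>
      integrable (P i) (\<lambda>x. ln (g x)) \<and> (\<integral>x. ln (g x) \<partial>P i) \<le> K i"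
    using KL_le_imp_density[OF P Q sets KL] by metis
  then obtain g :: "'a \<Rightarrow> 'b \<Rightarrow> real" where g: "\<And>i. P i = density (Q i) (g i)"
      "\<And>i. g i \<in> borel_measurable (Q i)" "\<And>i x. g i x \<ge> 0"
      "\<And>i. integrable (P i) (\<lambda>x. ln (g i x))" "\<And>i. (\<integral>x. ln (g i x) \<partial>P i) \<le> K i"
    by metis
  have Peq: "P = (\<lambda>i. density (Q i) (g i))" using g(1) by auto
  show ?thesis unfolding Peq
    using g P by (intro tilt_bounded_PiM_density I Q) (simp_all add: g(1)[symmetric])
qed

text \<open>A substitute for Pinsker's inequality. With a = 1/8 and exp (1/8) \<le> 1 + 1/8 + 1/64,
  the tilt inequality times 8 reads P(A) \<le> 8 K + (9/8) Q(A), and 8/64 + 1/8 = 1/4. This is the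
  origin of the threshold 1/64 on the two-point divergences.\<close>

lemma tilt_bounded_diff:
  assumes "tilt_bounded K P Q" and "prob_space Q" and "A \<in> sets Q" and "K \<le> 1 / 64"
  shows "measure P A - measure Q A \<le> 1 / 4"
proof -
  have "(1/8) * measure P A \<le> K + (exp (1/8) - 1) * measure Q A"
    using assms(1,3) unfolding tilt_bounded_def by (elim ballE allE[of _ "1/8"]) auto
  also have "\<dots> \<le> 1/64 + (1/8 + (1/8)\<^sup>2) * measure Q A"
    using exp_bound[of "1/8"] assms by (intro add_mono mult_right_mono) auto
  finally have "measure P A \<le> 1/8 + (9/8) * measure Q A" by (simp add: power2_eq_square)
  moreover have "measure Q A \<le> 1" using assms(2) by (rule prob_space.prob_le_1)
  ultimately show ?thesis by simp
qed

section \<open>The law of the observations as a product of shifted noise laws\<close>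

lemma obs_law_eq_PiM:
  fixes P :: "(real^'d) measure"
  assumes P: "prob_space P" "sets P = sets borel"
  shows "obs_law P D (f, xs, Ts) = 
    PiM (obs_index (D Ts)) (\<lambda>k. distr P borel (\<lambda>e. flow f (xs ! fst k) (D Ts ! fst k ! snd k) + e))"
proof -
  let ?I = "obs_index (D Ts)"
  let ?v = "\<lambda>k. flow f (xs ! fst k) (D Ts ! fst k ! snd k)"
  have fin: "finite ?I" by (auto simp: obs_index_def)
  have m: "(\<lambda>e. v + e) \<in> P \<rightarrow>\<^sub>M borel" for v
    unfolding measurable_cong_sets[OF P(2) refl] by measurable
  have pr: "prob_space (distr P borel (\<lambda>e. v + e))" for v
    using prob_space.prob_space_distr[OF P(1) m] .
  interpret S: product_prob_space "\<lambda>k. distr P borel (\<lambda>e. ?v k + e)"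
    by (intro product_prob_spaceI pr)
  interpret PP: product_prob_space "\<lambda>k::nat\<times>nat. P" by (intro product_prob_spaceI P)
  let ?T = "\<lambda>\<epsilon>. \<lambda>k\<in>?I. ?v k + \<epsilon> k"
  have Tm: "?T \<in> PiM ?I (\<lambda>_. P) \<rightarrow>\<^sub>M PiM ?I (\<lambda>_. borel)"
  proof (rule measurable_restrict)
    fix k assume k: "k \<in> ?I"
    show "(\<lambda>x. ?v k + x k) \<in> borel_measurable (Pi\<^sub>M ?I (\<lambda>_. P))"
      using measurable_compose[OF measurable_component_singleton[OF k] m] by simp
  qed
  have "distr (PiM ?I (\<lambda>_. P)) (PiM ?I (\<lambda>_. borel)) ?T = PiM ?I (\<lambda>k. distr P borel (\<lambda>e. ?v k + e))"
  proof (rule S.PiM_eqI[OF fin])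
    show "sets (distr (PiM ?I (\<lambda>_. P)) (PiM ?I (\<lambda>_. borel)) ?T) = sets (PiM ?I (\<lambda>k. distr P borel (\<lambda>e. ?v k + e)))"
      by (simp cong: sets_PiM_cong)
    fix A assume A: "\<And>k. k \<in> ?I \<Longrightarrow> A k \<in> sets (distr P borel (\<lambda>e. ?v k + e))"
    then have A': "Pi\<^sub>E ?I A \<in> sets (PiM ?I (\<lambda>_. borel))"
      using fin by (intro sets_PiM_I_finite) auto
    have "?T -` Pi\<^sub>E ?I A \<inter> space (PiM ?I (\<lambda>_. P)) = (\<Pi>\<^sub>E k\<in>?I. (\<lambda>e. ?v k + e) -` A k \<inter> space P)"
      by (fastforce simp: space_PiM PiE_iff extensional_def)
    then show "emeasure (distr (PiM ?I (\<lambda>_. P)) (PiM ?I (\<lambda>_. borel)) ?T) (Pi\<^sub>E ?I A) =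
      (\<Prod>k\<in>?I. emeasure (distr P borel (\<lambda>e. ?v k + e)) (A k))"
      using A A' Tm m fin by (simp add: emeasure_distr PP.emeasure_PiM measurable_sets)
  qed
  moreover have "(\<lambda>\<epsilon>. \<lambda>(j, i)\<in>?I. flow f (xs ! j) (D Ts ! j ! i) + \<epsilon> (j, i)) = ?T"
    by (auto simp: fun_eq_iff restrict_def)
  ultimately show ?thesis by (simp add: obs_space_def)
qed

lemma space_obs_law: "space (obs_law P D (f, xs, Ts)) = space (obs_space (D Ts))"
  and sets_obs_law: "sets (obs_law P D (f, xs, Ts)) = sets (obs_space (D Ts))"
  by simp_all

lemma prob_space_obs_law:
  assumes "prob_space P" "sets P = sets borel"
  shows "prob_space (obs_law P D (f, xs, Ts))"
proof -
  have m: "(\<lambda>e. v + e) \<in> P \<rightarrow>\<^sub>M borel" for v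
    unfolding measurable_cong_sets[OF assms(2) refl] by measurable
  show ?thesis unfolding obs_law_eq_PiM[OF assms]
    by (intro prob_space_PiM prob_space.prob_space_distr assms m)
qed

lemma tilt_bounded_obs_law:
  assumes P: "prob_space P" "sets P = sets borel" and noise: "noise_condition Cn P"
  shows "tilt_bounded (\<Sum>(j, i)\<in>obs_index (D Ts).
      Cn * (norm (flow f (xs ! j) (D Ts ! j ! i) - flow f' (xs ! j) (D Ts ! j ! i)))\<^sup>2)
    (obs_law P D (f, xs, Ts)) (obs_law P D (f', xs, Ts))"
proof -
  have m: "(\<lambda>e. v + e) \<in> P \<rightarrow>\<^sub>M borel" for v
    unfolding measurable_cong_sets[OF P(2) refl] by measurable
  show ?thesis unfolding obs_law_eq_PiM[OF P] case_prod_unfold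
    using noise unfolding noise_condition_def
    by (intro tilt_bounded_PiM prob_space.prob_space_distr P m) (auto simp: obs_index_def)
qed

section \<open>Bumps on a lattice of cells\<close>

text \<open>The \<open>n\<close>-th derivative of (s (1 - s))^m. Finite smoothness is enough, since
  only derivatives of the bump up to order \<open>l + 1\<close> occur, and with polynomials all of
  them are explicit.\<close>

definition bump_poly :: "nat \<Rightarrow> nat \<Rightarrow> real poly" where
  "bump_poly m n = (pderiv ^^ n) ([:0, 1, -1:] ^ m)"

definition bump :: "nat \<Rightarrow> nat \<Rightarrow> real \<Rightarrow> real" where
  "bump m n s = (if 0 < s \<and> s < 1 then poly (bump_poly m n) s else 0)"

text \<open>Each differentiation costs at most one factor s (1 - s).\<close>

lemma dvd_bump_poly: "n \<le> m \<Longrightarrow> [:0, 1, -1:] ^ (m - n) dvd bump_poly m n"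
proof (induction n)
  case (Suc n)
  let ?Q = "[:0, 1, -1:] :: real poly"
  obtain k where k: "m - n = Suc k" "m - Suc n = k" using Suc.prems by (cases "m - n") auto
  have "?Q ^ Suc k dvd bump_poly m n" using Suc.IH Suc.prems unfolding k by linarith
  then obtain w where w: "bump_poly m n = ?Q ^ Suc k * w" by (rule dvdE)
  have "bump_poly m (Suc n) = pderiv (?Q ^ Suc k * w)" by (simp add: bump_poly_def w[unfolded bump_poly_def])
  also have "\<dots> = ?Q ^ k * (?Q * pderiv w + smult (of_nat (Suc k)) (pderiv ?Q) * w)"
    by (simp only: pderiv_mult pderiv_power_Suc) (simp add: algebra_simps)
  finally show ?case unfolding k by (metis dvd_triv_left)
qed (simp add: bump_poly_def)

lemma poly_bump_poly_endpoints:
  assumes "n < m"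
  shows "poly (bump_poly m n) 0 = 0" "poly (bump_poly m n) 1 = 0"
proof -
  obtain k where k: "m - n = Suc k" using assms by (cases "m - n") auto
  have "[:0, 1, -1:] ^ Suc k dvd bump_poly m n"
    using dvd_bump_poly[of n m] assms unfolding k by linarith
  then obtain w where "bump_poly m n = [:0, 1, -1:] ^ Suc k * w" by (rule dvdE)
  then show "poly (bump_poly m n) 0 = 0" "poly (bump_poly m n) 1 = 0" by simp_all
qed

text \<open>Glues the bump to zero at the ends of the unit interval: there it is dominated by a
  polynomial that vanishes together with its first derivative.\<close>

lemma DERIV_zero_dominated:
  fixes f g :: "real \<Rightarrow> real"
  assumes g: "(g has_real_derivative 0) (at a)" "g a = 0" and f: "\<And>x. \<bar>f x\<bar> \<le> \<bar>g x\<bar>"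
  shows "(f has_real_derivative 0) (at a)"
proof -
  have "f a = 0" using f[of a] g(2) by simp
  have "((\<lambda>x. (g x - g a) / (x - a)) \<longlongrightarrow> 0) (at a)" using g(1) by (simp add: has_field_derivative_iff)
  then have "((\<lambda>x. \<bar>(g x - g a) / (x - a)\<bar>) \<longlongrightarrow> 0) (at a)" by (rule tendsto_rabs_zero)
  then have "((\<lambda>x. (f x - f a) / (x - a)) \<longlongrightarrow> 0) (at a)"
    by (rule Lim_null_comparison[rotated])
      (auto simp: g(2) \<open>f a = 0\<close> f intro!: always_eventually divide_right_mono)
  then show ?thesis by (simp add: has_field_derivative_iff)
qed

lemma bump_deriv:
  assumes "n + 2 \<le> m"
  shows "(bump m n has_real_derivative bump m (Suc n) s) (at s)"
proof -
  have poly: "(poly (bump_poly m n) has_real_derivative poly (bump_poly m (Suc n)) s) (at s)" for s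
    by (simp add: bump_poly_def poly_DERIV)
  consider "0 < s" "s < 1" | "s < 0" | "s > 1" | "s = 0" | "s = 1" by linarith
  then show ?thesis
  proof cases
    case 1
    have "(bump m n has_real_derivative poly (bump_poly m (Suc n)) s) (at s)"
      by (rule DERIV_cong_ev[THEN iffD1, OF refl _ refl poly])
        (use 1 in \<open>auto simp: bump_def intro!: eventually_nhds_in_open[of "{0<..<1}", THEN eventually_mono]\<close>)
    then show ?thesis using 1 by (simp add: bump_def)
  next
    case 2
    have "(bump m n has_real_derivative 0) (at s)"
      by (rule DERIV_cong_ev[THEN iffD1, OF refl _ refl DERIV_const[of 0]])
        (use 2 in \<open>auto simp: bump_def intro!: eventually_nhds_in_open[of "{..<0}", THEN eventually_mono]\<close>)
    then show ?thesis using 2 by (simp add: bump_def)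
  next
    case 3
    have "(bump m n has_real_derivative 0) (at s)"
      by (rule DERIV_cong_ev[THEN iffD1, OF refl _ refl DERIV_const[of 0]])
        (use 3 in \<open>auto simp: bump_def intro!: eventually_nhds_in_open[of "{1<..}", THEN eventually_mono]\<close>)
    then show ?thesis using 3 by (simp add: bump_def)
  next
    case 4
    have "(bump m n has_real_derivative 0) (at 0)"
    proof (rule DERIV_zero_dominated)
      show "(poly (bump_poly m n) has_real_derivative 0) (at 0)"
        using poly[of 0] poly_bump_poly_endpoints[of "Suc n" m] assms by simp
      show "poly (bump_poly m n) 0 = 0" using poly_bump_poly_endpoints[of n m] assms by simp
    qed (simp add: bump_def)
    then show ?thesis using 4 by (simp add: bump_def)
  next
    case 5
    have "(bump m n has_real_derivative 0) (at 1)"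
    proof (rule DERIV_zero_dominated)
      show "(poly (bump_poly m n) has_real_derivative 0) (at 1)"
        using poly[of 1] poly_bump_poly_endpoints[of "Suc n" m] assms by simp
      show "poly (bump_poly m n) 1 = 0" using poly_bump_poly_endpoints[of n m] assms by simp
    qed (simp add: bump_def)
    then show ?thesis using 5 by (simp add: bump_def)
  qed
qed

lemma bump_bounded:
  obtains B where "B \<ge> 1" "\<And>n s. n \<le> m \<Longrightarrow> \<bar>bump m n s\<bar> \<le> B"
proof -
  have "\<exists>B. \<forall>s. \<bar>bump m n s\<bar> \<le> B" for n
  proof -
    have "bounded (poly (bump_poly m n) ` {0..1})"
      by (intro compact_imp_bounded compact_continuous_image continuous_intros) auto
    then obtain B where "\<forall>x\<in>poly (bump_poly m n) ` {0..1}. norm x \<le> B"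
      unfolding bounded_iff by (rule exE)
    then have B: "\<bar>poly (bump_poly m n) s\<bar> \<le> B" if "s \<in> {0..1}" for s using that by simp
    moreover have "B \<ge> 0" using B[of 0] by (auto intro: order_trans[OF abs_ge_zero])
    ultimately show ?thesis by (intro exI[of _ B]) (auto simp: bump_def)
  qed
  then obtain B where B: "\<And>n s. \<bar>bump m n s\<bar> \<le> B n" by metis
  have "\<bar>bump m n s\<bar> \<le> Max (insert 1 (B ` {..m}))" if "n \<le> m" for n s
    using that by (intro order_trans[OF B Max_ge]) auto
  moreover have "Max (insert 1 (B ` {..m})) \<ge> 1" by (intro Max_ge) auto
  ultimately show ?thesis using that by blast
qed

lemma bump_0_range: "0 \<le> bump m 0 s" "bump m 0 s \<le> 1"
proof -
  have eq: "poly (bump_poly m 0) s = (s * (1 - s)) ^ m"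
    by (simp add: bump_poly_def poly_power algebra_simps)
  show "0 \<le> bump m 0 s" by (auto simp: bump_def eq)
  have "s * (1 - s) \<le> 1" if "0 < s" "s < 1" using mult_mono[of s 1 "1 - s" 1] that by simp
  then show "bump m 0 s \<le> 1" by (auto simp: bump_def eq intro!: power_le_one)
qed

lemma bump_0_ge:
  assumes "1/4 \<le> s" "s \<le> 3/4"
  shows "(3/16) ^ m \<le> bump m 0 s"
proof -
  have eq: "poly (bump_poly m 0) s = (s * (1 - s)) ^ m"
    by (simp add: bump_poly_def poly_power algebra_simps)
  have "0 \<le> (s - 1/4) * (3/4 - s)" using assms by simp
  moreover have "(s - 1/4) * (3/4 - s) = s * (1 - s) - 3/16" by (simp add: field_simps)
  ultimately have "3/16 \<le> s * (1 - s)" by linarith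
  then show ?thesis using assms by (auto simp: bump_def eq intro!: power_mono)
qed

text \<open>The cell with index $k$ is $\{x : M (x - z) - k \in (0,1)^d\}$; the sum puts one derivative of
  the product bump, with multi-index \<open>\<alpha>\<close> and without the chain rule factors, into each cell of \<open>K\<close>.\<close>

definition cells_bump ::
  "nat \<Rightarrow> real \<Rightarrow> real^'d \<Rightarrow> ('d \<Rightarrow> int) set \<Rightarrow> ('d::finite \<Rightarrow> nat) \<Rightarrow> real^'d \<Rightarrow> real" where
  "cells_bump m M z K \<alpha> x = (\<Sum>k\<in>K. \<Prod>i\<in>UNIV. bump m (\<alpha> i) (M * (x $ i - z $ i) - of_int (k i)))"

text \<open>The bumps live on disjoint open cells, so only the cell given by the coordinatewise
  floor can contribute. The bounds that follow are therefore independent of the number of cells in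
  \<open>K\<close>.\<close>

lemma cells_bump_eq:
  fixes K :: "('d::finite \<Rightarrow> int) set"
  assumes "finite K"
  shows "cells_bump m M z K \<alpha> x = (let k = (\<lambda>i. \<lfloor>M * (x $ i - z $ i)\<rfloor>) in
    if k \<in> K then \<Prod>i\<in>UNIV. bump m (\<alpha> i) (M * (x $ i - z $ i) - of_int (k i)) else 0)"
proof -
  define k0 where "k0 i = \<lfloor>M * (x $ i - z $ i)\<rfloor>" for i
  let ?t = "\<lambda>k. \<Prod>i\<in>UNIV. bump m (\<alpha> i) (M * (x $ i - z $ i) - of_int (k i))"
  have "?t k = 0" if neq: "k \<noteq> k0" for k
  proof -
    obtain i where "k i \<noteq> k0 i" using neq unfolding fun_eq_iff by blast
    then have "bump m (\<alpha> i) (M * (x $ i - z $ i) - of_int (k i)) = 0"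
      using floor_unique[of "k i" "M * (x $ i - z $ i)"] unfolding bump_def k0_def by auto
    then show ?thesis by (intro prod_zero) auto
  qed
  then have "cells_bump m M z K \<alpha> x = (\<Sum>k\<in>K. if k = k0 then ?t k else 0)"
    unfolding cells_bump_def by (intro sum.cong) auto
  also have "\<dots> = (if k0 \<in> K then ?t k0 else 0)" using assms by simp
  finally show ?thesis by (simp add: k0_def[abs_def] Let_def)
qed

lemma cells_bump_bounded:
  fixes K :: "('d::finite \<Rightarrow> int) set"
  assumes "finite K" and B: "B \<ge> 0" "\<And>n s. n \<le> m \<Longrightarrow> \<bar>bump m n s\<bar> \<le> B" and \<alpha>: "\<And>i. \<alpha> i \<le> m"
  shows "\<bar>cells_bump m M z K \<alpha> x\<bar> \<le> B ^ CARD('d)"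
proof -
  have "\<bar>\<Prod>i\<in>UNIV. bump m (\<alpha> i) (M * (x $ i - z $ i) - of_int (k i))\<bar> \<le> B ^ CARD('d)" for k :: "'d \<Rightarrow> int"
  proof -
    have "(\<Prod>i\<in>(UNIV::'d set). \<bar>bump m (\<alpha> i) (M * (x $ i - z $ i) - of_int (k i))\<bar>) \<le> (\<Prod>i\<in>(UNIV::'d set). B)"
      using B(2) \<alpha> by (intro prod_mono) auto
    then show ?thesis by (simp add: abs_prod)
  qed
  then show ?thesis using B(1) by (simp add: cells_bump_eq[OF assms(1)] Let_def)
qed

lemma cells_bump_0_range:
  assumes "finite K"
  shows "0 \<le> cells_bump m M z K (\<lambda>_. 0) x" "cells_bump m M z K (\<lambda>_. 0) x \<le> 1"
  unfolding cells_bump_eq[OF assms] Let_def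
  by (auto intro!: prod_nonneg prod_le_1 simp: bump_0_range)

lemma cells_bump_deriv:
  fixes K :: "('d::finite \<Rightarrow> int) set" and z :: "real^'d"
  assumes \<alpha>: "\<And>i. \<alpha> i + 2 \<le> m"
  shows "(cells_bump m M z K \<alpha> has_derivative
    (\<lambda>v. M * (\<Sum>j\<in>UNIV. v $ j * cells_bump m M z K (\<alpha>(j := Suc (\<alpha> j))) x))) (at x)"
proof -
  have 1: "((\<lambda>x. bump m (\<alpha> i) (M * (x $ i - z $ i) - of_int (k i))) has_derivative
      (\<lambda>v. M * v $ i * bump m (Suc (\<alpha> i)) (M * (x $ i - z $ i) - of_int (k i)))) (at x)"
    for i and k :: "'d \<Rightarrow> int"
  proof -
    have "((\<lambda>x. M * (x $ i - z $ i) - of_int (k i)) has_derivative (\<lambda>v. M * v $ i)) (at x)"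
      by (auto intro!: derivative_eq_intros bounded_linear_imp_has_derivative bounded_linear_vec_nth)
    from has_derivative_compose[OF this bump_deriv[OF \<alpha>, unfolded has_field_derivative_def]]
    show ?thesis by (simp add: mult.commute)
  qed
  have upd: "(\<Prod>i\<in>UNIV. bump m ((\<alpha>(j := Suc (\<alpha> j))) i) (M * (x $ i - z $ i) - of_int (k i))) =
      bump m (Suc (\<alpha> j)) (M * (x $ j - z $ j) - of_int (k j)) *
      (\<Prod>i\<in>UNIV - {j}. bump m (\<alpha> i) (M * (x $ i - z $ i) - of_int (k i)))" for j and k :: "'d \<Rightarrow> int"
    by (subst prod.remove[of _ j]) (auto intro!: prod.cong)
  have "(cells_bump m M z K \<alpha> has_derivative (\<lambda>v. \<Sum>k\<in>K. \<Sum>j\<in>UNIV.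
      M * v $ j * bump m (Suc (\<alpha> j)) (M * (x $ j - z $ j) - of_int (k j)) *
      (\<Prod>i\<in>UNIV - {j}. bump m (\<alpha> i) (M * (x $ i - z $ i) - of_int (k i))))) (at x)"
    unfolding cells_bump_def[abs_def] by (intro has_derivative_sum has_derivative_prod 1)
  also have "(\<lambda>v. \<Sum>k\<in>K. \<Sum>j\<in>UNIV.
      M * v $ j * bump m (Suc (\<alpha> j)) (M * (x $ j - z $ j) - of_int (k j)) *
      (\<Prod>i\<in>UNIV - {j}. bump m (\<alpha> i) (M * (x $ i - z $ i) - of_int (k i)))) =
    (\<lambda>v. M * (\<Sum>j\<in>UNIV. v $ j * cells_bump m M z K (\<alpha>(j := Suc (\<alpha> j))) x))"
    unfolding cells_bump_def upd
    by (subst sum.swap) (simp only: sum_distrib_left mult.assoc)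
  finally show ?thesis .
qed

text \<open>The iterated derivative as an explicit multilinear form: every direction raises one
  index of the multi-index, summed over the coordinates, and brings a chain rule factor
  \<open>M\<close>.\<close>

primrec cells_form ::
  "nat \<Rightarrow> real \<Rightarrow> real^'d \<Rightarrow> ('d \<Rightarrow> int) set \<Rightarrow> (real^'d) list \<Rightarrow> ('d::finite \<Rightarrow> nat) \<Rightarrow> real^'d \<Rightarrow> real" where
  "cells_form m M z K [] \<alpha> x = cells_bump m M z K \<alpha> x"
| "cells_form m M z K (v # vs) \<alpha> x =
     M * (\<Sum>j\<in>UNIV. v $ j * cells_form m M z K vs (\<alpha>(j := Suc (\<alpha> j))) x)"

text \<open>Differentiation puts the new direction in front, while the induction produces it behind
  \<open>w\<close>. The two agree because raising indices commutes, which is the symmetry of mixed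
  derivatives.\<close>

lemma cells_form_deriv:
  fixes K :: "('d::finite \<Rightarrow> int) set" and z :: "real^'d"
  assumes "\<And>i. \<alpha> i + length vs + 2 \<le> m"
  shows "(cells_form m M z K vs \<alpha> has_derivative (\<lambda>v. cells_form m M z K (v # vs) \<alpha> x)) (at x)"
  using assms
proof (induction vs arbitrary: \<alpha>)
  case Nil
  then show ?case using cells_bump_deriv[of \<alpha> m M z K x] by (simp add: cells_form.simps(1)[abs_def])
next
  case (Cons w vs)
  let ?s = "\<lambda>\<alpha> j. \<alpha>(j := Suc (\<alpha> j)) :: 'd \<Rightarrow> nat"
  have comm: "?s (?s \<alpha> j) i = ?s (?s \<alpha> i) j" for i j by auto
  have IH: "(cells_form m M z K vs (?s \<alpha> j) has_derivative
      (\<lambda>v. cells_form m M z K (v # vs) (?s \<alpha> j) x)) (at x)" for j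
  proof (rule Cons.IH)
    show "?s \<alpha> j i + length vs + 2 \<le> m" for i using Cons.prems[of i] Cons.prems[of j] by (cases "i = j") auto
  qed
  have "(cells_form m M z K (w # vs) \<alpha> has_derivative
      (\<lambda>v. M * (\<Sum>j\<in>UNIV. w $ j * cells_form m M z K (v # vs) (?s \<alpha> j) x))) (at x)"
    unfolding cells_form.simps(2)[of m M z K w vs \<alpha>, abs_def]
    by (intro has_derivative_mult_right has_derivative_sum IH)
  also have "(\<lambda>v. M * (\<Sum>j\<in>UNIV. w $ j * cells_form m M z K (v # vs) (?s \<alpha> j) x)) =
      (\<lambda>v. cells_form m M z K (v # w # vs) \<alpha> x)"
  proof
    fix v
    have "(\<Sum>j\<in>UNIV. w $ j * (M * (\<Sum>i\<in>UNIV. v $ i * cells_form m M z K vs (?s (?s \<alpha> j) i) x))) =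
        (\<Sum>j\<in>UNIV. \<Sum>i\<in>UNIV. w $ j * M * v $ i * cells_form m M z K vs (?s (?s \<alpha> j) i) x)"
      by (simp add: sum_distrib_left mult.assoc)
    also have "\<dots> = (\<Sum>i\<in>UNIV. \<Sum>j\<in>UNIV. w $ j * M * v $ i * cells_form m M z K vs (?s (?s \<alpha> j) i) x)"
      by (rule sum.swap)
    also have "\<dots> = (\<Sum>i\<in>UNIV. \<Sum>j\<in>UNIV. v $ i * (M * (w $ j * cells_form m M z K vs (?s (?s \<alpha> i) j) x)))"
      unfolding comm[of _ _] by (intro sum.cong refl) (simp add: comm)
    also have "\<dots> = (\<Sum>i\<in>UNIV. v $ i * (M * (\<Sum>j\<in>UNIV. w $ j * cells_form m M z K vs (?s (?s \<alpha> i) j) x)))"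
      by (simp add: sum_distrib_left)
    finally show "M * (\<Sum>j\<in>UNIV. w $ j * cells_form m M z K (v # vs) (?s \<alpha> j) x) =
      cells_form m M z K (v # w # vs) \<alpha> x" by simp
  qed
  finally show ?case .
qed

lemma abs_sum_nth_le:
  fixes v :: "real^'d"
  assumes "\<And>j. \<bar>a j\<bar> \<le> A"
  shows "\<bar>\<Sum>j\<in>UNIV. v $ j * a j\<bar> \<le> real CARD('d) * norm v * A"
proof -
  have "\<bar>\<Sum>j\<in>UNIV. v $ j * a j\<bar> \<le> (\<Sum>j\<in>UNIV. \<bar>v $ j * a j\<bar>)" by (rule sum_abs)
  also have "\<dots> \<le> (\<Sum>j\<in>(UNIV::'d set). norm v * A)"
    using assms by (intro sum_mono) (auto simp: abs_mult component_le_norm_cart intro!: mult_mono)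
  finally show ?thesis by simp
qed

lemma cells_form_bounded:
  fixes K :: "('d::finite \<Rightarrow> int) set" and z :: "real^'d"
  assumes K: "finite K" and B: "B \<ge> 0" "\<And>n s. n \<le> m \<Longrightarrow> \<bar>bump m n s\<bar> \<le> B" and M: "M \<ge> 0"
    and "\<And>i. \<alpha> i + length vs \<le> m" and "\<forall>v\<in>set vs. norm v = 1"
  shows "\<bar>cells_form m M z K vs \<alpha> x\<bar> \<le> (M * real CARD('d)) ^ length vs * B ^ CARD('d)"
  using assms(5,6)
proof (induction vs arbitrary: \<alpha>)
  case Nil
  then show ?case using cells_bump_bounded[OF K B, of \<alpha> M z x] by simp
next
  case (Cons v vs)
  have "\<bar>cells_form m M z K vs (\<alpha>(j := Suc (\<alpha> j))) x\<bar> \<le>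
      (M * real CARD('d)) ^ length vs * B ^ CARD('d)" for j
  proof (rule Cons.IH)
    show "(\<alpha>(j := Suc (\<alpha> j))) i + length vs \<le> m" for i using Cons.prems(1)[of i] by (cases "i = j") auto
  qed (use Cons.prems in auto)
  from abs_sum_nth_le[OF this, of v] Cons.prems(2) M
  have "M * \<bar>\<Sum>j\<in>UNIV. v $ j * cells_form m M z K vs (\<alpha>(j := Suc (\<alpha> j))) x\<bar> \<le>
      M * (real CARD('d) * ((M * real CARD('d)) ^ length vs * B ^ CARD('d)))"
    by (intro mult_left_mono) auto
  then show ?case using M by (simp add: abs_mult mult_ac)
qed

lemma cells_form_lipschitz:
  fixes K :: "('d::finite \<Rightarrow> int) set" and z :: "real^'d"
  assumes K: "finite K" and B: "B \<ge> 0" "\<And>n s. n \<le> m \<Longrightarrow> \<bar>bump m n s\<bar> \<le> B" and M: "M \<ge> 0"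
    and \<alpha>: "\<And>i. \<alpha> i + length vs + 2 \<le> m" and vs: "\<forall>v\<in>set vs. norm v = 1"
  shows "\<bar>cells_form m M z K vs \<alpha> x - cells_form m M z K vs \<alpha> y\<bar> \<le>
    (M * real CARD('d)) ^ Suc (length vs) * B ^ CARD('d) * norm (x - y)"
proof -
  have "norm (cells_form m M z K vs \<alpha> x - cells_form m M z K vs \<alpha> y) \<le>
    ((M * real CARD('d)) ^ Suc (length vs) * B ^ CARD('d)) * norm (x - y)"
  proof (rule differentiable_bound[OF convex_UNIV])
    fix x :: "real^'d"
    show "(cells_form m M z K vs \<alpha> has_derivative (\<lambda>v. cells_form m M z K (v # vs) \<alpha> x)) (at x within UNIV)"
      using cells_form_deriv[OF \<alpha>] by simp
    show "onorm (\<lambda>v. cells_form m M z K (v # vs) \<alpha> x) \<le> (M * real CARD('d)) ^ Suc (length vs) * B ^ CARD('d)"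
    proof (rule onorm_le)
      fix v :: "real^'d"
      have "\<bar>cells_form m M z K vs (\<alpha>(j := Suc (\<alpha> j))) x\<bar> \<le>
          (M * real CARD('d)) ^ length vs * B ^ CARD('d)" for j
      proof (rule cells_form_bounded[OF K B M _ vs])
        show "(\<alpha>(j := Suc (\<alpha> j))) i + length vs \<le> m" for i using \<alpha>[of i] by (cases "i = j") auto
      qed
      from abs_sum_nth_le[OF this, of v] M
      have "M * \<bar>\<Sum>j\<in>UNIV. v $ j * cells_form m M z K vs (\<alpha>(j := Suc (\<alpha> j))) x\<bar> \<le>
          M * (real CARD('d) * norm v * ((M * real CARD('d)) ^ length vs * B ^ CARD('d)))"
        by (intro mult_left_mono)
      then show "norm (cells_form m M z K (v # vs) \<alpha> x) \<le>
          (M * real CARD('d)) ^ Suc (length vs) * B ^ CARD('d) * norm v"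
        using M by (simp add: abs_mult mult_ac)
    qed
  qed auto
  then show ?thesis by simp
qed

lemma iter_deriv_cells:
  fixes K :: "('d::finite \<Rightarrow> int) set" and z :: "real^'d"
  assumes "length vs + 1 \<le> m"
  shows "iter_deriv (\<lambda>x. a + e * cells_bump m M z K (\<lambda>_. 0) x) vs =
    (\<lambda>x. (if vs = [] then a else 0) + e * cells_form m M z K vs (\<lambda>_. 0) x)"
  using assms
proof (induction vs)
  case (Cons v vs)
  have "(cells_form m M z K vs (\<lambda>_. 0) has_derivative (\<lambda>v. cells_form m M z K (v # vs) (\<lambda>_. 0) x)) (at x)" for x
    by (rule cells_form_deriv) (use Cons.prems in simp)
  then have "((\<lambda>x. (if vs = [] then a else 0) + e * cells_form m M z K vs (\<lambda>_. 0) x) has_derivative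
    (\<lambda>v. 0 + e * cells_form m M z K (v # vs) (\<lambda>_. 0) x)) (at x)" for x
    by (intro has_derivative_add has_derivative_const has_derivative_mult_right)
  from frechet_derivative_at[OF this, symmetric] Cons show ?case by simp
qed simp

lemma differentiable_iter_deriv_cells:
  fixes K :: "('d::finite \<Rightarrow> int) set" and z :: "real^'d"
  assumes "length vs + 2 \<le> m"
  shows "iter_deriv (\<lambda>x. a + e * cells_bump m M z K (\<lambda>_. 0) x) vs differentiable (at x)"
proof -
  have "cells_form m M z K vs (\<lambda>_. 0) differentiable (at x)"
    using cells_form_deriv[of "\<lambda>_. 0" vs m M z K x] assms by (auto simp: differentiable_def)
  then show ?thesis using assms by (subst iter_deriv_cells) (auto intro!: differentiable_add differentiable_mult)
qed

text \<open>Interpolates between the trivial and the Lipschitz bound for the highest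
  derivative.\<close>

lemma min_one_le_powr:
  fixes s g :: real
  assumes "0 \<le> s" "0 < g" "g \<le> 1"
  shows "min 1 s \<le> s powr g"
proof (cases "s \<le> 1")
  case True
  show ?thesis
  proof (cases "s = 0")
    case False
    then have "s powr 1 \<le> s powr g" using assms True by (intro powr_mono') auto
    then show ?thesis using True False assms by simp
  qed simp
next
  case False
  then show ?thesis using assms by (simp add: ge_one_powr_ge_zero)
qed

text \<open>The height \<eta> M^(-\<beta>) is the critical scaling. A derivative of order k \<le> l
  grows by M^k, which the height absorbs as k < \<beta>; in the Hoelder condition M^l min(1, M t)
  \<le> M^l (M t)^(\<beta> - l), and the powers of \<open>M\<close> cancel exactly. What remains are
  smallness conditions on \<open>\<eta>\<close> that do not involve \<open>M\<close>.\<close>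

lemma ridge_smooth_class:
  fixes f :: "real^'d \<Rightarrow> real^'d" and z :: "real^'d" and L :: "nat \<Rightarrow> real"
  assumes f: "\<And>x j. f x $ j = (if j = i then c + e * cells_bump (l + 2) M z K (\<lambda>_. 0) x else 0)"
    and \<beta>: "real l < \<beta>" "\<beta> \<le> real l + 1"
    and K: "finite K" and B: "B \<ge> 1" "\<And>n s. n \<le> l + 2 \<Longrightarrow> \<bar>bump (l + 2) n s\<bar> \<le> B"
    and M: "M \<ge> 1" and e: "e = \<eta> * M powr - \<beta>" and \<eta>: "\<eta> \<ge> 0" and c: "c \<ge> 0" "c + \<eta> \<le> L 0"
    and L: "\<And>k. k \<le> l \<Longrightarrow> 0 \<le> L k"
    and \<eta>L: "\<And>k. 1 \<le> k \<Longrightarrow> k \<le> l \<Longrightarrow> \<eta> * (real CARD('d) ^ k * B ^ CARD('d)) \<le> L k"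
    and \<eta>L\<beta>: "\<eta> * (2 * real CARD('d) ^ Suc l * B ^ CARD('d)) \<le> L\<beta>" and L\<beta>: "0 \<le> L\<beta>"
  shows "f \<in> smooth_class \<beta> l L L\<beta>"
proof -
  define D where "D = real CARD('d)"
  have D: "D \<ge> 1" by (simp add: D_def Suc_leI)
  have e0: "e \<ge> 0" using \<eta> by (simp add: e)
  have B0: "B \<ge> 0" using B by simp
  let ?W = "cells_form (l + 2) M z K"
  have eMk: "e * M ^ k \<le> \<eta>" if "k \<le> l" for k
  proof -
    have "M powr - \<beta> * M ^ k = M powr (real k - \<beta>)" using M by (simp add: powr_realpow[symmetric] powr_add[symmetric])
    also have "\<dots> \<le> M powr 0" using M that \<beta> by (intro powr_mono) auto
    finally have "\<eta> * (M powr - \<beta> * M ^ k) \<le> \<eta> * 1" using \<eta> M by (intro mult_left_mono) auto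
    then show ?thesis by (simp add: e mult_ac)
  qed
  have form0: "\<bar>e * ?W vs (\<lambda>_. 0) x\<bar> \<le> \<eta> * (D ^ length vs * B ^ CARD('d))"
    if "length vs \<le> l" "\<forall>v\<in>set vs. norm v = 1" for vs x
  proof -
    have "\<bar>?W vs (\<lambda>_. 0) x\<bar> \<le> (M * D) ^ length vs * B ^ CARD('d)"
      unfolding D_def using that M by (intro cells_form_bounded K B0 B(2)) auto
    then have "e * \<bar>?W vs (\<lambda>_. 0) x\<bar> \<le> e * ((M * D) ^ length vs * B ^ CARD('d))"
      using e0 by (rule mult_left_mono)
    also have "\<dots> = (e * M ^ length vs) * (D ^ length vs * B ^ CARD('d))" by (simp add: power_mult_distrib)
    also have "\<dots> \<le> \<eta> * (D ^ length vs * B ^ CARD('d))"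
      using that eMk D B0 by (intro mult_right_mono) auto
    finally show ?thesis using e0 by (simp add: abs_mult)
  qed
  have hoelder: "\<bar>e * ?W vs (\<lambda>_. 0) x - e * ?W vs (\<lambda>_. 0) y\<bar> \<le> L\<beta> * norm (x - y) powr (\<beta> - l)"
    if vs: "length vs = l" "\<forall>v\<in>set vs. norm v = 1" for vs x y
  proof -
    define t where "t = norm (x - y)"
    have t: "t \<ge> 0" by (simp add: t_def)
    let ?d = "\<bar>?W vs (\<lambda>_. 0) x - ?W vs (\<lambda>_. 0) y\<bar>"
    have "\<bar>?W vs (\<lambda>_. 0) u\<bar> \<le> (M * D) ^ l * B ^ CARD('d)" for u
      using vs M cells_form_bounded[OF K B0 B(2), of M "\<lambda>_. 0" vs z u] by (simp add: D_def)
    \<comment> \<open>The bound for distant points; it is the origin of the factor 2 in the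
      condition on \<open>L\<beta>\<close>.\<close>
    from this[of x] this[of y] have "?d \<le> 2 * ((M * D) ^ l * B ^ CARD('d))" by linarith
    also have "\<dots> \<le> 2 * (M ^ l * D ^ Suc l * B ^ CARD('d))"
      using M D B0 by (simp add: power_mult_distrib mult_right_mono)
    finally have 1: "?d \<le> 2 * (M ^ l * D ^ Suc l * B ^ CARD('d)) * 1" by simp
    have "?d \<le> (M * D) ^ Suc l * B ^ CARD('d) * t"
      using vs M cells_form_lipschitz[OF K B0 B(2), of M "\<lambda>_. 0" vs z x y] by (simp add: D_def t_def)
    also have "\<dots> = (M ^ l * D ^ Suc l * B ^ CARD('d)) * (M * t)" by (simp add: power_mult_distrib)
    also have "\<dots> \<le> 2 * (M ^ l * D ^ Suc l * B ^ CARD('d)) * (M * t)"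
      using M D B0 t by (intro mult_right_mono) auto
    finally have "?d \<le> 2 * (M ^ l * D ^ Suc l * B ^ CARD('d)) * min 1 (M * t)" using 1
      by (auto simp: min_def)
    also have "\<dots> \<le> 2 * (M ^ l * D ^ Suc l * B ^ CARD('d)) * (M * t) powr (\<beta> - l)"
      using M D B0 t \<beta> by (intro mult_left_mono min_one_le_powr) auto
    finally have "e * ?d \<le> e * (2 * (M ^ l * D ^ Suc l * B ^ CARD('d)) * (M * t) powr (\<beta> - l))"
      using e0 by (rule mult_left_mono)
    also have "\<dots> = \<eta> * (2 * D ^ Suc l * B ^ CARD('d)) * (M powr - \<beta> * M ^ l * M powr (\<beta> - l)) * t powr (\<beta> - l)"
      using M t by (simp add: e powr_mult)
    also have "M powr - \<beta> * M ^ l * M powr (\<beta> - l) = 1"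
      using M by (simp add: powr_realpow[symmetric] powr_add[symmetric])
    also have "\<eta> * (2 * D ^ Suc l * B ^ CARD('d)) * 1 * t powr (\<beta> - l) \<le> L\<beta> * t powr (\<beta> - l)"
      using \<eta>L\<beta> by (intro mult_right_mono) (auto simp: D_def)
    finally show ?thesis using e0 by (simp add: t_def right_diff_distrib[symmetric] abs_mult)
  qed
  have "times_differentiable l (\<lambda>x. f x $ j) \<and>
     (\<forall>k\<le>l. (SUP x. form_norm k (\<lambda>vs. iter_deriv (\<lambda>x. f x $ j) vs x)) \<le> ereal (L k)) \<and>
     (\<forall>x x'. form_norm l (\<lambda>vs. iter_deriv (\<lambda>x. f x $ j) vs x - iter_deriv (\<lambda>x. f x $ j) vs x')
              \<le> ereal (L\<beta> * norm (x - x') powr (\<beta> - real l)))" for j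
  proof -
    obtain a e' where g: "(\<lambda>x. f x $ j) = (\<lambda>x. a + e' * cells_bump (l + 2) M z K (\<lambda>_. 0) x)"
      and ae: "a = c \<and> e' = e \<or> a = 0 \<and> e' = 0"
    proof (cases "j = i")
      case True
      then show ?thesis using that[of c e] f by auto
    next
      case False
      then show ?thesis using that[of 0 0] f by auto
    qed
    have it: "iter_deriv (\<lambda>x. f x $ j) vs =
        (\<lambda>x. (if vs = [] then a else 0) + e' * ?W vs (\<lambda>_. 0) x)" if "length vs \<le> l" for vs
      unfolding g using that by (intro iter_deriv_cells) auto
    have "times_differentiable l (\<lambda>x. f x $ j)"
      unfolding times_differentiable_def g by (auto intro!: differentiable_iter_deriv_cells)
    moreover have "\<bar>iter_deriv (\<lambda>x. f x $ j) vs x\<bar> \<le> L (length vs)"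
      if "length vs \<le> l" "\<forall>v\<in>set vs. norm v = 1" for vs x
    proof (cases "vs = []")
      case True
      have "\<bar>a + e' * cells_bump (l + 2) M z K (\<lambda>_. 0) x\<bar> \<le> L 0"
      proof (cases "e' = e \<and> a = c")
        case True
        have "e * cells_bump (l + 2) M z K (\<lambda>_. 0) x \<le> e * 1"
          using e0 cells_bump_0_range[OF K] by (intro mult_left_mono)
        moreover have "0 \<le> e * cells_bump (l + 2) M z K (\<lambda>_. 0) x"
          using e0 cells_bump_0_range[OF K] by simp
        ultimately show ?thesis using True c eMk[of 0] by simp
      qed (use ae L in auto)
      then show ?thesis using True it[of vs] by simp
    next
      case False
      then have 1: "1 \<le> length vs" by (cases vs) auto
      have "\<bar>e' * ?W vs (\<lambda>_. 0) x\<bar> \<le> L (length vs)"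
        using form0[OF that, of x] \<eta>L[OF 1 that(1)] ae L[OF that(1)] by (auto simp: D_def)
      then show ?thesis using False it[OF that(1)] by simp
    qed
    moreover have "\<bar>iter_deriv (\<lambda>x. f x $ j) vs x - iter_deriv (\<lambda>x. f x $ j) vs y\<bar> \<le>
        L\<beta> * norm (x - y) powr (\<beta> - l)" if "length vs = l" "\<forall>v\<in>set vs. norm v = 1" for vs x y
      using hoelder[OF that, of x y] ae it[of vs] that L\<beta> by auto
    ultimately show ?thesis unfolding form_norm_def by (auto intro!: SUP_least)
  qed
  then show ?thesis unfolding smooth_class_def Let_def by blast
qed

lemma continuous_on_cells_bump:
  fixes K :: "('d::finite \<Rightarrow> int) set"
  assumes "m \<ge> 2"
  shows "continuous_on S (cells_bump m M z K (\<lambda>_. 0))"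
proof (intro continuous_at_imp_continuous_on ballI)
  fix x :: "real^'d"
  have "0 + 2 \<le> m" using assms by simp
  then show "isCont (cells_bump m M z K (\<lambda>_. 0)) x"
    by (intro has_derivative_continuous[OF cells_bump_deriv]) simp
qed

section \<open>Flows along a coordinate axis\<close>

text \<open>\<open>F\<close> is the travel time of the equation s' = g(s), which grows at rate 1
  along solutions. The upper bound on \<open>g\<close> gives it slope at least 1/b.\<close>

lemma antiderivative_reciprocal:
  fixes g :: "real \<Rightarrow> real"
  assumes cont: "continuous_on UNIV g" and c: "0 < c" and lb: "\<And>s. c \<le> g s" and ub: "\<And>s. g s \<le> b"
  obtains F where "\<And>s. (F has_real_derivative inverse (g s)) (at s)"
    and "\<And>s r. s \<le> r \<Longrightarrow> F r - F s \<ge> (r - s) / b"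
proof -
  have g0: "g s \<noteq> 0" for s using c lb[of s] by auto
  have b: "b \<noteq> 0" using c lb[of 0] ub[of 0] by linarith
  have "isCont (\<lambda>s. inverse (g s)) s" for s
    using cont g0 by (auto simp: continuous_on_eq_continuous_at intro!: continuous_intros)
  then have "\<exists>F. \<forall>s::real. -\<infinity> < ereal s \<longrightarrow> ereal s < \<infinity> \<longrightarrow> (F has_vector_derivative inverse (g s)) (at s)"
    by (intro einterval_antiderivative) auto
  then obtain F where F: "\<And>s. (F has_real_derivative inverse (g s)) (at s)"
    by (auto simp: has_real_derivative_iff_has_vector_derivative)
  moreover have "F r - F s \<ge> (r - s) / b" if "s \<le> r" for s r
  proof -
    have "F s - s / b \<le> F r - r / b"
    proof (rule DERIV_nonneg_imp_nondecreasing[OF that])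
      fix x assume "s \<le> x" "x \<le> r"
      have "((\<lambda>x. F x - x / b) has_real_derivative inverse (g x) - 1 / b) (at x)"
        by (auto intro!: derivative_eq_intros F simp: b)
      moreover have gx: "0 < g x" using lb[of x] c by simp
      have "0 \<le> inverse (g x) - 1 / b"
        using le_imp_inverse_le[OF ub[of x] gx] unfolding inverse_eq_divide by linarith
      ultimately show "\<exists>y. ((\<lambda>x. F x - x / b) has_real_derivative y) (at x) \<and> 0 \<le> y"
        by blast
    qed
    then show ?thesis by (simp add: diff_divide_distrib)
  qed
  ultimately show ?thesis using that by blast
qed

text \<open>Separation of variables: the solution is the inverse of the travel time, up to a shift.
  The slope bound makes the travel time onto and its inverse \<open>b\<close>-Lipschitz.\<close>

lemma scalar_flow_exists:
  fixes g :: "real \<Rightarrow> real"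
  assumes cont: "continuous_on UNIV g" and c: "0 < c" and lb: "\<And>s. c \<le> g s" and ub: "\<And>s. g s \<le> b"
  obtains w where "w 0 = 0" "\<And>t. (w has_real_derivative g (w t)) (at t)"
proof -
  obtain F where F: "\<And>s. (F has_real_derivative inverse (g s)) (at s)"
    and Flb: "\<And>s r. s \<le> r \<Longrightarrow> F r - F s \<ge> (r - s) / b"
    using antiderivative_reciprocal[OF cont c lb ub] by blast
  have g0: "g s \<noteq> 0" for s using c lb[of s] by auto
  have b: "0 < b" using c lb[of 0] ub[of 0] by simp
  have Fcont: "continuous_on S F" for S
    by (intro continuous_at_imp_continuous_on ballI DERIV_isCont[OF F])
  have surj: "\<exists>s. F s = t" for t
  proof -
    define r where "r = b * (\<bar>t\<bar> + \<bar>F 0\<bar>)"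
    have r: "r \<ge> 0" using b by (simp add: r_def)
    have "F r \<ge> t" using Flb[OF r] b by (simp add: r_def)
    moreover have "F (- r) \<le> t" using Flb[of "-r" 0] r b by (simp add: r_def)
    ultimately show ?thesis
      using IVT'[of F "-r" t r] Fcont r by auto
  qed
  have lip': "r - s \<le> b * (F r - F s)" if "s \<le> r" for s r
    using Flb[OF that] b unfolding pos_divide_le_eq[OF b] by (simp only: mult.commute)
  have lip: "\<bar>s - r\<bar> \<le> b * \<bar>F s - F r\<bar>" for s r
  proof -
    have "b * (F r - F s) \<le> b * \<bar>F s - F r\<bar>" "b * (F s - F r) \<le> b * \<bar>F s - F r\<bar>"
      using b by (intro mult_left_mono; linarith)+
    then show ?thesis using lip'[of r s] lip'[of s r] by linarith
  qed
  have inj: "s = r" if "F s = F r" for s r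
    using lip[of s r] unfolding that by simp
  define w where "w t = (THE s. F s = F 0 + t)" for t
  have Fw: "F (w t) = F 0 + t" for t
  proof -
    obtain s where "F s = F 0 + t" using surj by blast
    then show ?thesis unfolding w_def
    proof (rule theI)
      fix r assume "F r = F 0 + t"
      then show "r = s" using \<open>F s = F 0 + t\<close> by (simp add: inj[of r s])
    qed
  qed
  have w0: "w 0 = 0" by (rule inj) (simp add: Fw)
  have "\<bar>w t - w s\<bar> \<le> b * \<bar>t - s\<bar>" for s t using lip[of "w t" "w s"] by (simp add: Fw)
  then have "b-lipschitz_on UNIV w"
    using b by (intro lipschitz_onI) (auto simp: dist_real_def)
  then have wcont: "isCont w t" for t
    using lipschitz_on_continuous_on continuous_on_eq_continuous_at by blast
  have "(w has_real_derivative inverse (inverse (g (w t)))) (at t)" for t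
  proof (rule DERIV_inverse_function[where a = "t - 1" and b = "t + 1" and f = "\<lambda>s. F s - F 0"])
    show "((\<lambda>s. F s - F 0) has_real_derivative inverse (g (w t))) (at (w t))"
      by (auto intro!: derivative_eq_intros F simp: b)
  qed (use Fw g0 wcont in auto)
  then show ?thesis using that[of w] w0 by simp
qed

section \<open>Fields of constant direction and positive speed\<close>

definition ridge_field :: "'n::finite \<Rightarrow> (real^'n \<Rightarrow> real) \<Rightarrow> real^'n \<Rightarrow> real^'n" where
  "ridge_field i \<phi> x = \<phi> x *\<^sub>R axis i 1"

lemma ridge_field_nth: "ridge_field i \<phi> x $ j = (if j = i then \<phi> x else 0)"
  by (simp add: ridge_field_def axis_def)

lemma vec_eq_add_axis:
  fixes x y :: "real^'n"
  assumes "\<And>j. j \<noteq> i \<Longrightarrow> y $ j = x $ j"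
  shows "y = x + (y $ i - x $ i) *\<^sub>R axis i 1"
  unfolding vec_eq_iff using assms by (simp add: axis_def)

lemma ridge_solution_straight:
  fixes u :: "real \<Rightarrow> real^'n"
  assumes S: "convex S" "0 \<in> S"
    and u: "\<And>t. t \<in> S \<Longrightarrow> (u has_vector_derivative ridge_field i \<phi> (u t)) (at t within S)"
  shows ridge_solution_nth: "t \<in> S \<Longrightarrow> j \<noteq> i \<Longrightarrow> u t $ j = u 0 $ j"
    and ridge_solution_deriv: "t \<in> S \<Longrightarrow> ((\<lambda>t. u t $ i) has_real_derivative \<phi> (u t)) (at t within S)"
proof -
  have nth: "((\<lambda>t. u t $ j) has_real_derivative (if j = i then \<phi> (u t) else 0)) (at t within S)"
    if "t \<in> S" for t j
  proof -
    have "((\<lambda>t. u t $ j) has_vector_derivative ridge_field i \<phi> (u t) $ j) (at t within S)"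
      by (rule bounded_linear.has_vector_derivative[OF bounded_linear_vec_nth u[OF that]])
    then show ?thesis
      unfolding ridge_field_nth has_real_derivative_iff_has_vector_derivative .
  qed
  show "t \<in> S \<Longrightarrow> ((\<lambda>t. u t $ i) has_real_derivative \<phi> (u t)) (at t within S)"
    using nth[of t i] by simp
  assume "j \<noteq> i"
  then have "\<exists>a. \<forall>t\<in>S. u t $ j = a"
  proof (intro has_field_derivative_zero_constant S(1))
    show "((\<lambda>t. u t $ j) has_real_derivative 0) (at t within S)" if "t \<in> S" for t
      using nth[OF that, of j] \<open>j \<noteq> i\<close> by (simp only: if_False)
  qed
  then show "t \<in> S \<Longrightarrow> u t $ j = u 0 $ j" using S(2) by auto
qed

context
  fixes \<phi> :: "real^'n \<Rightarrow> real" and c b :: real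
  assumes cont: "continuous_on UNIV \<phi>" and c: "0 < c" and lb: "\<And>x. c \<le> \<phi> x" and ub: "\<And>x. \<phi> x \<le> b"
begin

text \<open>The travel time serves as a clock: along any solution, \<open>F\<close> of the covered
  distance minus \<open>t\<close> is constant, and \<open>F\<close> is injective. Continuity and
  two-sided bounds of the speed thus replace a Lipschitz condition. The set \<open>S\<close> is the
  whole line for the flow itself, and a compact interval when two fields agree only along a piece of
  a trajectory.\<close>

lemma ridge_solution_unique:
  fixes u v :: "real \<Rightarrow> real^'n"
  assumes S: "convex S" "0 \<in> S"
    and u: "\<And>t. t \<in> S \<Longrightarrow> (u has_vector_derivative ridge_field i \<phi> (u t)) (at t within S)"
    and v: "\<And>t. t \<in> S \<Longrightarrow> (v has_vector_derivative ridge_field i \<phi> (v t)) (at t within S)"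
    and eq: "u 0 = v 0" and t: "t \<in> S"
  shows "u t = v t"
proof -
  define g where "g s = \<phi> (u 0 + s *\<^sub>R axis i 1)" for s
  have gcont: "continuous_on UNIV g" unfolding g_def
    by (intro continuous_on_compose2[OF cont] continuous_intros) auto
  have gb: "c \<le> g s" "g s \<le> b" for s using lb ub by (simp_all add: g_def)
  obtain F where F: "\<And>s. (F has_real_derivative inverse (g s)) (at s)"
    and Flb: "\<And>s r. s \<le> r \<Longrightarrow> F r - F s \<ge> (r - s) / b"
    using antiderivative_reciprocal[OF gcont c gb] by blast
  have b: "0 < b" using c lb[of 0] ub[of 0] by linarith
  have clock: "\<exists>a. \<forall>t\<in>S. F (w t $ i - u 0 $ i) - t = a"
    if w: "\<And>t. t \<in> S \<Longrightarrow> (w has_vector_derivative ridge_field i \<phi> (w t)) (at t within S)"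
      and w0: "w 0 = u 0" for w
  proof (rule has_field_derivative_zero_constant[OF S(1)])
    fix t assume t: "t \<in> S"
    have d: "((\<lambda>t. w t $ i - u 0 $ i) has_real_derivative \<phi> (w t)) (at t within S)"
      using ridge_solution_deriv[OF S w t] by (auto intro!: derivative_eq_intros)
    have "w t = u 0 + (w t $ i - u 0 $ i) *\<^sub>R axis i 1"
      using ridge_solution_nth[OF S w t] by (intro vec_eq_add_axis) (simp add: w0)
    then have gw: "g (w t $ i - u 0 $ i) = \<phi> (w t)" unfolding g_def by (rule arg_cong[OF sym])
    have "((\<lambda>t. F (w t $ i - u 0 $ i)) has_real_derivative
        inverse (g (w t $ i - u 0 $ i)) * \<phi> (w t)) (at t within S)"
      by (rule DERIV_chain2[OF F d])
    also have "inverse (g (w t $ i - u 0 $ i)) * \<phi> (w t) = 1"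
      using c lb[of "w t"] gw by simp
    finally show "((\<lambda>t. F (w t $ i - u 0 $ i) - t) has_real_derivative 0) (at t within S)"
      by (auto intro!: derivative_eq_intros)
  qed
  obtain a a' where Hu: "\<And>t. t \<in> S \<Longrightarrow> F (u t $ i - u 0 $ i) - t = a"
    and Hv: "\<And>t. t \<in> S \<Longrightarrow> F (v t $ i - u 0 $ i) - t = a'"
    using clock[OF u refl] clock[OF v eq[symmetric]] by blast
  have Feq: "F (u t $ i - u 0 $ i) = F (v t $ i - u 0 $ i)"
    using Hu[OF S(2)] Hu[OF t] Hv[OF S(2)] Hv[OF t] unfolding eq by linarith
  have "r \<le> s" if "F s = F r" for s r
  proof (rule ccontr)
    assume "\<not> r \<le> s"
    then have "0 < (r - s) / b" using b by simp
    then show False using Flb[of s r] \<open>\<not> r \<le> s\<close> that by linarith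
  qed
  from this[OF Feq] this[OF Feq[symmetric]] have "u t $ i = v t $ i" by linarith
  moreover have "u t $ j = v t $ j" if "j \<noteq> i" for j
    using ridge_solution_nth[OF S u t that] ridge_solution_nth[OF S v t that] eq by simp
  ultimately show ?thesis unfolding vec_eq_iff by metis
qed

text \<open>\<open>flow\<close> is a definite description, so its equation becomes available through
  existence and uniqueness on the whole line.\<close>

lemma ridge_flow:
  shows ridge_flow_0: "flow (ridge_field i \<phi>) x 0 = x"
    and ridge_flow_deriv: "(flow (ridge_field i \<phi>) x has_vector_derivative
      ridge_field i \<phi> (flow (ridge_field i \<phi>) x t)) (at t)"
proof -
  let ?P = "\<lambda>u. u 0 = x \<and> (\<forall>t. (u has_vector_derivative ridge_field i \<phi> (u t)) (at t))"
  have gcont: "continuous_on UNIV (\<lambda>s. \<phi> (x + s *\<^sub>R axis i 1))"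
    by (intro continuous_on_compose2[OF cont] continuous_intros) auto
  obtain w where w: "w 0 = 0" "\<And>t. (w has_real_derivative \<phi> (x + w t *\<^sub>R axis i 1)) (at t)"
    by (rule scalar_flow_exists[OF gcont c lb ub], rule that)
  have ex: "?P (\<lambda>t. x + w t *\<^sub>R axis i 1)"
    using w by (auto simp: ridge_field_def intro!: derivative_eq_intros)
  have un: "u = v" if "?P u" "?P v" for u v
  proof
    show "u t = v t" for t
      by (rule ridge_solution_unique[OF convex_UNIV, of u i v]) (use that in auto)
  qed
  have "\<exists>!u. ?P u" by (rule ex1I[of ?P, OF ex un[OF _ ex]])
  then have "?P (flow (ridge_field i \<phi>) x)" unfolding flow_def by (rule theI')
  then show "flow (ridge_field i \<phi>) x 0 = x" "(flow (ridge_field i \<phi>) x has_vector_derivative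
      ridge_field i \<phi> (flow (ridge_field i \<phi>) x t)) (at t)" by auto
qed

lemma ridge_flow_nth: "j \<noteq> i \<Longrightarrow> flow (ridge_field i \<phi>) x t $ j = x $ j"
  using ridge_solution_nth[OF convex_UNIV, of "flow (ridge_field i \<phi>) x" i \<phi> t j]
    ridge_flow_deriv ridge_flow_0 by simp

lemma ridge_flow_nth_deriv:
  "((\<lambda>t. flow (ridge_field i \<phi>) x t $ i) has_real_derivative \<phi> (flow (ridge_field i \<phi>) x t)) (at t)"
  using ridge_solution_deriv[OF convex_UNIV, of "flow (ridge_field i \<phi>) x" i \<phi> t]
    ridge_flow_deriv by simp

lemma ridge_flow_bounds:
  assumes "t \<ge> 0"
  shows "x $ i + c * t \<le> flow (ridge_field i \<phi>) x t $ i" "flow (ridge_field i \<phi>) x t $ i \<le> x $ i + b * t"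
proof -
  let ?w = "\<lambda>t. flow (ridge_field i \<phi>) x t $ i"
  have "?w 0 - c * 0 \<le> ?w t - c * t"
  proof (rule DERIV_nonneg_imp_nondecreasing[OF assms])
    fix s
    show "\<exists>y. ((\<lambda>t. ?w t - c * t) has_real_derivative y) (at s) \<and> 0 \<le> y"
      by (rule exI[of _ "\<phi> (flow (ridge_field i \<phi>) x s) - c"])
        (auto intro!: derivative_eq_intros ridge_flow_nth_deriv simp: lb)
  qed
  then show "x $ i + c * t \<le> ?w t" by (simp add: ridge_flow_0)
  have "b * 0 - ?w 0 \<le> b * t - ?w t"
  proof (rule DERIV_nonneg_imp_nondecreasing[OF assms])
    fix s
    show "\<exists>y. ((\<lambda>t. b * t - ?w t) has_real_derivative y) (at s) \<and> 0 \<le> y"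
      by (rule exI[of _ "b - \<phi> (flow (ridge_field i \<phi>) x s)"])
        (auto intro!: derivative_eq_intros ridge_flow_nth_deriv simp: ub)
  qed
  then show "?w t \<le> x $ i + b * t" by (simp add: ridge_flow_0)
qed

text \<open>By the intermediate value theorem the trajectory attains the coordinate \<open>i\<close>
  of \<open>y\<close>, and there the difference to \<open>y\<close> is orthogonal to the flow
  direction. The covered region is expressed through the least speed \<open>c\<close> and hence is
  common to all perturbations.\<close>

lemma mem_tube_ridge_flow:
  assumes T: "T > 0" and y: "x $ i \<le> y $ i" "y $ i \<le> x $ i + c * T"
    and \<delta>: "(\<Sum>j\<in>UNIV - {i}. \<bar>y $ j - x $ j\<bar>) \<le> \<delta>"
  shows "y \<in> tube T (flow (ridge_field i \<phi>) x) \<delta>"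
proof -
  let ?u = "flow (ridge_field i \<phi>) x"
  have "continuous_on {0..T} (\<lambda>t. ?u t $ i)"
    by (intro continuous_at_imp_continuous_on ballI DERIV_isCont[OF ridge_flow_nth_deriv])
  moreover have "?u 0 $ i \<le> y $ i" using y by (simp add: ridge_flow_0)
  moreover have "y $ i \<le> ?u T $ i" using y ridge_flow_bounds(1)[of T x i] T by simp
  ultimately obtain t where t: "0 \<le> t" "t \<le> T" "?u t $ i = y $ i"
    using IVT'[of "\<lambda>t. ?u t $ i" 0 "y $ i" T] T by auto
  have vd: "vector_derivative ?u (at t within {0..T}) = ridge_field i \<phi> (?u t)"
    using vector_derivative_within_cbox[of 0 T t ?u] t T
    by (simp add: has_vector_derivative_at_within ridge_flow_deriv)
  have "\<phi> (?u t) \<noteq> 0" using c lb[of "?u t"] by simp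
  then have "ridge_field i \<phi> (?u t) \<noteq> 0"
    by (metis ridge_field_nth zero_index)
  moreover have "(y - ?u t) \<bullet> ridge_field i \<phi> (?u t) = 0"
    using t by (simp add: ridge_field_def inner_axis)
  moreover have "norm (y - ?u t) \<le> \<delta>"
  proof -
    have "norm (y - ?u t) \<le> (\<Sum>j\<in>UNIV. \<bar>(y - ?u t) $ j\<bar>)" by (rule norm_le_l1_cart)
    also have "\<dots> = (\<Sum>j\<in>UNIV - {i}. \<bar>(y - ?u t) $ j\<bar>)"
      using t by (subst sum.remove[of _ i]) auto
    also have "\<dots> = (\<Sum>j\<in>UNIV - {i}. \<bar>y $ j - x $ j\<bar>)"
      by (intro sum.cong) (auto simp: ridge_flow_nth)
    finally show ?thesis using \<delta> by simp
  qed
  ultimately show ?thesis using t unfolding tube_def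
    by (intro UN_I[of t]) (auto simp: vd intro!: exI[of _ "y - ?u t"])
qed

end

text \<open>The trajectory of \<open>\<phi>\<close> also solves the equation of
  \<open>\<phi>'\<close> on \<open>{0..t}\<close>, and uniqueness on that interval applies.\<close>

lemma ridge_flow_cong:
  fixes \<phi> \<phi>' :: "real^'n \<Rightarrow> real"
  assumes \<phi>: "continuous_on UNIV \<phi>" "\<And>x. c \<le> \<phi> x" "\<And>x. \<phi> x \<le> b"
    and \<phi>': "continuous_on UNIV \<phi>'" "\<And>x. c \<le> \<phi>' x" "\<And>x. \<phi>' x \<le> b" and c: "0 < c"
    and eq: "\<And>s. 0 \<le> s \<Longrightarrow> s \<le> t \<Longrightarrow>
      \<phi>' (flow (ridge_field i \<phi>) x s) = \<phi> (flow (ridge_field i \<phi>) x s)"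
    and t: "0 \<le> t"
  shows "flow (ridge_field i \<phi>') x t = flow (ridge_field i \<phi>) x t"
proof (rule ridge_solution_unique[OF \<phi>'(1) c \<phi>'(2,3), where S = "{0..t}" and i = i
      and u = "flow (ridge_field i \<phi>') x" and v = "flow (ridge_field i \<phi>) x"])
  show "(flow (ridge_field i \<phi>') x has_vector_derivative
      ridge_field i \<phi>' (flow (ridge_field i \<phi>') x s)) (at s within {0..t})" for s
    by (rule has_vector_derivative_at_within[OF ridge_flow_deriv[OF \<phi>'(1) c \<phi>'(2,3)]])
  show "(flow (ridge_field i \<phi>) x has_vector_derivative
      ridge_field i \<phi>' (flow (ridge_field i \<phi>) x s)) (at s within {0..t})" if "s \<in> {0..t}" for s
  proof -
    have "ridge_field i \<phi>' (flow (ridge_field i \<phi>) x s) = ridge_field i \<phi> (flow (ridge_field i \<phi>) x s)"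
      unfolding ridge_field_def[of i \<phi>'] ridge_field_def[of i \<phi> "flow _ _ _"] using eq[of s] that by (intro arg_cong2[of _ _ _ _ scaleR]) auto
    then show ?thesis
      using has_vector_derivative_at_within[OF ridge_flow_deriv[OF \<phi>(1) c \<phi>(2,3)]] by (simp only:)
  qed
  show "flow (ridge_field i \<phi>') x 0 = flow (ridge_field i \<phi>) x 0"
    by (simp only: ridge_flow_0[OF \<phi>(1) c \<phi>(2,3)] ridge_flow_0[OF \<phi>'(1) c \<phi>'(2,3)])
qed (use t in auto)

text \<open>Both positions along the axis lie between x + c t and x + b t. No Gronwall argument is
  involved, so no exponential in \<open>t\<close> appears.\<close>

lemma norm_ridge_flow_diff_le:
  fixes \<phi> \<phi>' :: "real^'n \<Rightarrow> real"
  assumes \<phi>: "continuous_on UNIV \<phi>" "\<And>x. c \<le> \<phi> x" "\<And>x. \<phi> x \<le> b"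
    and \<phi>': "continuous_on UNIV \<phi>'" "\<And>x. c \<le> \<phi>' x" "\<And>x. \<phi>' x \<le> b" and c: "0 < c" and t: "0 \<le> t"
  shows "norm (flow (ridge_field i \<phi>) x t - flow (ridge_field i \<phi>') x t) \<le> (b - c) * t"
proof -
  let ?u = "flow (ridge_field i \<phi>) x t" and ?v = "flow (ridge_field i \<phi>') x t"
  have "?u = ?v + (?u $ i - ?v $ i) *\<^sub>R axis i 1"
    by (rule vec_eq_add_axis)
      (simp add: ridge_flow_nth[OF \<phi>(1) c \<phi>(2,3)] ridge_flow_nth[OF \<phi>'(1) c \<phi>'(2,3)])
  then have "?u - ?v = (?u $ i - ?v $ i) *\<^sub>R axis i 1"
    unfolding diff_eq_eq by (simp only: add.commute)
  then have "norm (?u - ?v) = norm ((?u $ i - ?v $ i) *\<^sub>R (axis i 1 :: real^'n))"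
    by (rule arg_cong)
  also have "\<dots> = \<bar>?u $ i - ?v $ i\<bar>" by (simp only: norm_scaleR norm_axis_1 mult_1_right)
  also have "\<dots> \<le> (b - c) * t"
    using ridge_flow_bounds[OF \<phi>(1) c \<phi>(2,3) t, where x = x and i = i] ridge_flow_bounds[OF \<phi>'(1) c \<phi>'(2,3) t, where x = x and i = i]
    unfolding left_diff_distrib abs_le_iff by linarith
  finally show ?thesis .
qed

section \<open>Snakes of short trajectories\<close>

lemma card_int_open_interval_le:
  fixes a b :: real
  shows "finite {s::int. a < of_int s \<and> of_int s < b}"
    and "a \<le> b \<Longrightarrow> real (card {s::int. a < of_int s \<and> of_int s < b}) \<le> b - a + 1"
proof -
  have eq: "{s::int. a < of_int s \<and> of_int s < b} = {\<lfloor>a\<rfloor> + 1..\<lceil>b\<rceil> - 1}"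
    by (auto simp: add1_zle_eq zle_diff1_eq floor_less_iff less_ceiling_iff)
  show "finite {s::int. a < of_int s \<and> of_int s < b}" unfolding eq by simp
  assume "a \<le> b"
  then show "real (card {s::int. a < of_int s \<and> of_int s < b}) \<le> b - a + 1"
    unfolding eq card_atLeastAtMost_int by linarith
qed

lemma card_PiE_one_distinct:
  fixes i :: "'d::finite"
  shows "card (PiE UNIV (\<lambda>j. if j = i then A else B j)) = card A * (\<Prod>j\<in>UNIV - {i}. card (B j))"
  by (subst card_PiE) (auto simp: prod.remove[of UNIV i] intro!: prod.cong)

lemma sorted_nth_bounds:
  assumes "sorted (ts :: real list)" "ts \<noteq> []" "0 \<le> hd ts" "last ts = T" "i < length ts"
  shows "0 \<le> ts ! i" "ts ! i \<le> T"
proof -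
  have "ts ! 0 \<le> ts ! i" "ts ! i \<le> ts ! (length ts - 1)"
    using assms(1,2,5) by (auto intro!: sorted_nth_mono)
  then show "0 \<le> ts ! i" "ts ! i \<le> T"
    using assms by (simp_all add: hd_conv_nth last_conv_nth)
qed

text \<open>Short trajectories start on the lattice through \<open>z\<close> with spacing $1/M$ in the flow direction \<open>i\<close>
  and spacing $1/q$ in the other directions. The bumps occupy open cells of side $1/M$, so that for
  $M = q$ no trajectory meets a bump.\<close>

locale snake_grid =
  fixes i :: "'d::finite" and z :: "real^'d" and m M q :: nat and c e :: real
  assumes M: "1 \<le> M" "M \<le> q" and c: "0 < c" and e: "0 \<le> e" "e \<le> c"
    and z: "\<And>j. \<bar>z $ j\<bar> \<le> 1" and card: "2 \<le> CARD('d)" and m: "2 \<le> m"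
begin

definition speed :: "('d \<Rightarrow> int) set \<Rightarrow> real^'d \<Rightarrow> real" where
  "speed K x = c + e * cells_bump m (real M) z K (\<lambda>_. 0) x"

abbreviation field :: "('d \<Rightarrow> int) set \<Rightarrow> real^'d \<Rightarrow> real^'d" where
  "field K \<equiv> ridge_field i (speed K)"

definition start :: "('d \<Rightarrow> int) \<Rightarrow> real^'d" where
  "start s = (\<chi> j. z $ j + of_int (s j) / real (if j = i then M else q))"

text \<open>Since the coordinates of \<open>z\<close> are at most 1 in absolute value, the unit cube
  seen from \<open>z\<close> lies in [-1, 2] in every direction, within the range of the
  lattice.\<close>

definition grid :: "('d \<Rightarrow> int) set" where
  "grid = PiE UNIV (\<lambda>j. if j = i then {- 2 * int M..2 * int M} else {- 2 * int q..2 * int q})"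

text \<open>In this time the least speed \<open>c\<close> covers one lattice spacing 1/M, and the
  greatest speed, at most 2 c, covers at most two.\<close>

definition dur :: real where "dur = 1 / (real M * c)"

text \<open>A piece advances by at most 2/M, so only the starting layers k i - 1 and k i can reach
  the cell. The inequalities in the other directions are strict because the cell is open; for M = q
  no integer satisfies them.\<close>

definition hits :: "('d \<Rightarrow> int) \<Rightarrow> ('d \<Rightarrow> int) \<Rightarrow> bool" where
  "hits k s \<longleftrightarrow> k i - 1 \<le> s i \<and> s i \<le> k i \<and>
    (\<forall>j\<in>UNIV - {i}. of_int (k j) * real q / real M < of_int (s j) \<and>
       of_int (s j) < (of_int (k j) + 1) * real q / real M)"

lemma q_ge_1: "1 \<le> q" using M by simp

lemma dur_pos: "0 < dur" using M c by (simp add: dur_def)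

lemma finite_grid: "finite grid"
  unfolding grid_def by (intro finite_PiE) auto

lemma card_grid: "card grid = (4 * M + 1) * (4 * q + 1) ^ (CARD('d) - 1)"
proof -
  have "card {- 2 * int N..2 * int N} = 4 * N + 1" for N by (simp add: nat_eq_iff)
  then show ?thesis
    unfolding grid_def card_PiE_one_distinct prod_constant by (simp only: card_Diff_singleton UNIV_I)
qed

lemma speed_bounds:
  assumes "finite K"
  shows "c \<le> speed K x" "speed K x \<le> c + e"
  using cells_bump_0_range[OF assms, of m "real M" z x] e by (auto simp: speed_def mult_left_le)

lemma speed_cont: "continuous_on UNIV (speed K)"
  unfolding speed_def[abs_def] by (intro continuous_intros continuous_on_cells_bump m)

lemma speed_cong:
  assumes "K - {k} = K' - {k}" and fin: "finite K" "finite K'"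
    and "\<not> (\<forall>j. 0 < real M * (x $ j - z $ j) - of_int (k j) \<and> real M * (x $ j - z $ j) - of_int (k j) < 1)"
  shows "speed K x = speed K' x"
proof -
  let ?t = "\<lambda>k. \<Prod>j\<in>UNIV. bump m 0 (real M * (x $ j - z $ j) - of_int (k j))"
  have 0: "?t k = 0" using assms(4) by (intro prod_zero) (auto simp: bump_def)
  have "sum ?t K = sum ?t (K - {k})" using fin 0 by (intro sum.mono_neutral_right) auto
  moreover have "sum ?t K' = sum ?t (K' - {k})" using fin 0 by (intro sum.mono_neutral_right) auto
  ultimately show ?thesis using assms(1) by (simp add: speed_def cells_bump_def)
qed

lemma flow_cong_unless_hits:
  assumes K: "K - {k} = K' - {k}" and fin: "finite K" "finite K'"
    and t: "0 \<le> t" "t \<le> dur" and "\<not> hits k s"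
  shows "flow (field K') (start s) t = flow (field K) (start s) t"
proof (rule ridge_flow_cong[OF speed_cont speed_bounds[OF fin(1)] speed_cont speed_bounds[OF fin(2)] c _ t(1)])
  fix r assume r: "0 \<le> r" "r \<le> t"
  define y where "y = flow (field K) (start s) r"
  have yj: "y $ j = start s $ j" if "j \<noteq> i" for j
    unfolding y_def by (rule ridge_flow_nth[OF speed_cont c speed_bounds[OF fin(1)] that])
  have "start s $ i + c * r \<le> y $ i" "y $ i \<le> start s $ i + (c + e) * r"
    unfolding y_def by (rule ridge_flow_bounds[OF speed_cont c speed_bounds[OF fin(1)] r(1)])+
  moreover have "0 \<le> c * r" using c r by simp
  moreover have "(c + e) * r \<le> 2 / M"
  proof -
    have "(c + e) * r \<le> (2 * c) * dur" using e c r t by (intro mult_mono) auto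
    then show ?thesis using c M by (simp add: dur_def field_simps)
  qed
  ultimately have "start s $ i \<le> y $ i" "y $ i \<le> start s $ i + 2 / M" by linarith+
  then have "of_int (s i) / M \<le> y $ i - z $ i" "y $ i - z $ i \<le> of_int (s i) / M + 2 / M"
    by (simp_all add: start_def)
  then have "of_int (s i) / M \<le> y $ i - z $ i" "y $ i - z $ i \<le> (of_int (s i) + 2) / M"
    by (simp_all add: add_divide_distrib)
  then have yi: "of_int (s i) \<le> M * (y $ i - z $ i)" "M * (y $ i - z $ i) \<le> of_int (s i) + 2"
    using M by (simp_all add: pos_divide_le_eq pos_le_divide_eq mult.commute)
  have "\<not> (\<forall>j. 0 < M * (y $ j - z $ j) - of_int (k j) \<and> M * (y $ j - z $ j) - of_int (k j) < 1)"
  proof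
    assume H: "\<forall>j. 0 < M * (y $ j - z $ j) - of_int (k j) \<and> M * (y $ j - z $ j) - of_int (k j) < 1"
    have "of_int (s i) < of_int (k i) + (1::real)" "of_int (k i) < of_int (s i) + (2::real)"
      using H[rule_format, of i] yi by linarith+
    then have "k i - 1 \<le> s i \<and> s i \<le> k i" by linarith
    moreover have "of_int (k j) * real q / M < of_int (s j) \<and> of_int (s j) < (of_int (k j) + 1) * real q / M"
      if "j \<noteq> i" for j
    proof -
      have "0 < M * (of_int (s j) / q) - of_int (k j)" "M * (of_int (s j) / q) - of_int (k j) < 1"
        using H[rule_format, of j] yj[OF that] that by (simp_all add: start_def)
      then show ?thesis using M q_ge_1 by (simp add: field_simps)
    qed
    ultimately show False using \<open>\<not> hits k s\<close> by (simp add: hits_def)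
  qed
  from speed_cong[OF K fin this] show "speed K' (flow (field K) (start s) r) = speed K (flow (field K) (start s) r)"
    unfolding y_def by (rule sym)
qed

text \<open>For the trajectory that uses up the remaining time: it starts at coordinate 10 in
  direction \<open>i\<close> and only moves upwards, whereas |z i| \<le> 1 and k i < M keep the cell
  below coordinate 2.\<close>

lemma flow_cong_far:
  assumes K: "K - {k} = K' - {k}" and fin: "finite K" "finite K'"
    and t: "0 \<le> t" and k: "\<And>j. k j < int M"
  shows "flow (field K') (\<chi> j. 10) t = flow (field K) (\<chi> j. 10) t"
proof (rule ridge_flow_cong[OF speed_cont speed_bounds[OF fin(1)] speed_cont speed_bounds[OF fin(2)] c _ t])
  fix r assume r: "0 \<le> r" "r \<le> t"
  define y where "y = flow (field K) (\<chi> j. 10) r"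
  have "(\<chi> j. 10) $ i + c * r \<le> y $ i"
    unfolding y_def by (rule ridge_flow_bounds[OF speed_cont c speed_bounds[OF fin(1)] r(1)])
  moreover have "0 \<le> c * r" using c r by simp
  ultimately have "10 - 1 \<le> y $ i - z $ i" using z[of i] by (simp add: abs_le_iff)
  then have "real M * 9 \<le> real M * (y $ i - z $ i)" by (intro mult_left_mono) auto
  moreover have "of_int (k i) \<le> real M - 1" using k[of i] by linarith
  ultimately have "\<not> real M * (y $ i - z $ i) - of_int (k i) < 1" using M by linarith
  then have "speed K y = speed K' y" by (intro speed_cong[OF K fin]) blast
  then show "speed K' (flow (field K) (\<chi> j. 10) r) = speed K (flow (field K) (\<chi> j. 10) r)"
    unfolding y_def by (rule sym)
qed

lemma norm_flow_diff_le:
  assumes "finite K" "finite K'" "0 \<le> t"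
  shows "norm (flow (field K) x t - flow (field K') x t) \<le> e * t"
  using norm_ridge_flow_diff_le[OF speed_cont speed_bounds[OF assms(1)] speed_cont speed_bounds[OF assms(2)] c assms(3)]
  by simp

text \<open>An open interval of length q/M contains at most q/M + 1 \<le> 2 q/M integers, in each of
  the d - 1 transversal directions; the leading 2 counts the layers in direction \<open>i\<close>.
  For M = q the endpoints are consecutive integers with none strictly between, and d \<ge> 2
  supplies a transversal direction.\<close>

lemma card_hits_le: "real (card {s\<in>grid. hits k s}) \<le> (if M = q then 0 else 2 * (2 * real q / real M) ^ (CARD('d) - 1))"
proof -
  define I where "I j = {s::int. of_int (k j) * real q / M < of_int s \<and> of_int s < (of_int (k j) + 1) * real q / M}" for j
  have finI: "finite (I j)" for j unfolding I_def by (rule card_int_open_interval_le)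
  have "{s\<in>grid. hits k s} \<subseteq> PiE UNIV (\<lambda>j. if j = i then {k i - 1..k i} else I j)"
    by (auto simp: hits_def I_def grid_def)
  then have "card {s\<in>grid. hits k s} \<le> card (PiE UNIV (\<lambda>j. if j = i then {k i - 1..k i} else I j))"
    by (intro card_mono finite_PiE) (auto simp: finI)
  also have "\<dots> = 2 * (\<Prod>j\<in>UNIV - {i}. card (I j))" by (simp add: card_PiE_one_distinct)
  finally have "real (card {s\<in>grid. hits k s}) \<le> real (2 * (\<Prod>j\<in>UNIV - {i}. card (I j)))"
    by (rule of_nat_mono)
  then have 1: "real (card {s\<in>grid. hits k s}) \<le> 2 * (\<Prod>j\<in>UNIV - {i}. real (card (I j)))"
    by simp
  show ?thesis
  proof (cases "M = q")
    case True
    have "card (UNIV - {i}) = CARD('d) - 1" by (simp add: card_Diff_singleton)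
    then have "card (UNIV - {i}) \<noteq> 0" using card by linarith
    then have "UNIV - {i} \<noteq> {}" by (intro notI) simp
    then obtain j where "j \<in> UNIV - {i}" by blast
    moreover have "I j = {}" using M q_ge_1 True by (auto simp: I_def)
    ultimately have z0: "(\<Prod>j\<in>UNIV - {i}. real (card (I j))) = 0"
      by (intro prod_zero) (auto intro!: bexI[of _ j])
    show ?thesis using 1[unfolded z0] by (simp only: True mult_zero_right if_True refl)
  next
    case False
    have "real (card (I j)) \<le> 2 * real q / M" for j
    proof -
      have "real (card (I j)) \<le> (of_int (k j) + 1) * real q / M - of_int (k j) * real q / M + 1"
        unfolding I_def by (rule card_int_open_interval_le(2)) (use M in \<open>simp add: divide_right_mono mult_right_mono\<close>)
      also have "\<dots> = real q / M + 1" by (simp add: distrib_right add_divide_distrib)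
      also have "1 \<le> real q / M" using M by simp
      finally show ?thesis by simp
    qed
    then have "(\<Prod>j\<in>UNIV - {i}. real (card (I j))) \<le> (\<Prod>j\<in>UNIV - {i}. 2 * real q / M)"
      by (intro prod_mono) auto
    also have "\<dots> = (2 * real q / real M) ^ (CARD('d) - 1)" by (simp add: card_Diff_singleton)
    finally show ?thesis using 1 False by simp
  qed
qed

text \<open>Rounding down to the lattice leaves at most 1/q in each transversal direction, in total
  at most d/q, and at most 1/M along the axis, which is the distance covered in time
  \<open>dur\<close> at the least speed.\<close>

lemma grid_tubes_cover:
  assumes K: "finite K" and x: "x \<in> cbox 0 1" and \<delta>: "real CARD('d) / real q \<le> \<delta>"
  shows "\<exists>s\<in>grid. x \<in> tube dur (flow (field K) (start s)) \<delta>"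
proof -
  define N where "N j = (if j = i then M else q)" for j
  define s where "s j = \<lfloor>(x $ j - z $ j) * N j\<rfloor>" for j
  have N: "1 \<le> N j" for j using M q_ge_1 by (simp add: N_def)
  have x': "0 \<le> x $ j" "x $ j \<le> 1" for j using x by (auto simp: mem_box_cart)
  have "\<bar>(x $ j - z $ j) * N j\<bar> \<le> 2 * real (N j)" for j
    using x'[of j] z[of j] by (auto simp: abs_mult abs_le_iff intro!: mult_right_mono)
  then have sb: "- 2 * int (N j) \<le> s j" "s j \<le> 2 * int (N j)" for j
    unfolding s_def abs_le_iff by (simp_all add: le_floor_iff floor_le_iff) (smt (verit))+
  have "(if j = i then {- 2 * int M..2 * int M} else {- 2 * int q..2 * int q}) =
      {- 2 * int (N j)..2 * int (N j)}" for j by (simp add: N_def)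
  then have "s \<in> grid" unfolding grid_def using sb by (simp add: PiE_iff)
  have st: "start s $ j = z $ j + of_int (s j) / N j" for j by (simp add: start_def N_def)
  have "of_int (s j) / N j \<le> x $ j - z $ j" "x $ j - z $ j \<le> of_int (s j) / N j + 1 / N j" for j
  proof -
    have f: "of_int (s j) \<le> (x $ j - z $ j) * N j" "(x $ j - z $ j) * N j \<le> of_int (s j) + 1"
      unfolding s_def by linarith+
    show "of_int (s j) / N j \<le> x $ j - z $ j"
      using f(1) N[of j] by (simp add: pos_divide_le_eq)
    show "x $ j - z $ j \<le> of_int (s j) / N j + 1 / N j"
      unfolding add_divide_distrib[symmetric] using f(2) N[of j] by (simp add: pos_le_divide_eq)
  qed
  then have sj: "start s $ j \<le> x $ j" "x $ j \<le> start s $ j + 1 / N j" for j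
    unfolding st by (simp_all add: algebra_simps)
  have "c * dur = 1 / N i" using c by (simp add: dur_def N_def)
  moreover have "(\<Sum>j\<in>UNIV - {i}. \<bar>x $ j - start s $ j\<bar>) \<le> \<delta>"
  proof -
    have "(\<Sum>j\<in>UNIV - {i}. \<bar>x $ j - start s $ j\<bar>) \<le> (\<Sum>j\<in>UNIV - {i}. 1 / q)"
    proof (rule sum_mono)
      fix j assume "j \<in> UNIV - {i}"
      then show "\<bar>x $ j - start s $ j\<bar> \<le> 1 / q" using sj[of j] by (simp add: N_def)
    qed
    also have "\<dots> \<le> (\<Sum>j\<in>(UNIV::'d set). 1 / q)" by (intro sum_mono2) auto
    also have "\<dots> = CARD('d) / q" by simp
    finally show ?thesis using \<delta> by simp
  qed
  ultimately have "x \<in> tube dur (flow (field K) (start s)) \<delta>"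
    using sj[of i] by (intro mem_tube_ridge_flow[OF speed_cont c speed_bounds[OF K] dur_pos]) simp_all
  with \<open>s \<in> grid\<close> show ?thesis by blast
qed

text \<open>One choice of starting points and durations serves every \<open>K\<close>, so the
  observation times agree across the hypotheses. For two hypotheses that differ in one cell, the
  divergence is at most the number of pieces that hit the cell, times the observations per piece,
  times the divergence per observation.\<close>

lemma snake_family:
  fixes U :: "('d \<Rightarrow> int) set" and P :: "(real^'d) measure" and D :: design
  assumes U: "finite U" "\<And>k j. k \<in> U \<Longrightarrow> k j < int M"
    and smooth: "\<And>K. K \<subseteq> U \<Longrightarrow> field K \<in> smooth_class \<beta> l L L\<beta>"
    and \<delta>: "0 < \<delta>" "real CARD('d) / real q \<le> \<delta>"
    and T: "real (card grid) * dur < Tsum" and n: "card grid + 1 \<le> n"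
    and P: "prob_space P" "sets P = sets borel" "noise_condition Cn P" and Cn: "0 \<le> Cn"
    and D: "\<forall>(f, xs, Ts) \<in> (snake_model_class \<beta> l L L\<beta> \<delta> Tsum n :: 'd param set).
       valid_times n Ts (D Ts) \<and> cover_time Cc n Tsum Ts (D Ts)"
  obtains xs Ts where
    "\<And>K. K \<subseteq> U \<Longrightarrow> (field K, xs, Ts) \<in> snake_model_class \<beta> l L L\<beta> \<delta> Tsum n"
    "\<And>K K' k. K \<subseteq> U \<Longrightarrow> K' \<subseteq> U \<Longrightarrow> k \<in> U \<Longrightarrow> K - {k} = K' - {k} \<Longrightarrow>
      tilt_bounded ((if M = q then 0 else 2 * (2 * real q / real M) ^ (CARD('d) - 1)) *
          max 1 (Cc * dur * (real n / Tsum)) * (Cn * (e * dur)\<^sup>2))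
        (obs_law P D (field K, xs, Ts)) (obs_law P D (field K', xs, Ts))"
proof -
  obtain ss where ss: "set ss = grid" "distinct ss" using finite_distinct_list[OF finite_grid] by blast
  have len: "length ss = card grid" using ss distinct_card by fastforce
  \<comment> \<open>The last trajectory absorbs the time left over by the pieces, so that the
    durations add up to \<open>Tsum\<close>; it is the reason for the + 1 in the bound on
    \<open>n\<close>.\<close>
  define xs where "xs = map start ss @ [\<chi> j. 10]"
  define Ts where "Ts = replicate (length ss) dur @ [Tsum - card grid * dur]"
  have lens: "length Ts = length ss + 1" "length xs = length ss + 1" by (simp_all add: Ts_def xs_def)
  have Ts1: "Ts ! j = dur" "xs ! j = start (ss ! j)" if "j < length ss" for j
    using that by (simp_all add: Ts_def xs_def nth_append)
  have Ts2: "xs ! length ss = (\<chi> j. 10)"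
    using nth_append_length[of "map start ss" "\<chi> j. 10" "[]"] by (simp add: xs_def)
  have mem: "(field K, xs, Ts) \<in> snake_model_class \<beta> l L L\<beta> \<delta> Tsum n" if K: "K \<subseteq> U" for K
  proof -
    have finK: "finite K" using U K finite_subset by blast
    have "tube_dist (cbox 0 1) (field K, xs, Ts) \<le> ereal \<delta>"
      unfolding tube_dist.simps
    proof (rule Inf_lower, rule imageI, safe)
      show "0 < \<delta>" by fact
      fix x :: "real^'d" assume "x \<in> cbox 0 1"
      then obtain s where s: "s \<in> grid" "x \<in> tube dur (flow (field K) (start s)) \<delta>"
        using grid_tubes_cover[OF finK _ \<delta>(2)] by blast
      then obtain j where j: "j < length ss" "ss ! j = s" using ss by (metis in_set_conv_nth)
      show "x \<in> (\<Union>j<length Ts. tube (Ts ! j) (flow (field K) (xs ! j)) \<delta>)"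
        using s j Ts1[OF j(1)] lens by (intro UN_I[of j]) auto
    qed
    moreover have "sum_list Ts = Tsum" by (simp add: Ts_def len sum_list_replicate)
    moreover have "\<forall>T\<in>set Ts. 0 < T" using T dur_pos by (auto simp: Ts_def)
    moreover have "Ts \<noteq> []" by (simp add: Ts_def)
    ultimately show ?thesis
      using smooth[OF K] lens n len by (simp add: snake_model_class_def snake_class_def)
  qed
  let ?ts = "D Ts"
  have vc: "valid_times n Ts ?ts" "cover_time Cc n Tsum Ts ?ts"
    using mem[of "{}"] D by auto
  then have lents: "length ?ts = length Ts" by (simp add: valid_times_def)
  have tb: "0 \<le> ?ts ! j ! i'" "?ts ! j ! i' \<le> Ts ! j" if "j < length Ts" "i' < length (?ts ! j)" for j i'
    using sorted_nth_bounds[of "?ts ! j" "Ts ! j" i'] vc(1) that unfolding valid_times_def by auto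
  \<comment> \<open>All observation times of a piece lie between 0 and \<open>dur\<close>, so the
    cover condition on this whole interval bounds their number.\<close>
  have nj: "real (length (?ts ! j)) \<le> max 1 (Cc * dur * (real n / Tsum))" if j: "j < length ss" for j
  proof -
    have j': "j < length Ts" using j lens by simp
    have all: "{i'. i' < length (?ts ! j) \<and> ?ts ! j ! i' \<in> {0..dur}} = {..<length (?ts ! j)}"
      using tb[OF j'] Ts1[OF j] by auto
    have "0 \<le> (0::real) \<and> 0 < dur \<and> dur \<le> Ts ! j" using Ts1[OF j] dur_pos by simp
    then have "real (card {i'. i' < length (?ts ! j) \<and> ?ts ! j ! i' \<in> {0..dur}}) \<le>
        max 1 (Cc * (dur - 0) * (real n / Tsum))"
      using vc(2) j' unfolding cover_time_def by blast
    then show ?thesis unfolding all by simp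
  qed
  define R where "R = max 1 (Cc * dur * (real n / Tsum))"
  have R: "R \<ge> 0" by (simp add: R_def)
  have tilt: "tilt_bounded ((if M = q then 0 else 2 * (2 * real q / real M) ^ (CARD('d) - 1)) * R * (Cn * (e * dur)\<^sup>2))
      (obs_law P D (field K, xs, Ts)) (obs_law P D (field K', xs, Ts))"
    if K: "K \<subseteq> U" "K' \<subseteq> U" "k \<in> U" "K - {k} = K' - {k}" for K K' k
  proof -
    have fin: "finite K" "finite K'" using U K finite_subset by blast+
    let ?d = "\<lambda>j i'. Cn * (norm (flow (field K) (xs ! j) (?ts ! j ! i') - flow (field K') (xs ! j) (?ts ! j ! i')))\<^sup>2"
    let ?E = "Cn * (e * dur)\<^sup>2"
    have E0: "0 \<le> ?E" using Cn by simp
    define J where "J = {j. j < length ss \<and> hits k (ss ! j)}"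
    have J: "J \<subseteq> {..<length Ts}" by (auto simp: J_def lens)
    have "bij_betw ((!) ss) J {s\<in>grid. hits k s}"
      unfolding bij_betw_def J_def
    proof
      show "inj_on ((!) ss) {j. j < length ss \<and> hits k (ss ! j)}"
        using ss(2) by (auto intro!: inj_on_nth)
      show "(!) ss ` {j. j < length ss \<and> hits k (ss ! j)} = {s \<in> grid. hits k s}"
        unfolding ss(1)[symmetric] by (auto simp: set_conv_nth)
    qed
    then have cardJ: "real (card J) \<le> (if M = q then 0 else 2 * (2 * real q / real M) ^ (CARD('d) - 1))"
      using card_hits_le[of k] by (simp only: bij_betw_same_card)
    have zero: "?d j i' = 0" if j: "j < length Ts" "j \<notin> J" and i': "i' < length (?ts ! j)" for j i'
    proof (cases "j < length ss")
      case True
      then have "flow (field K') (xs ! j) (?ts ! j ! i') = flow (field K) (xs ! j) (?ts ! j ! i')"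
        using tb[OF j(1) i'] j(2) Ts1[OF True] by (simp add: flow_cong_unless_hits[OF K(4) fin] J_def)
      then show ?thesis by simp
    next
      case False
      then have "j = length ss" using j lens by simp
      then have "flow (field K') (xs ! j) (?ts ! j ! i') = flow (field K) (xs ! j) (?ts ! j ! i')"
        using tb[OF j(1) i'] Ts2 by (simp add: flow_cong_far[OF K(4) fin _ U(2)[OF K(3)]])
      then show ?thesis by simp
    qed
    have small: "?d j i' \<le> ?E" if j: "j \<in> J" and i': "i' < length (?ts ! j)" for j i'
    proof -
      have j': "j < length ss" "j < length Ts" using j J by (auto simp: J_def)
      let ?t = "?ts ! j ! i'"
      have t: "0 \<le> ?t" "?t \<le> dur" using tb[OF j'(2) i'] Ts1[OF j'(1)] by simp_all
      have "norm (flow (field K) (xs ! j) ?t - flow (field K') (xs ! j) ?t) \<le> e * ?t"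
        by (rule norm_flow_diff_le[OF fin t(1)])
      also have "\<dots> \<le> e * dur" using t e by (intro mult_left_mono)
      finally show ?thesis using Cn by (intro mult_left_mono power_mono) auto
    qed
    have "(\<Sum>(j, i')\<in>obs_index ?ts. ?d j i') = (\<Sum>j<length Ts. \<Sum>i'<length (?ts ! j). ?d j i')"
      unfolding obs_index_def lents by (rule sum.Sigma[symmetric]) auto
    also have "\<dots> = (\<Sum>j\<in>J. \<Sum>i'<length (?ts ! j). ?d j i')"
      using J zero by (intro sum.mono_neutral_right) (auto intro!: sum.neutral)
    also have "\<dots> \<le> (\<Sum>j\<in>J. R * ?E)"
    proof (rule sum_mono)
      fix j assume j: "j \<in> J"
      have "(\<Sum>i'<length (?ts ! j). ?d j i') \<le> (\<Sum>i'<length (?ts ! j). ?E)"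
        using small[OF j] by (intro sum_mono) auto
      also have "\<dots> = real (length (?ts ! j)) * ?E" by simp
      also have "\<dots> \<le> R * ?E" using nj[of j] j E0 by (intro mult_right_mono) (auto simp: J_def R_def)
      finally show "(\<Sum>i'<length (?ts ! j). ?d j i') \<le> R * ?E" .
    qed
    also have "\<dots> = real (card J) * (R * ?E)" by simp
    also have "\<dots> \<le> (if M = q then 0 else 2 * (2 * real q / real M) ^ (CARD('d) - 1)) * (R * ?E)"
      using cardJ E0 R by (intro mult_right_mono) auto
    finally have le: "(\<Sum>(j, i')\<in>obs_index ?ts. ?d j i') \<le>
      (if M = q then 0 else 2 * (2 * real q / real M) ^ (CARD('d) - 1)) * R * ?E" by (simp only: mult.assoc)
    show ?thesis
      by (rule tilt_bounded_mono[OF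
        tilt_bounded_obs_law[OF P, where D = D and Ts = Ts and xs = xs and f = "field K" and f' = "field K'"] le])
  qed
  show ?thesis by (rule that[OF mem tilt[unfolded R_def]])
qed

end

section \<open>Minimax bounds from tilt inequalities\<close>

lemma minimax_prob_geI:
  fixes P :: "(real^'d::finite) measure"
  assumes "\<And>F. F \<in> estimators D \<Longrightarrow> \<exists>\<theta>\<in>\<Theta>. a \<le> exceed_prob P D loss C r F \<theta>"
  shows "a \<le> minimax_prob P D \<Theta> loss C r"
  unfolding minimax_prob_def
proof (rule INF_greatest)
  fix F :: "'d estimator" assume "F \<in> estimators D"
  then obtain \<theta> where "\<theta> \<in> \<Theta>" "a \<le> exceed_prob P D loss C r F \<theta>" using assms by blast
  then show "a \<le> (SUP \<theta>\<in>\<Theta>. exceed_prob P D loss C r F \<theta>)" by (rule SUP_upper2)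
qed

text \<open>A measurable event inside the exceedance set is enough, which avoids the measurability
  of the supremum loss.\<close>

lemma exceed_prob_geI:
  assumes P: "prob_space P" "sets P = sets borel" and E: "E \<in> sets (obs_space (D Ts))"
    and sub: "\<And>y. y \<in> E \<Longrightarrow> ennreal r \<le> ennreal C * loss (F xs Ts y) f"
    and a: "a \<le> measure (obs_law P D (f, xs, Ts)) E"
  shows "ennreal a \<le> exceed_prob P D loss C r F (f, xs, Ts)"
proof -
  interpret prob_space "obs_law P D (f, xs, Ts)" by (rule prob_space_obs_law[OF P])
  have E': "E \<in> sets (obs_law P D (f, xs, Ts))" using E by (simp only: sets_obs_law)
  have "ennreal a \<le> emeasure (obs_law P D (f, xs, Ts)) E"
    unfolding emeasure_eq_measure by (rule ennreal_leI[OF a])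
  also have "\<dots> = outer_measure_of (obs_law P D (f, xs, Ts)) E"
    by (rule outer_measure_of_eq[OF E', symmetric])
  also have "\<dots> \<le> exceed_prob P D loss C r F (f, xs, Ts)"
    unfolding exceed_prob.simps using sub sets.sets_into_space[OF E] by (intro outer_measure_of_mono) auto
  finally show ?thesis .
qed

lemma estimator_measurable:
  assumes "F \<in> estimators D"
  shows estimator_measurable_pair: "(\<lambda>(y, x). F xs Ts y x) \<in> borel_measurable (obs_space (D Ts) \<Otimes>\<^sub>M borel)"
    and estimator_measurable_at: "(\<lambda>y. F xs Ts y x) \<in> borel_measurable (obs_space (D Ts))"
proof -
  show 1: "(\<lambda>(y, x). F xs Ts y x) \<in> borel_measurable (obs_space (D Ts) \<Otimes>\<^sub>M borel)"
    using assms by (simp add: estimators_def)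
  have "(\<lambda>y. (y, x)) \<in> obs_space (D Ts) \<rightarrow>\<^sub>M obs_space (D Ts) \<Otimes>\<^sub>M borel" by measurable
  from measurable_compose[OF this 1] show "(\<lambda>y. F xs Ts y x) \<in> borel_measurable (obs_space (D Ts))"
    by simp
qed

definition bad_event :: "design \<Rightarrow> 'd::finite estimator \<Rightarrow> (real^'d) list \<Rightarrow> real list \<Rightarrow>
    (real^'d \<Rightarrow> real^'d) \<Rightarrow> real \<Rightarrow> real^'d \<Rightarrow> (nat \<times> nat \<Rightarrow> real^'d) set" where
  "bad_event D F xs Ts f \<rho> x = {y \<in> space (obs_space (D Ts)). \<rho> \<le> norm (F xs Ts y x - f x)}"

lemma bad_event_sets:
  assumes "F \<in> estimators D"
  shows "bad_event D F xs Ts f \<rho> x \<in> sets (obs_space (D Ts))"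
proof -
  note [measurable] = estimator_measurable_at[OF assms]
  show ?thesis unfolding bad_event_def by measurable
qed

text \<open>By the separation, the estimator is within \<open>\<rho>\<close> of at most one
  hypothesis at \<open>x\<close>. The good events are thus disjoint and have joint mass at most 1
  under the second law; passing to the first law costs 1/4. The sum and not the maximum is bounded,
  since it gets averaged over the edges of a hypercube and integrated over \<open>x\<close>.\<close>

lemma two_point_bad_events:
  assumes P: "prob_space P" "sets P = sets borel" and F: "F \<in> estimators D"
    and sep: "2 * \<rho> \<le> norm (f x - f' x)"
    and tilt: "tilt_bounded \<kappa> (obs_law P D (f, xs, Ts)) (obs_law P D (f', xs, Ts))" "\<kappa> \<le> 1/64"
  shows "3/4 \<le> measure (obs_law P D (f, xs, Ts)) (bad_event D F xs Ts f \<rho> x) +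
    measure (obs_law P D (f', xs, Ts)) (bad_event D F xs Ts f' \<rho> x)"
proof -
  let ?P = "obs_law P D (f, xs, Ts)" and ?Q = "obs_law P D (f', xs, Ts)"
  interpret P: prob_space ?P by (rule prob_space_obs_law[OF P])
  interpret Q: prob_space ?Q by (rule prob_space_obs_law[OF P])
  have b: "bad_event D F xs Ts g \<rho> x \<in> sets ?P" "bad_event D F xs Ts g \<rho> x \<in> sets ?Q" for g
    unfolding sets_obs_law by (rule bad_event_sets[OF F])+
  let ?G = "space ?P - bad_event D F xs Ts f \<rho> x" and ?G' = "space ?Q - bad_event D F xs Ts f' \<rho> x"
  have "?G \<inter> ?G' = {}"
  proof -
    have "\<rho> \<le> norm (F xs Ts y x - f x) \<or> \<rho> \<le> norm (F xs Ts y x - f' x)" for y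
      using norm_triangle_ineq4[of "F xs Ts y x - f' x" "F xs Ts y x - f x"] sep
      by (simp add: algebra_simps) linarith
    then show ?thesis unfolding bad_event_def space_obs_law by blast
  qed
  then have "Q.prob ?G + Q.prob ?G' = Q.prob (?G \<union> ?G')"
    using b by (subst Q.finite_measure_Union) (auto simp: sets_obs_law space_obs_law)
  also have "\<dots> \<le> 1" by (rule Q.prob_le_1)
  finally have "Q.prob ?G + Q.prob ?G' \<le> 1" .
  moreover have "P.prob ?G - Q.prob ?G \<le> 1/4"
    using tilt b by (intro tilt_bounded_diff[OF tilt(1) Q.prob_space_axioms _ tilt(2)])
      (simp add: sets_obs_law space_obs_law)
  moreover have "P.prob ?G = 1 - P.prob (bad_event D F xs Ts f \<rho> x)" using b by (intro P.prob_compl)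
  moreover have "Q.prob ?G' = 1 - Q.prob (bad_event D F xs Ts f' \<rho> x)" using b by (intro Q.prob_compl)
  ultimately show ?thesis by linarith
qed

lemma minimax_pointwise_two_point:
  fixes P :: "(real^'d::finite) measure"
  assumes P: "prob_space P" "sets P = sets borel"
    and mem: "(f, xs, Ts) \<in> \<Theta>" "(f', xs, Ts) \<in> \<Theta>"
    and sep: "2 * \<rho> \<le> norm (f x - f' x)" and r: "r \<le> C * \<rho>" and C: "0 \<le> C"
    and tilt: "tilt_bounded \<kappa> (obs_law P D (f, xs, Ts)) (obs_law P D (f', xs, Ts))" "\<kappa> \<le> 1/64"
  shows "ennreal (1/4) \<le> minimax_prob P D \<Theta> (pointwise_loss x) C r"
proof (rule minimax_prob_geI)
  fix F :: "'d estimator" assume F: "F \<in> estimators D"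
  have exc: "ennreal (1/4) \<le> exceed_prob P D (pointwise_loss x) C r F (g, xs, Ts)"
    if "1/4 \<le> measure (obs_law P D (g, xs, Ts)) (bad_event D F xs Ts g \<rho> x)" for g
  proof (rule exceed_prob_geI[where loss = "pointwise_loss x", OF P bad_event_sets[OF F] _ that])
    fix y assume "y \<in> bad_event D F xs Ts g \<rho> x"
    then have "C * \<rho> \<le> C * norm (F xs Ts y x - g x)" using C by (auto simp: bad_event_def intro: mult_left_mono)
    then show "ennreal r \<le> ennreal C * pointwise_loss x (F xs Ts y) g"
      using r C by (auto simp: pointwise_loss_def ennreal_mult[symmetric] intro!: ennreal_leI)
  qed
  have "1/4 \<le> measure (obs_law P D (f, xs, Ts)) (bad_event D F xs Ts f \<rho> x) \<or>
    1/4 \<le> measure (obs_law P D (f', xs, Ts)) (bad_event D F xs Ts f' \<rho> x)"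
    using two_point_bad_events[OF P F sep tilt] by linarith
  then show "\<exists>\<theta>\<in>\<Theta>. ennreal (1/4) \<le> exceed_prob P D (pointwise_loss x) C r F \<theta>"
    using exc mem by blast
qed

text \<open>With $a = \log |U|$ the tilt inequality, summed over the disjoint events on which the estimator
  is close to the $k$-th hypothesis, plays the role of Fano's inequality.\<close>

lemma minimax_sup_many_points:
  fixes P :: "(real^'d::finite) measure"
  assumes P: "prob_space P" "sets P = sets borel"
    and mem: "\<And>k. k \<in> U \<Longrightarrow> (f k, xs, Ts) \<in> \<Theta>"
    and U: "finite U" "2 \<le> ln (real (card U))"
    and x: "\<And>k. k \<in> U \<Longrightarrow> x k \<in> cbox 0 1"
    and sep: "\<And>j k. j \<in> U \<Longrightarrow> k \<in> U \<Longrightarrow> j \<noteq> k \<Longrightarrow> 2 * \<rho> \<le> norm (f k (x k) - f j (x k))"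
    and r: "r \<le> C * \<rho>" and C: "0 \<le> C"
    and tilt: "\<And>k. k \<in> U \<Longrightarrow> tilt_bounded \<kappa> (obs_law P D (f k, xs, Ts)) (obs_law P D (g, xs, Ts))"
    and \<kappa>: "\<kappa> \<le> ln (real (card U)) / 4"
  shows "ennreal (1/4) \<le> minimax_prob P D \<Theta> sup_loss C r"
proof (rule minimax_prob_geI)
  fix F :: "'d estimator" assume F: "F \<in> estimators D"
  let ?Q = "obs_law P D (g, xs, Ts)" and ?P = "\<lambda>k. obs_law P D (f k, xs, Ts)"
  interpret Q: prob_space ?Q by (rule prob_space_obs_law[OF P])
  \<comment> \<open>Errors are tested at all points \<open>x j\<close> and not only at
    \<open>x k\<close>: the good events of two hypotheses are disjoint because both control the
    error at one common point. The finite union is measurable.\<close>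
  define B where "B k = (\<Union>j\<in>U. bad_event D F xs Ts (f k) \<rho> (x j))" for k
  have B: "B k \<in> sets (obs_space (D Ts))" for k
    unfolding B_def using U(1) bad_event_sets[OF F] by (intro sets.finite_UN) auto
  define G where "G k = space (obs_space (D Ts)) - B k" for k
  have G: "G k \<in> sets (obs_space (D Ts))" for k unfolding G_def using B by auto
  have exc: "ennreal (1/4) \<le> exceed_prob P D sup_loss C r F (f k, xs, Ts)"
    if "1/4 \<le> measure (?P k) (B k)" for k
  proof (rule exceed_prob_geI[where loss = sup_loss, OF P B _ that])
    fix y assume "y \<in> B k"
    then obtain j where j: "j \<in> U" "\<rho> \<le> norm (F xs Ts y (x j) - f k (x j))"
      by (auto simp: B_def bad_event_def)
    then have "C * \<rho> \<le> C * norm (F xs Ts y (x j) - f k (x j))" using C by (intro mult_left_mono)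
    then have "ennreal r \<le> ennreal C * ennreal (norm (F xs Ts y (x j) - f k (x j)))"
      using r C by (auto simp: ennreal_mult[symmetric] intro!: ennreal_leI)
    also have "\<dots> \<le> ennreal C * sup_loss (F xs Ts y) (f k)"
      unfolding sup_loss_def using x[OF j(1)] by (intro mult_left_mono SUP_upper) auto
    finally show "ennreal r \<le> ennreal C * sup_loss (F xs Ts y) (f k)" .
  qed
  have "\<exists>k\<in>U. 1/4 \<le> measure (?P k) (B k)"
  proof (rule ccontr)
    assume H: "\<not> (\<exists>k\<in>U. 1/4 \<le> measure (?P k) (B k))"
    have card: "0 < card U" using U(2) by (cases "card U = 0") auto
    define Lg where "Lg = ln (real (card U))"
    have PG: "3/4 \<le> measure (?P k) (G k)" if "k \<in> U" for k
    proof -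
      interpret Pk: prob_space "?P k" by (rule prob_space_obs_law[OF P])
      have "Pk.prob (G k) = 1 - Pk.prob (B k)"
        unfolding G_def space_obs_law[symmetric, of D Ts P "f k" xs]
        by (rule Pk.prob_compl) (use B in \<open>simp only: sets_obs_law\<close>)
      moreover have "\<not> 1/4 \<le> Pk.prob (B k)" using H that by blast
      ultimately show ?thesis by linarith
    qed
    have disj: "disjoint_family_on G U"
      unfolding disjoint_family_on_def
    proof (intro ballI impI)
      fix j k assume jk: "j \<in> U" "k \<in> U" "j \<noteq> k"
      have False if y: "y \<in> G j" "y \<in> G k" for y
      proof -
        have "norm (F xs Ts y (x k) - f j (x k)) < \<rho>" "norm (F xs Ts y (x k) - f k (x k)) < \<rho>"
          using y jk by (auto simp: G_def B_def bad_event_def not_le)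
        then show False
          using norm_triangle_ineq4[of "F xs Ts y (x k) - f j (x k)" "F xs Ts y (x k) - f k (x k)"]
            sep[OF jk] by simp
      qed
      then show "G j \<inter> G k = {}" by blast
    qed
    have "(\<Sum>k\<in>U. Q.prob (G k)) = Q.prob (\<Union>k\<in>U. G k)"
      using G by (intro Q.finite_measure_finite_Union[symmetric] U(1) disj) (auto simp: sets_obs_law)
    also have "\<dots> \<le> 1" by (rule Q.prob_le_1)
    finally have sumQ: "(\<Sum>k\<in>U. Q.prob (G k)) \<le> 1" .
    have Lg: "2 \<le> Lg" "exp Lg = card U" using U(2) card by (simp_all add: Lg_def)
    have "card U * (Lg * (3/4)) = (\<Sum>k\<in>U. Lg * (3/4))" by simp
    also have "\<dots> \<le> (\<Sum>k\<in>U. \<kappa> + (exp Lg - 1) * Q.prob (G k))"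
    proof (rule sum_mono)
      fix k assume k: "k \<in> U"
      have "Lg * (3/4) \<le> Lg * measure (?P k) (G k)" using PG[OF k] Lg(1) by (intro mult_left_mono) auto
      also have "G k \<in> sets ?Q" using G by (simp only: sets_obs_law)
      then have "Lg * measure (?P k) (G k) \<le> \<kappa> + (exp Lg - 1) * Q.prob (G k)"
        using tilt[OF k] Lg(1) unfolding tilt_bounded_def by (elim ballE allE[of _ Lg]) auto
      finally show "Lg * (3/4) \<le> \<kappa> + (exp Lg - 1) * Q.prob (G k)" .
    qed
    also have "\<dots> = card U * \<kappa> + (exp Lg - 1) * (\<Sum>k\<in>U. Q.prob (G k))"
      by (simp add: sum.distrib sum_distrib_left)
    also have "0 \<le> exp Lg - 1" using Lg(1) by simp
    then have "card U * \<kappa> + (exp Lg - 1) * (\<Sum>k\<in>U. Q.prob (G k)) \<le> card U * \<kappa> + (exp Lg - 1) * 1"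
      using sumQ by (intro add_left_mono mult_left_mono)
    also have "\<dots> < card U * (\<kappa> + 1)" using Lg(2) by (simp add: distrib_left)
    \<comment> \<open>Combined with \<kappa> \<le> Lg/4 this would force Lg < 2.\<close>
    finally have "Lg * (3/4) < \<kappa> + 1" using card by (simp add: mult_less_cancel_left)
    then show False using \<kappa> Lg(1) by (simp add: Lg_def)
  qed
  then show "\<exists>\<theta>\<in>\<Theta>. ennreal (1/4) \<le> exceed_prob P D sup_loss C r F \<theta>"
    using exc mem by blast
qed

section \<open>Averaging over a hypercube and over space\<close>

lemma sum_Pow_remove:
  fixes g :: "'a set \<Rightarrow> real"
  assumes "finite U" "k \<in> U"
  shows "(\<Sum>\<omega>\<in>Pow U. g \<omega>) = (\<Sum>\<omega>\<in>Pow (U - {k}). g \<omega> + g (insert k \<omega>))"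
proof -
  have "Pow U = Pow (U - {k}) \<union> insert k ` Pow (U - {k})"
    using Pow_insert[of k "U - {k}"] assms(2) by (simp add: insert_absorb)
  moreover have "Pow (U - {k}) \<inter> insert k ` Pow (U - {k}) = {}" by auto
  moreover have "inj_on (insert k) (Pow (U - {k}))" by (auto simp: inj_on_def)
  ultimately show ?thesis
    using assms(1) by (simp add: sum.union_disjoint sum.reindex sum.distrib)
qed

text \<open>The volume of \<open>A\<close> is at most 1 and hence at most its own power 1/p. This
  reduces every \<open>p\<close> to the volume of the set where the error is large.\<close>

lemma Lp_loss_ge:
  assumes p: "1 \<le> p" and \<rho>: "0 < \<rho>" and A: "A \<in> sets lborel" "A \<subseteq> cbox 0 1"
    and far: "\<And>x. x \<in> A \<Longrightarrow> \<rho> \<le> norm (g x - f x)"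
  shows "ennreal (\<rho> * measure lborel A) \<le> Lp_loss p g f"
proof -
  define I where "I = (\<integral>\<^sup>+x\<in>cbox 0 1. ennreal (norm (g x - f x) powr p) \<partial>lborel)"
  show ?thesis
  proof (cases "I = \<infinity>")
    case True
    then show ?thesis by (simp add: Lp_loss_def Let_def I_def)
  next
    case False
    have finA: "emeasure lborel A < \<infinity>"
      using emeasure_mono[OF A(2), of lborel] emeasure_lborel_cbox_finite[of 0 "1::real^'a"] by (auto intro: le_less_trans)
    have le1: "measure lborel A \<le> 1"
    proof -
      have "measure lborel A \<le> measure lborel (cbox 0 (1::real^'a))"
        using A by (intro measure_mono_fmeasurable) (auto simp: fmeasurable_cbox)
      also have "\<dots> = 1" by (subst content_cbox_cart) (auto simp: interval_ne_empty_cart)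
      finally show ?thesis .
    qed
    have "ennreal (\<rho> powr p * measure lborel A) = (\<integral>\<^sup>+x. ennreal (\<rho> powr p) * indicator A x \<partial>lborel)"
      using A finA by (simp add: nn_integral_cmult_indicator emeasure_eq_ennreal_measure ennreal_mult)
    also have "\<dots> \<le> I"
      unfolding I_def
    proof (rule nn_integral_mono)
      fix x
      show "ennreal (\<rho> powr p) * indicator A x \<le> ennreal (norm (g x - f x) powr p) * indicator (cbox 0 1) x"
        using A(2) far[of x] \<rho> p by (auto simp: indicator_def intro!: ennreal_leI powr_mono2)
    qed
    finally have "\<rho> powr p * measure lborel A \<le> enn2real I"
      using False by (cases I) (auto simp: ennreal_le_iff)
    then have "(\<rho> powr p * measure lborel A) powr (1/p) \<le> enn2real I powr (1/p)"
      using p \<rho> by (intro powr_mono2) auto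
    moreover have "(\<rho> powr p * measure lborel A) powr (1/p) = \<rho> * measure lborel A powr (1/p)"
      using p \<rho> by (simp add: powr_mult powr_powr)
    moreover have "measure lborel A \<le> measure lborel A powr (1/p)"
    proof (cases "measure lborel A = 0")
      case False
      then have "measure lborel A powr 1 \<le> measure lborel A powr (1/p)"
        using le1 p by (intro powr_mono') auto
      then show ?thesis using False by simp
    qed simp
    then have "\<rho> * measure lborel A \<le> \<rho> * measure lborel A powr (1/p)" using \<rho> by simp
    ultimately have "\<rho> * measure lborel A \<le> enn2real I powr (1/p)" by linarith
    then show ?thesis using False by (simp add: Lp_loss_def Let_def I_def[symmetric] ennreal_leI)
  qed
qed

text \<open>Assouad's argument bounds the mean erroneous volume from below. At each point of
  \<open>S k\<close> the two-point bound holds along every edge in direction \<open>k\<close>, which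
  averages to 3/8 over the vertices. If an erroneous volume of at least V/8 had probability below
  1/4 at every vertex, the mean would stay below V (1/4 + 1/8) = 3 V/8. Only neighbouring vertices
  are compared, so \<open>\<kappa>\<close> concerns a single cell.\<close>

lemma minimax_Lp_hypercube:
  fixes f :: "'i set \<Rightarrow> real^'d \<Rightarrow> real^'d"
  assumes P: "prob_space P" "sets P = sets borel"
    and mem: "\<And>\<omega>. \<omega> \<subseteq> U \<Longrightarrow> (f \<omega>, xs, Ts) \<in> \<Theta>"
    and U: "finite U" and f: "\<And>\<omega>. f \<omega> \<in> borel_measurable borel"
    and S: "\<And>k. k \<in> U \<Longrightarrow> S k \<in> sets borel" "\<And>k. k \<in> U \<Longrightarrow> S k \<subseteq> cbox 0 1"
    and V: "V = measure lborel (\<Union>k\<in>U. S k)" "0 < V"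
    and sep: "\<And>\<omega> k x. \<omega> \<subseteq> U - {k} \<Longrightarrow> k \<in> U \<Longrightarrow> x \<in> S k \<Longrightarrow> 2 * \<rho> \<le> norm (f \<omega> x - f (insert k \<omega>) x)"
    and \<rho>: "0 < \<rho>" and r: "r \<le> C * (\<rho> * (V / 8))" and C: "0 < C" and p: "1 \<le> p"
    and tilt: "\<And>\<omega> k. \<omega> \<subseteq> U - {k} \<Longrightarrow> k \<in> U \<Longrightarrow>
      tilt_bounded \<kappa> (obs_law P D (f \<omega>, xs, Ts)) (obs_law P D (f (insert k \<omega>), xs, Ts))" and \<kappa>: "\<kappa> \<le> 1/64"
  shows "ennreal (1/4) \<le> minimax_prob P D \<Theta> (Lp_loss p) C r"
proof (rule minimax_prob_geI)
  fix F :: "'d estimator" assume F: "F \<in> estimators D"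
  let ?N = "obs_space (D Ts) :: (nat \<times> nat \<Rightarrow> real^'d) measure"
  let ?P = "\<lambda>\<omega>. obs_law P D (f \<omega>, xs, Ts)"
  let ?SS = "\<Union>k\<in>U. S k"
  note f[measurable] and estimator_measurable_pair[OF F, measurable]
  have SS[measurable]: "?SS \<in> sets borel" using U S(1) by (intro sets.finite_UN) auto
  have SSc: "?SS \<subseteq> cbox 0 1" using S(2) by blast
  have finSS: "emeasure lborel ?SS < \<infinity>"
    using emeasure_mono[OF SSc, of lborel] emeasure_lborel_cbox_finite[of 0 "1::real^'d"] by (auto intro: le_less_trans)
  then have emSS: "emeasure lborel ?SS = ennreal V" unfolding V(1) by (simp add: emeasure_eq_ennreal_measure)
  \<comment> \<open>The pairs of an observation and a point with a large error. One kind of section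
    is the erroneous region, the other a bad event, and Tonelli's theorem links the two.\<close>
  define W where "W \<omega> = {(y, x) \<in> space (?N \<Otimes>\<^sub>M borel). x \<in> ?SS \<and> \<rho> \<le> norm (F xs Ts y x - f \<omega> x)}" for \<omega>
  have W: "W \<omega> \<in> sets (?N \<Otimes>\<^sub>M borel)" for \<omega>
  proof -
    have "W \<omega> = {z \<in> space (?N \<Otimes>\<^sub>M borel). snd z \<in> ?SS \<and> \<rho> \<le> norm ((\<lambda>(y, x). F xs Ts y x) z - f \<omega> (snd z))}"
      unfolding W_def by auto
    also have "\<dots> \<in> sets (?N \<Otimes>\<^sub>M borel)" by measurable
    finally show ?thesis .
  qed
  have setsP: "sets (?P \<omega> \<Otimes>\<^sub>M lborel) = sets (?N \<Otimes>\<^sub>M borel)" for \<omega>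
    by (intro sets_pair_measure_cong sets_obs_law sets_lborel)
  have Wy: "Pair y -` W \<omega> = {x \<in> ?SS. \<rho> \<le> norm (F xs Ts y x - f \<omega> x)}" if "y \<in> space ?N" for y \<omega>
    using that by (auto simp: W_def space_pair_measure)
  have Wx: "(\<lambda>y. (y, x)) -` W \<omega> = (if x \<in> ?SS then bad_event D F xs Ts (f \<omega>) \<rho> x else {})" for x \<omega>
    by (auto simp: W_def space_pair_measure bad_event_def)
  define v where "v \<omega> y = measure lborel (Pair y -` W \<omega>)" for \<omega> y
  have Wysub: "Pair y -` W \<omega> \<subseteq> ?SS" for y \<omega> by (auto simp: W_def)
  have Wym: "Pair y -` W \<omega> \<in> sets lborel" for y \<omega> using sets_Pair1[OF W] by simp
  have vem: "emeasure lborel (Pair y -` W \<omega>) = ennreal (v \<omega> y)" for y \<omega>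
    unfolding v_def using emeasure_mono[OF Wysub, of lborel y \<omega>] finSS SS
    by (intro emeasure_eq_ennreal_measure) (auto simp: top_unique)
  have vV: "v \<omega> y \<le> V" for y \<omega>
    using emeasure_mono[OF Wysub, of lborel y \<omega>] SS V(2) by (simp add: vem emSS ennreal_le_iff)
  have vm[measurable]: "v \<omega> \<in> borel_measurable ?N" for \<omega>
  proof -
    have "(\<lambda>y. emeasure lborel (Pair y -` W \<omega>)) \<in> borel_measurable ?N"
      using W by (intro lborel.measurable_emeasure_Pair) (simp cong: sets_pair_measure_cong)
    then have "(\<lambda>y. enn2real (emeasure lborel (Pair y -` W \<omega>))) \<in> borel_measurable ?N" by measurable
    then show ?thesis unfolding v_def[abs_def] measure_def .
  qed
  define A where "A \<omega> = {y \<in> space ?N. V / 8 \<le> v \<omega> y}" for \<omega>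
  have A: "A \<omega> \<in> sets ?N" for \<omega> unfolding A_def by measurable
  have exc: "ennreal (1/4) \<le> exceed_prob P D (Lp_loss p) C r F (f \<omega>, xs, Ts)"
    if "1/4 \<le> measure (?P \<omega>) (A \<omega>)" for \<omega>
  proof (rule exceed_prob_geI[where loss = "Lp_loss p", OF P A _ that])
    fix y assume y: "y \<in> A \<omega>"
    have "ennreal r \<le> ennreal (C * (\<rho> * (V / 8)))" using r by (rule ennreal_leI)
    also have "\<dots> \<le> ennreal (C * (\<rho> * v \<omega> y))"
      using y C \<rho> by (intro ennreal_leI mult_left_mono) (auto simp: A_def)
    also have "\<dots> = ennreal C * ennreal (\<rho> * v \<omega> y)" using C \<rho> by (intro ennreal_mult) (auto simp: v_def)
    also have "\<dots> \<le> ennreal C * Lp_loss p (F xs Ts y) (f \<omega>)"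
    proof (rule mult_left_mono)
      show "ennreal (\<rho> * v \<omega> y) \<le> Lp_loss p (F xs Ts y) (f \<omega>)"
        unfolding v_def using Wym Wysub SSc
        by (intro Lp_loss_ge[OF p \<rho>]) (auto simp: W_def)
    qed simp
    finally show "ennreal r \<le> ennreal C * Lp_loss p (F xs Ts y) (f \<omega>)" .
  qed
  have "\<exists>\<omega>\<in>Pow U. 1/4 \<le> measure (?P \<omega>) (A \<omega>)"
  proof (rule ccontr)
    assume H: "\<not> (\<exists>\<omega>\<in>Pow U. 1/4 \<le> measure (?P \<omega>) (A \<omega>))"
    have upper: "emeasure (?P \<omega> \<Otimes>\<^sub>M lborel) (W \<omega>) \<le> ennreal (V * (measure (?P \<omega>) (A \<omega>) + 1/8))" for \<omega>
    proof -
      interpret Pw: prob_space "?P \<omega>" by (rule prob_space_obs_law[OF P])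
      have A': "A \<omega> \<in> sets (?P \<omega>)" using A by (simp only: sets_obs_law)
      have "emeasure (?P \<omega> \<Otimes>\<^sub>M lborel) (W \<omega>) = (\<integral>\<^sup>+y. emeasure lborel (Pair y -` W \<omega>) \<partial>?P \<omega>)"
        using W setsP by (intro lborel.emeasure_pair_measure_alt) blast
      also have "\<dots> \<le> (\<integral>\<^sup>+y. ennreal V * indicator (A \<omega>) y + ennreal (V / 8) \<partial>?P \<omega>)"
      proof (rule nn_integral_mono)
        fix y assume "y \<in> space (?P \<omega>)"
        then have y: "y \<in> space ?N" by (simp only: space_obs_law)
        show "emeasure lborel (Pair y -` W \<omega>) \<le> ennreal V * indicator (A \<omega>) y + ennreal (V / 8)"
        proof (cases "y \<in> A \<omega>")
          case True
          have "ennreal (v \<omega> y) \<le> ennreal V" using vV by (rule ennreal_leI)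
          also have "\<dots> \<le> ennreal V + ennreal (V / 8)" by simp
          finally show ?thesis using True by (simp add: vem)
        next
          case False
          then have "v \<omega> y \<le> V / 8" using y by (simp add: A_def)
          then show ?thesis using False by (simp add: vem ennreal_leI)
        qed
      qed
      also have "\<dots> = ennreal V * emeasure (?P \<omega>) (A \<omega>) + ennreal (V / 8)"
        using A' by (simp add: nn_integral_add nn_integral_cmult_indicator Pw.emeasure_space_1 del: obs_law.simps)
      also have "\<dots> = ennreal (V * (measure (?P \<omega>) (A \<omega>) + 1/8))"
        using V(2) by (simp add: Pw.emeasure_eq_measure ennreal_mult[symmetric] ennreal_plus[symmetric] distrib_left del: ennreal_plus obs_law.simps)
      finally show ?thesis .
    qed
    have lower: "ennreal (2 ^ card U * (3/8) * V) \<le> (\<Sum>\<omega>\<in>Pow U. emeasure (?P \<omega> \<Otimes>\<^sub>M lborel) (W \<omega>))"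
    proof -
      have alt2: "emeasure (?P \<omega> \<Otimes>\<^sub>M lborel) (W \<omega>) = (\<integral>\<^sup>+x. emeasure (?P \<omega>) ((\<lambda>y. (y, x)) -` W \<omega>) \<partial>lborel)"
        and meas: "(\<lambda>x. emeasure (?P \<omega>) ((\<lambda>y. (y, x)) -` W \<omega>)) \<in> borel_measurable lborel" for \<omega>
      proof -
        interpret Pw: prob_space "?P \<omega>" by (rule prob_space_obs_law[OF P])
        interpret pair_sigma_finite "?P \<omega>" lborel ..
        have W': "W \<omega> \<in> sets (?P \<omega> \<Otimes>\<^sub>M lborel)" using W setsP by blast
        show "emeasure (?P \<omega> \<Otimes>\<^sub>M lborel) (W \<omega>) = (\<integral>\<^sup>+x. emeasure (?P \<omega>) ((\<lambda>y. (y, x)) -` W \<omega>) \<partial>lborel)"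
          by (rule emeasure_pair_measure_alt2[OF W'])
        show "(\<lambda>x. emeasure (?P \<omega>) ((\<lambda>y. (y, x)) -` W \<omega>)) \<in> borel_measurable lborel"
          by (rule measurable_emeasure_Pair2[OF W'])
      qed
      have "ennreal (2 ^ card U * (3/8) * V) = (\<integral>\<^sup>+x. ennreal (2 ^ card U * (3/8)) * indicator ?SS x \<partial>lborel)"
        using V(2) SS ennreal_mult[of "2 ^ card U * (3/8)" V]
        by (subst nn_integral_cmult_indicator) (simp_all only: emSS sets_lborel, auto)
      also have "\<dots> \<le> (\<integral>\<^sup>+x. (\<Sum>\<omega>\<in>Pow U. emeasure (?P \<omega>) ((\<lambda>y. (y, x)) -` W \<omega>)) \<partial>lborel)"
      proof (rule nn_integral_mono)
        fix x
        show "ennreal (2 ^ card U * (3/8)) * indicator ?SS x \<le> (\<Sum>\<omega>\<in>Pow U. emeasure (?P \<omega>) ((\<lambda>y. (y, x)) -` W \<omega>))"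
        proof (cases "x \<in> ?SS")
          case True
          then obtain k where k: "k \<in> U" "x \<in> S k" by blast
          define g where "g \<omega> = measure (?P \<omega>) (bad_event D F xs Ts (f \<omega>) \<rho> x)" for \<omega>
          \<comment> \<open>Half of the vertices remain after removing \<open>k\<close>; each
            represents an edge with the bound 3/4.\<close>
          have "2 ^ card U * (3/8) = (\<Sum>\<omega>\<in>Pow (U - {k}). (3/4::real))"
            using U k(1) card_Suc_Diff1[OF U k(1)] by (simp add: card_Pow) (metis power_Suc mult.commute)
          also have "\<dots> \<le> (\<Sum>\<omega>\<in>Pow (U - {k}). g \<omega> + g (insert k \<omega>))"
            unfolding g_def using two_point_bad_events[OF P F sep tilt \<kappa>] k by (intro sum_mono) auto
          also have "\<dots> = (\<Sum>\<omega>\<in>Pow U. g \<omega>)" by (rule sum_Pow_remove[OF U k(1), symmetric])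
          finally have "ennreal (2 ^ card U * (3/8)) \<le> ennreal (\<Sum>\<omega>\<in>Pow U. g \<omega>)" by (rule ennreal_leI)
          also have "\<dots> = (\<Sum>\<omega>\<in>Pow U. ennreal (g \<omega>))" by (subst sum_ennreal) (auto simp: g_def)
          also have "\<dots> = (\<Sum>\<omega>\<in>Pow U. emeasure (?P \<omega>) ((\<lambda>y. (y, x)) -` W \<omega>))"
          proof (rule sum.cong[OF refl])
            fix \<omega>
            interpret Pw: prob_space "?P \<omega>" by (rule prob_space_obs_law[OF P])
            show "ennreal (g \<omega>) = emeasure (?P \<omega>) ((\<lambda>y. (y, x)) -` W \<omega>)"
              unfolding Wx g_def using True by (simp only: if_True Pw.emeasure_eq_measure)
          qed
          finally show ?thesis using True by simp
        qed simp
      qed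
      also have "\<dots> = (\<Sum>\<omega>\<in>Pow U. emeasure (?P \<omega> \<Otimes>\<^sub>M lborel) (W \<omega>))"
        unfolding alt2 using meas by (intro nn_integral_sum) auto
      finally show ?thesis .
    qed
    have "ennreal (2 ^ card U * (3/8) * V) \<le> (\<Sum>\<omega>\<in>Pow U. ennreal (V * (measure (?P \<omega>) (A \<omega>) + 1/8)))"
      by (rule order_trans[OF lower sum_mono[OF upper]])
    also have "\<dots> = ennreal (\<Sum>\<omega>\<in>Pow U. V * (measure (?P \<omega>) (A \<omega>) + 1/8))"
      using V(2) by (intro sum_ennreal) auto
    finally have "2 ^ card U * (3/8) * V \<le> (\<Sum>\<omega>\<in>Pow U. V * (measure (?P \<omega>) (A \<omega>) + 1/8))"
      using V(2) by (subst (asm) ennreal_le_iff) (auto intro!: sum_nonneg)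
    also have "\<dots> < (\<Sum>\<omega>\<in>Pow U. V * (3/8))"
    proof (rule sum_strict_mono)
      fix \<omega> assume "\<omega> \<in> Pow U"
      then have "measure (?P \<omega>) (A \<omega>) < 1/4" using H by (auto simp: not_le)
      then show "V * (measure (?P \<omega>) (A \<omega>) + 1/8) < V * (3/8)" using V(2) by (intro mult_strict_left_mono) auto
    qed (use U in auto)
    also have "\<dots> = 2 ^ card U * (3/8) * V" using U by (simp add: card_Pow)
    finally show False by simp
  qed
  then show "\<exists>\<theta>\<in>\<Theta>. ennreal (1/4) \<le> exceed_prob P D (Lp_loss p) C r F \<theta>"
    using exc mem by blast
qed

section \<open>Choice of the scale\<close>

text \<open>The middle half of the cell in every direction, where the bump is bounded below. The
  cores of all unit cells still fill the fixed share (1/2)^d of the cube.\<close>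

definition cell_core :: "real \<Rightarrow> real^'d \<Rightarrow> ('d::finite \<Rightarrow> int) \<Rightarrow> (real^'d) set" where
  "cell_core M z k = cbox (\<chi> j. z $ j + (of_int (k j) + 1/4) / M) (\<chi> j. z $ j + (of_int (k j) + 3/4) / M)"

lemma cell_core_coordinates:
  assumes "x \<in> cell_core M z k" "0 < M"
  shows "1/4 \<le> M * (x $ j - z $ j) - of_int (k j)" "M * (x $ j - z $ j) - of_int (k j) \<le> 3/4"
proof -
  have "(of_int (k j) + 1/4) / M \<le> x $ j - z $ j" "x $ j - z $ j \<le> (of_int (k j) + 3/4) / M"
    using assms(1) by (auto simp: cell_core_def mem_box_cart algebra_simps)
  then show "1/4 \<le> M * (x $ j - z $ j) - of_int (k j)" "M * (x $ j - z $ j) - of_int (k j) \<le> 3/4"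
    using assms(2) by (simp_all add: pos_divide_le_eq pos_le_divide_eq mult.commute)
qed

lemma cell_core_floor:
  assumes "x \<in> cell_core M z k" "0 < M"
  shows "\<lfloor>M * (x $ j - z $ j)\<rfloor> = k j"
  using cell_core_coordinates[OF assms, of j] by (intro floor_unique) linarith+

lemma cells_bump_cell_core:
  fixes z :: "real^'d"
  assumes "x \<in> cell_core M z k" "0 < M" and K: "finite K"
  shows "cells_bump m M z K (\<lambda>_. 0) x = (if k \<in> K then cells_bump m M z {k} (\<lambda>_. 0) x else 0)"
    and "((3/16) ^ m) ^ CARD('d) \<le> cells_bump m M z {k} (\<lambda>_. 0) x"
proof -
  show "cells_bump m M z K (\<lambda>_. 0) x = (if k \<in> K then cells_bump m M z {k} (\<lambda>_. 0) x else 0)"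
    using K by (simp add: cells_bump_eq cell_core_floor[OF assms(1,2)] Let_def)
  have "(\<Prod>j\<in>(UNIV::'d set). (3/16::real) ^ m) \<le> (\<Prod>j\<in>UNIV. bump m 0 (M * (x $ j - z $ j) - of_int (k j)))"
    using cell_core_coordinates[OF assms(1,2)] by (intro prod_mono) (auto intro: bump_0_ge)
  then show "((3/16) ^ m) ^ CARD('d) \<le> cells_bump m M z {k} (\<lambda>_. 0) x"
    by (simp add: cells_bump_def)
qed

lemma disjoint_family_cell_core:
  fixes z :: "real^'d"
  assumes "0 < M"
  shows "disjoint_family_on (cell_core M z) U"
  unfolding disjoint_family_on_def
proof (intro ballI impI)
  fix j k :: "'d \<Rightarrow> int" assume "j \<noteq> k"
  have False if "x \<in> cell_core M z j" "x \<in> cell_core M z k" for x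
  proof -
    have "j i = k i" for i
      using cell_core_floor[OF that(1) assms, of i] cell_core_floor[OF that(2) assms, of i] by simp
    then show False using \<open>j \<noteq> k\<close> by blast
  qed
  then show "cell_core M z j \<inter> cell_core M z k = {}" by blast
qed

lemma measure_cell_core:
  fixes z :: "real^'d"
  assumes "0 < M"
  shows "measure lborel (cell_core M z k) = (1 / (2 * M)) ^ CARD('d)"
proof -
  have "(of_int (k j) + 1/4) / M \<le> (of_int (k j) + 3/4) / M" for j
    using assms by (intro divide_right_mono) auto
  then have ne: "cell_core M z k \<noteq> {}" unfolding cell_core_def by (simp add: interval_ne_empty_cart)
  have "(of_int (k j) + 3/4) / M - (of_int (k j) + 1/4) / M = 1 / (2 * M)" for j
    using assms by (simp add: field_simps)
  then show ?thesis using ne unfolding cell_core_def by (subst content_cbox_cart) simp_all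
qed

definition unit_cells :: "nat \<Rightarrow> ('d::finite \<Rightarrow> int) set" where
  "unit_cells M = PiE UNIV (\<lambda>_. {0..<int M})"

lemma unit_cells:
  shows finite_unit_cells: "finite (unit_cells M :: ('d::finite \<Rightarrow> int) set)"
    and card_unit_cells: "card (unit_cells M :: ('d \<Rightarrow> int) set) = M ^ CARD('d)"
    and unit_cells_less: "k \<in> (unit_cells M :: ('d \<Rightarrow> int) set) \<Longrightarrow> k j < int M"
  unfolding unit_cells_def by (auto intro!: finite_PiE simp: card_PiE)

lemma cell_core_subset_unit:
  assumes "k \<in> unit_cells M" "1 \<le> M"
  shows "cell_core (real M) 0 k \<subseteq> cbox 0 1"
proof
  fix x assume x: "x \<in> cell_core (real M) 0 k"
  have "0 \<le> x $ j \<and> x $ j \<le> 1" for j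
  proof -
    have "k j \<in> {0..<int M}" using assms(1) by (simp add: unit_cells_def PiE_iff)
    then have kj: "0 \<le> k j" "k j + 1 \<le> int M" by simp_all
    have "1/4 \<le> real M * x $ j - of_int (k j)" "real M * x $ j - of_int (k j) \<le> 3/4"
      using cell_core_coordinates[OF x, of j] assms(2) by simp_all
    moreover have "0 \<le> real_of_int (k j)" "real_of_int (k j) + 1 \<le> real M" using kj by linarith+
    ultimately have "0 \<le> real M * x $ j" "real M * x $ j \<le> real M * 1" by linarith+
    then show ?thesis using assms(2) by (simp add: zero_le_mult_iff)
  qed
  then show "x \<in> cbox 0 1" by (simp add: mem_box_cart)
qed

text \<open>\<open>q\<close> is d/\<delta> rounded up, as the tubes demand, and \<open>M\<close> is
  1/h rounded down but capped at \<open>q\<close>. If the cap is active, M = q and no line meets a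
  cell; otherwise the rounding loses at most a factor 2. In both cases the cells have side at least
  \<open>h\<close>, which is what the separation of the hypotheses needs.\<close>

lemma scale_choice:
  fixes h \<delta> :: real and d :: nat
  assumes h: "0 < h" "h \<le> 1" and \<delta>: "0 < \<delta>" "\<delta> \<le> 1" and d: "1 \<le> d"
  obtains M q :: nat where "1 \<le> M" "M \<le> q" "real M * h \<le> 1" "M \<noteq> q \<Longrightarrow> 1 \<le> 2 * (real M * h)"
    "real d \<le> \<delta> * real q" "\<delta> * real q \<le> 2 * real d"
proof -
  define q where "q = nat \<lceil>real d / \<delta>\<rceil>"
  define N where "N = nat \<lfloor>1 / h\<rfloor>"
  have dd: "1 \<le> real d / \<delta>" using \<delta> d by (simp add: le_divide_eq)
  have q1: "real d / \<delta> \<le> real q" "real q \<le> real d / \<delta> + 1" using dd unfolding q_def by linarith+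
  have h1: "1 \<le> 1 / h" using h by simp
  then have N: "1 \<le> N" "real N \<le> 1 / h" "1 / h \<le> real N + 1" unfolding N_def by linarith+
  show ?thesis
  proof (rule that[of "min q N" q])
    show "1 \<le> min q N" using q1(1) dd N(1) by linarith
    show "min q N \<le> q" by simp
    have "real (min q N) \<le> 1 / h" using N(2) by linarith
    then show "real (min q N) * h \<le> 1" using h by (simp add: pos_le_divide_eq)
    show "1 \<le> 2 * (real (min q N) * h)" if "min q N \<noteq> q"
    proof -
      have "1 / h \<le> 2 * real N" using N by linarith
      moreover have "min q N = N" using that by linarith
      ultimately show ?thesis using h by (simp add: pos_divide_le_eq)
    qed
    show "real d \<le> \<delta> * real q" using q1(1) \<delta> by (simp add: pos_divide_le_eq mult.commute)
    have "real q \<le> 2 * (real d / \<delta>)" using q1(2) dd by linarith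
    then show "\<delta> * real q \<le> 2 * real d" using \<delta> by (simp add: pos_le_divide_eq mult.commute)
  qed
qed

section \<open>Constants independent of the sample size, and the family of hypotheses at one
  scale\<close>

locale snake_constants =
  fixes \<beta> L\<beta> Cn Cc B \<eta> c :: real and l :: nat and L :: "nat \<Rightarrow> real" and i :: "'d::finite"
  assumes card: "2 \<le> CARD('d)" and \<beta>: "1 \<le> \<beta>" "real l < \<beta>" "\<beta> \<le> real l + 1"
    and L: "\<And>k. k \<le> l \<Longrightarrow> 0 < L k" and L\<beta>: "0 < L\<beta>" and Cn: "0 < Cn" and Cc: "0 < Cc"
    and B: "1 \<le> B" "\<And>n s. n \<le> l + 2 \<Longrightarrow> \<bar>bump (l + 2) n s\<bar> \<le> B"
    and c: "0 < c" and \<eta>: "0 < \<eta>" "\<eta> \<le> c" "c + \<eta> \<le> L 0"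
    and \<eta>L: "\<And>k. 1 \<le> k \<Longrightarrow> k \<le> l \<Longrightarrow> \<eta> * (real CARD('d) ^ k * B ^ CARD('d)) \<le> L k"
    and \<eta>L\<beta>: "\<eta> * (2 * real CARD('d) ^ Suc l * B ^ CARD('d)) \<le> L\<beta>"
begin

definition field :: "nat \<Rightarrow> real^'d \<Rightarrow> ('d \<Rightarrow> int) set \<Rightarrow> real^'d \<Rightarrow> real^'d" where
  "field M z K = ridge_field i
     (\<lambda>x. c + \<eta> * real M powr - \<beta> * cells_bump (l + 2) (real M) z K (\<lambda>_. 0) x)"

definition D0 :: real where "D0 = 2 * (\<beta> + 1) + real CARD('d)"

text \<open>The constant of the divergence bound without \<eta>^2: pieces that hit a cell,
  observations per piece, noise constant with travel time, and the factor 2^D0 lost by rounding the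
  scale. It is free of \<open>\<eta>\<close>, so that \<open>\<eta>\<close> can be chosen
  afterwards.\<close>

definition A0 :: real where
  "A0 = 2 * (4 * real CARD('d)) ^ (CARD('d) - 1) * (1 + Cc / c) * Cn / c\<^sup>2 * 2 powr D0"

definition b0 :: real where "b0 = ((3/16) ^ (l + 2)) ^ CARD('d)"

lemma D0_pos: "0 < D0" using \<beta> by (simp add: D0_def add_pos_nonneg)

lemma b0_pos: "0 < b0" by (simp add: b0_def)

lemma field_diff_norm:
  assumes x: "x \<in> cell_core (real M) z k" and M: "1 \<le> M" and K: "finite K" "finite K'" "k \<in> K" "k \<notin> K'"
  shows "\<eta> * real M powr - \<beta> * b0 \<le> norm (field M z K x - field M z K' x)"
proof -
  let ?e = "\<eta> * real M powr - \<beta>"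
  have M0: "0 < real M" using M by simp
  have e: "0 \<le> ?e" using \<eta> by simp
  note b = cells_bump_cell_core[OF x M0]
  have "?e * b0 \<le> ?e * cells_bump (l + 2) (real M) z {k} (\<lambda>_. 0) x"
    unfolding b0_def by (intro mult_left_mono b(2)[OF finite.emptyI] e)
  also have "\<dots> \<le> \<bar>?e * cells_bump (l + 2) (real M) z {k} (\<lambda>_. 0) x\<bar>" by (rule abs_ge_self)
  also have "\<dots> = norm (field M z K x - field M z K' x)"
    using b(1)[OF K(1)] b(1)[OF K(2)] K(3,4)
    by (simp add: field_def ridge_field_def scaleR_left_diff_distrib[symmetric])
  finally show ?thesis .
qed

lemma field_diff_norm':
  assumes "x \<in> cell_core (real M) z k" "1 \<le> M" "finite K" "finite K'" "k \<notin> K" "k \<in> K'"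
  shows "\<eta> * real M powr - \<beta> * b0 \<le> norm (field M z K x - field M z K' x)"
  using field_diff_norm[OF assms(1,2,4,3,6,5)] by (simp add: norm_minus_commute)

lemma field_measurable:
  "field M z K \<in> borel_measurable borel"
proof -
  have "continuous_on UNIV (field M z K)"
    unfolding field_def ridge_field_def[abs_def] by (intro continuous_intros continuous_on_cells_bump) simp
  then show ?thesis by (rule borel_measurable_continuous_onI)
qed

lemma divergence_bound:
  fixes M q n :: nat and T \<delta> h :: real
  assumes M: "1 \<le> M" "real M * h \<le> 1" "1 \<le> 2 * (real M * h)" and q: "\<delta> * real q \<le> 2 * real CARD('d)"
    and \<delta>: "0 < \<delta>" and T: "0 < T" and h: "0 < h" "1 \<le> h * (real n / T)"
  shows "2 * (2 * real q / real M) ^ (CARD('d) - 1) * max 1 (Cc * (1 / (real M * c)) * (real n / T)) *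
      (Cn * (\<eta> * real M powr - \<beta> * (1 / (real M * c)))\<^sup>2)
    \<le> \<eta>\<^sup>2 * A0 * (inverse (\<delta> ^ (CARD('d) - 1)) * inverse T * real n * h powr D0)"
proof -
  let ?d = "CARD('d)" and ?D = "real CARD('d)"
  define H where "H = 1 / real M"
  have H: "0 < H" "h \<le> H" using M h by (simp_all add: H_def pos_le_divide_eq mult.commute)
  have "1 \<le> 2 * h * real M" using M(3) by (simp only: mult_ac)
  then have H2: "H \<le> 2 * h" using M(1) unfolding H_def by (subst pos_divide_le_eq) auto
  have nT: "0 < real n / T" using h by (metis mult_le_0_iff not_less not_one_le_zero order_trans less_eq_real_def)
  have 1: "(2 * real q / real M) ^ (?d - 1) \<le> (4 * ?D) ^ (?d - 1) * inverse (\<delta> ^ (?d - 1)) * H ^ (?d - 1)"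
  proof -
    have "real q \<le> 2 * ?D / \<delta>" using q \<delta> by (simp add: pos_le_divide_eq mult.commute)
    then have "2 * real q * H \<le> 2 * (2 * ?D / \<delta>) * H" using H by (intro mult_right_mono mult_left_mono) auto
    then have "2 * real q / real M \<le> 4 * ?D * inverse \<delta> * H" by (simp add: H_def divide_inverse mult_ac)
    then have "(2 * real q / real M) ^ (?d - 1) \<le> (4 * ?D * inverse \<delta> * H) ^ (?d - 1)"
      by (intro power_mono) auto
    then show ?thesis by (simp add: power_mult_distrib power_inverse)
  qed
  \<comment> \<open>From h \<le> H and 1 \<le> h n/T one has 1 \<le> H n/T, which absorbs the
    maximum with 1.\<close>
  have 2: "max 1 (Cc * (1 / (real M * c)) * (real n / T)) \<le> (1 + Cc / c) * (H * (real n / T))"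
  proof -
    have "1 \<le> H * (real n / T)" using h(2) H nT by (meson mult_right_mono order_trans less_imp_le)
    moreover have "0 \<le> Cc / c * (H * (real n / T))"
      using Cc c H nT by (intro mult_nonneg_nonneg divide_nonneg_nonneg[of Cc]) linarith+
    moreover have "Cc * (1 / (real M * c)) * (real n / T) = Cc / c * (H * (real n / T))" by (simp add: H_def)
    ultimately show ?thesis unfolding distrib_right by (intro max.boundedI) linarith+
  qed
  have 3: "Cn * (\<eta> * real M powr - \<beta> * (1 / (real M * c)))\<^sup>2 = Cn / c\<^sup>2 * \<eta>\<^sup>2 * H powr (2 * \<beta> + 2)"
  proof -
    have "real M powr - \<beta> * (1 / real M) = H powr (\<beta> + 1)"
      using M(1) unfolding H_def by (simp add: powr_divide powr_add powr_minus field_simps)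
    moreover have "\<eta> * real M powr - \<beta> * (1 / (real M * c)) = \<eta> / c * (real M powr - \<beta> * (1 / real M))"
      by simp
    moreover have "(H powr (\<beta> + 1))\<^sup>2 = H powr (2 * \<beta> + 2)"
      using H by (simp add: power2_eq_square powr_add[symmetric])
    ultimately show ?thesis by (simp only: power_mult_distrib power_divide) simp
  qed
  have "2 * (2 * real q / real M) ^ (?d - 1) * max 1 (Cc * (1 / (real M * c)) * (real n / T)) *
      (Cn * (\<eta> * real M powr - \<beta> * (1 / (real M * c)))\<^sup>2)
    \<le> 2 * ((4 * ?D) ^ (?d - 1) * inverse (\<delta> ^ (?d - 1)) * H ^ (?d - 1)) * ((1 + Cc / c) * (H * (real n / T))) *
      (Cn / c\<^sup>2 * \<eta>\<^sup>2 * H powr (2 * \<beta> + 2))"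
    unfolding 3
  proof (rule mult_right_mono, rule mult_mono)
    show "2 * (2 * real q / real M) ^ (?d - 1) \<le>
        2 * ((4 * ?D) ^ (?d - 1) * inverse (\<delta> ^ (?d - 1)) * H ^ (?d - 1))"
      using 1 by linarith
    show "0 \<le> 2 * ((4 * ?D) ^ (?d - 1) * inverse (\<delta> ^ (?d - 1)) * H ^ (?d - 1))"
      using H \<delta> by simp
  qed (use 2 Cn in auto)
  also have "\<dots> = \<eta>\<^sup>2 * (2 * (4 * ?D) ^ (?d - 1) * (1 + Cc / c) * Cn / c\<^sup>2) *
      (inverse (\<delta> ^ (?d - 1)) * inverse T * real n) * (H ^ (?d - 1) * H * H powr (2 * \<beta> + 2))"
    by (simp add: divide_inverse mult_ac)
  also have "H ^ (?d - 1) * H * H powr (2 * \<beta> + 2) = H powr D0"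
  proof -
    have "H ^ (?d - 1) * H = H ^ ?d" using card by (simp add: power_eq_if[of H ?d] mult.commute)
    also have "\<dots> = H powr ?D" using H by (simp add: powr_realpow)
    finally show ?thesis using H by (simp add: powr_add[symmetric] D0_def algebra_simps)
  qed
  also have "\<eta>\<^sup>2 * (2 * (4 * ?D) ^ (?d - 1) * (1 + Cc / c) * Cn / c\<^sup>2) *
      (inverse (\<delta> ^ (?d - 1)) * inverse T * real n) * H powr D0 \<le>
    \<eta>\<^sup>2 * (2 * (4 * ?D) ^ (?d - 1) * (1 + Cc / c) * Cn / c\<^sup>2) *
      (inverse (\<delta> ^ (?d - 1)) * inverse T * real n) * (2 powr D0 * h powr D0)"
  proof (rule mult_left_mono)
    have "H powr D0 \<le> (2 * h) powr D0" using H H2 D0_pos by (intro powr_mono2) auto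
    then show "H powr D0 \<le> 2 powr D0 * h powr D0" using h by (simp add: powr_mult)
    show "0 \<le> \<eta>\<^sup>2 * (2 * (4 * ?D) ^ (?d - 1) * (1 + Cc / c) * Cn / c\<^sup>2) *
      (inverse (\<delta> ^ (?d - 1)) * inverse T * real n)"
      using Cn Cc c \<delta> T by (intro mult_nonneg_nonneg divide_nonneg_nonneg) auto
  qed
  also have "\<dots> = \<eta>\<^sup>2 * A0 * (inverse (\<delta> ^ (?d - 1)) * inverse T * real n * h powr D0)"
    by (simp add: A0_def)
  finally show ?thesis .
qed

text \<open>The factor \<open>M\<close> in the number of pieces cancels against the duration 1/(M
  c), so the bound on the total time depends on the scale only through \<open>\<delta>\<close>. The
  number of pieces is at most n/2 because M h \<le> 1 \<le> h n/T gives M T \<le> n; as n \<ge> 2,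
  one more trajectory fits.\<close>

lemma grid_size:
  fixes M q n :: nat and T \<delta> h :: real
  assumes M: "1 \<le> M" "M \<le> q" "real M * h \<le> 1" and q: "\<delta> * real q \<le> 2 * real CARD('d)"
    and \<delta>: "0 < \<delta>" and T: "0 < T" and h: "0 < h" "1 \<le> h * (real n / T)" and n: "2 \<le> n"
    and time: "5 * (10 * real CARD('d)) ^ (CARD('d) - 1) / c < T * \<delta> ^ (CARD('d) - 1)"
    and number: "10 * (10 * real CARD('d)) ^ (CARD('d) - 1) \<le> T * \<delta> ^ (CARD('d) - 1)"
  shows "real ((4 * M + 1) * (4 * q + 1) ^ (CARD('d) - 1)) * (1 / (real M * c)) < T"
    and "(4 * M + 1) * (4 * q + 1) ^ (CARD('d) - 1) + 1 \<le> n"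
proof -
  let ?d = "CARD('d)" and ?D = "real CARD('d)"
  let ?g = "real ((4 * M + 1) * (4 * q + 1) ^ (?d - 1))"
  define Q where "Q = (10 * ?D) ^ (?d - 1) / \<delta> ^ (?d - 1)"
  have \<delta>d: "0 < \<delta> ^ (?d - 1)" using \<delta> by simp
  have "?g = (4 * real M + 1) * (4 * real q + 1) ^ (?d - 1)"
    by (simp only: of_nat_mult of_nat_add of_nat_power of_nat_numeral of_nat_1)
  also have "\<dots> \<le> (5 * real M) * (5 * real q) ^ (?d - 1)"
    using M by (intro mult_mono power_mono) auto
  also have "\<dots> \<le> (5 * real M) * (10 * ?D / \<delta>) ^ (?d - 1)"
  proof (intro mult_left_mono power_mono)
    have "5 * (\<delta> * real q) \<le> 5 * (2 * ?D)" using q by (intro mult_left_mono) auto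
    then show "5 * real q \<le> 10 * ?D / \<delta>" using \<delta> by (simp add: pos_le_divide_eq mult_ac)
  qed auto
  also have "\<dots> = 5 * real M * Q" by (simp add: Q_def power_divide)
  finally have g: "?g \<le> 5 * real M * Q" .
  have "?g * (1 / (real M * c)) \<le> 5 * real M * Q * (1 / (real M * c))"
    using g c by (intro mult_right_mono) auto
  also have "\<dots> = 5 * Q / c" using M by simp
  also have "\<dots> = (5 * (10 * ?D) ^ (?d - 1) / c) / \<delta> ^ (?d - 1)" by (simp add: Q_def)
  also have "\<dots> < T" unfolding pos_divide_less_eq[OF \<delta>d] by (rule time)
  finally show "?g * (1 / (real M * c)) < T" .
  have "10 * Q \<le> T" using number \<delta>d by (simp add: Q_def pos_divide_le_eq)
  have "real M * T \<le> n"
  proof -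
    have "T \<le> h * n" using h T by (simp add: pos_le_divide_eq)
    then have "real M * T \<le> (real M * h) * n" by (simp add: mult_left_mono mult.assoc)
    also have "\<dots> \<le> 1 * real n" using M by (intro mult_right_mono) auto
    finally show ?thesis by simp
  qed
  have "real M * (10 * Q) \<le> real M * T" using \<open>10 * Q \<le> T\<close> by (intro mult_left_mono) auto
  then have "2 * ?g \<le> n" using g \<open>real M * T \<le> n\<close> by linarith
  then have "real ((4 * M + 1) * (4 * q + 1) ^ (?d - 1) + 1) \<le> real n" using n by linarith
  then show "(4 * M + 1) * (4 * q + 1) ^ (?d - 1) + 1 \<le> n" by (simp only: of_nat_le_iff)
qed

lemma family_at_scale:
  fixes M q n :: nat and T \<delta> h :: real and P :: "(real^'d) measure" and D :: design and z :: "real^'d"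
  assumes M: "1 \<le> M" "M \<le> q" "real M * h \<le> 1" "M \<noteq> q \<Longrightarrow> 1 \<le> 2 * (real M * h)"
    and q: "real CARD('d) \<le> \<delta> * real q" "\<delta> * real q \<le> 2 * real CARD('d)"
    and \<delta>: "0 < \<delta>" and T: "0 < T" and h: "0 < h" "1 \<le> h * (real n / T)" and n: "2 \<le> n"
    and time: "5 * (10 * real CARD('d)) ^ (CARD('d) - 1) / c < T * \<delta> ^ (CARD('d) - 1)"
    and number: "10 * (10 * real CARD('d)) ^ (CARD('d) - 1) \<le> T * \<delta> ^ (CARD('d) - 1)"
    and P: "prob_space P" "sets P = sets borel" "noise_condition Cn P"
    and D: "\<forall>(f, xs, Ts) \<in> (snake_model_class \<beta> l L L\<beta> \<delta> T n :: 'd param set).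
       valid_times n Ts (D Ts) \<and> cover_time Cc n T Ts (D Ts)"
    and z: "\<And>j. \<bar>z $ j\<bar> \<le> 1" and U: "finite U" "\<And>k j. k \<in> U \<Longrightarrow> k j < int M"
  obtains xs Ts where
    "\<And>K. K \<subseteq> U \<Longrightarrow> (field M z K, xs, Ts) \<in> snake_model_class \<beta> l L L\<beta> \<delta> T n"
    "\<And>K K' k. K \<subseteq> U \<Longrightarrow> K' \<subseteq> U \<Longrightarrow> k \<in> U \<Longrightarrow> K - {k} = K' - {k} \<Longrightarrow>
      tilt_bounded (if M = q then 0 else
          \<eta>\<^sup>2 * A0 * (inverse (\<delta> ^ (CARD('d) - 1)) * inverse T * real n * h powr D0))
        (obs_law P D (field M z K, xs, Ts)) (obs_law P D (field M z K', xs, Ts))"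
proof -
  define e where "e = \<eta> * real M powr - \<beta>"
  have "real M powr - \<beta> \<le> real M powr 0" using M(1) \<beta> by (intro powr_mono) auto
  then have "e \<le> \<eta> * 1" unfolding e_def using \<eta> M(1) by (intro mult_left_mono) auto
  moreover have "0 \<le> e" using \<eta> by (simp add: e_def)
  ultimately have ee: "0 \<le> e" "e \<le> c" using \<eta> by linarith+
  interpret G: snake_grid i z "l + 2" M q c e
    using M(1,2) c ee z card by unfold_locales auto
  have field: "G.field K = field M z K" for K
  proof -
    have "G.speed K = (\<lambda>x. c + e * cells_bump (l + 2) (real M) z K (\<lambda>_. 0) x)"
      by (rule ext) (rule G.speed_def)
    then show ?thesis by (simp only: field_def e_def)
  qed
  have smooth: "G.field K \<in> smooth_class \<beta> l L L\<beta>" if "K \<subseteq> U" for K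
  proof (rule ridge_smooth_class[OF _ \<beta>(2,3) finite_subset[OF that U(1)] B _ e_def])
    show "G.field K x $ j = (if j = i then c + e * cells_bump (l + 2) (real M) z K (\<lambda>_. 0) x else 0)" for x j
      by (simp only: ridge_field_nth G.speed_def)
  qed (use M(1) \<eta> c L L\<beta> \<eta>L \<eta>L\<beta> in \<open>auto intro: less_imp_le\<close>)
  have "real ((4 * M + 1) * (4 * q + 1) ^ (CARD('d) - 1)) * (1 / (real M * c)) < T"
    "(4 * M + 1) * (4 * q + 1) ^ (CARD('d) - 1) + 1 \<le> n"
    by (rule grid_size[OF M(1,2,3) q(2) \<delta> T h n time number])+
  then have grid: "real (card G.grid) * G.dur < T" "card G.grid + 1 \<le> n"
    by (simp_all only: G.card_grid G.dur_def)
  have \<delta>q: "real CARD('d) / real q \<le> \<delta>" using q(1) M(1,2) by (simp add: pos_divide_le_eq)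
  have le: "(if M = q then 0 else 2 * (2 * real q / real M) ^ (CARD('d) - 1)) *
      max 1 (Cc * G.dur * (real n / T)) * (Cn * (e * G.dur)\<^sup>2) \<le>
    (if M = q then 0 else \<eta>\<^sup>2 * A0 * (inverse (\<delta> ^ (CARD('d) - 1)) * inverse T * real n * h powr D0))"
    unfolding G.dur_def e_def using divergence_bound[OF M(1,3,4) q(2) \<delta> T h]
    by (cases "M = q") simp_all
  show thesis
  proof (rule G.snake_family[where \<beta> = \<beta> and l = l and L = L and L\<beta> = L\<beta> and \<delta> = \<delta> and Tsum = T
      and n = n and P = P and D = D and Cn = Cn and Cc = Cc and U = U])
    show "k j < int M" if "k \<in> U" for k j by (rule U(2)[OF that])
    show "G.field K \<in> smooth_class \<beta> l L L\<beta>" if "K \<subseteq> U" for K by (rule smooth[OF that])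
    show "0 \<le> Cn" using Cn by simp
    fix xs Ts
    assume fam: "\<And>K. K \<subseteq> U \<Longrightarrow> (G.field K, xs, Ts) \<in> snake_model_class \<beta> l L L\<beta> \<delta> T n"
      and tilt: "\<And>K K' k. K \<subseteq> U \<Longrightarrow> K' \<subseteq> U \<Longrightarrow> k \<in> U \<Longrightarrow> K - {k} = K' - {k} \<Longrightarrow>
        tilt_bounded ((if M = q then 0 else 2 * (2 * real q / real M) ^ (CARD('d) - 1)) *
            max 1 (Cc * G.dur * (real n / T)) * (Cn * (e * G.dur)\<^sup>2))
          (obs_law P D (G.field K, xs, Ts)) (obs_law P D (G.field K', xs, Ts))"
    show thesis
    proof (rule that[of xs Ts])
      show "(field M z K, xs, Ts) \<in> snake_model_class \<beta> l L L\<beta> \<delta> T n" if "K \<subseteq> U" for K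
        using fam[OF that] unfolding field .
      show "tilt_bounded (if M = q then 0 else
          \<eta>\<^sup>2 * A0 * (inverse (\<delta> ^ (CARD('d) - 1)) * inverse T * real n * h powr D0))
        (obs_law P D (field M z K, xs, Ts)) (obs_law P D (field M z K', xs, Ts))"
        if "K \<subseteq> U" "K' \<subseteq> U" "k \<in> U" "K - {k} = K' - {k}" for K K' k
        using tilt_bounded_mono[OF tilt[OF that] le] unfolding field .
    qed
  qed (fact U(1) \<delta> \<delta>q grid P D)+
qed

end

locale snake_scale = snake_constants \<beta> L\<beta> Cn Cc B \<eta> c l L i
  for \<beta> L\<beta> Cn Cc B \<eta> c :: real and l :: nat and L :: "nat \<Rightarrow> real" and i :: "'d::finite" +
  fixes M q n :: nat and T \<delta> h :: real and P :: "(real^'d) measure" and D :: design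
  assumes M: "1 \<le> M" "M \<le> q" "real M * h \<le> 1" "M \<noteq> q \<Longrightarrow> 1 \<le> 2 * (real M * h)"
    and q: "real CARD('d) \<le> \<delta> * real q" "\<delta> * real q \<le> 2 * real CARD('d)"
    and \<delta>: "0 < \<delta>" and T: "0 < T" and h: "0 < h" "1 \<le> h * (real n / T)" and n: "2 \<le> n"
    and time: "5 * (10 * real CARD('d)) ^ (CARD('d) - 1) / c < T * \<delta> ^ (CARD('d) - 1)"
    and number: "10 * (10 * real CARD('d)) ^ (CARD('d) - 1) \<le> T * \<delta> ^ (CARD('d) - 1)"
    and P: "prob_space P" "sets P = sets borel" "noise_condition Cn P"
    and D: "\<forall>(f, xs, Ts) \<in> (snake_model_class \<beta> l L L\<beta> \<delta> T n :: 'd param set).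
       valid_times n Ts (D Ts) \<and> cover_time Cc n T Ts (D Ts)"
begin

definition \<kappa> :: real where
  "\<kappa> = (if M = q then 0 else \<eta>\<^sup>2 * A0 * (inverse (\<delta> ^ (CARD('d) - 1)) * inverse T * real n * h powr D0))"

definition \<rho> :: real where "\<rho> = \<eta> * real M powr - \<beta> * b0 / 2"

abbreviation \<Theta> :: "'d param set" where "\<Theta> \<equiv> snake_model_class \<beta> l L L\<beta> \<delta> T n"

lemma \<rho>_pos: "0 < \<rho>" using \<eta> M(1) b0_pos by (simp add: \<rho>_def)

lemma rate_le: "\<eta> * b0 / 2 * h powr \<beta> \<le> \<rho>"
proof -
  have "h \<le> 1 / real M" using M by (simp add: pos_le_divide_eq mult.commute)
  then have "h powr \<beta> \<le> (1 / real M) powr \<beta>" using h \<beta> by (intro powr_mono2) auto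
  also have "\<dots> = real M powr - \<beta>" using M(1) by (simp add: powr_divide powr_minus field_simps)
  finally have "\<eta> * b0 / 2 * h powr \<beta> \<le> \<eta> * b0 / 2 * real M powr - \<beta>"
    using \<eta> b0_pos by (intro mult_left_mono) auto
  then show ?thesis by (simp add: \<rho>_def mult_ac)
qed

definition close_family :: "real^'d \<Rightarrow> ('d \<Rightarrow> int) set \<Rightarrow> (real^'d) list \<Rightarrow> real list \<Rightarrow> bool" where
  "close_family z U xs Ts \<longleftrightarrow> (\<forall>K. K \<subseteq> U \<longrightarrow> (field M z K, xs, Ts) \<in> \<Theta>) \<and>
    (\<forall>K K' k. K \<subseteq> U \<longrightarrow> K' \<subseteq> U \<longrightarrow> k \<in> U \<longrightarrow> K - {k} = K' - {k} \<longrightarrow>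
      tilt_bounded \<kappa> (obs_law P D (field M z K, xs, Ts)) (obs_law P D (field M z K', xs, Ts)))"

lemma close_familyD:
  assumes "close_family z U xs Ts"
  shows close_family_mem: "K \<subseteq> U \<Longrightarrow> (field M z K, xs, Ts) \<in> \<Theta>"
    and close_family_tilt: "K \<subseteq> U \<Longrightarrow> K' \<subseteq> U \<Longrightarrow> k \<in> U \<Longrightarrow> K - {k} = K' - {k} \<Longrightarrow>
      tilt_bounded \<kappa> (obs_law P D (field M z K, xs, Ts)) (obs_law P D (field M z K', xs, Ts))"
  using assms unfolding close_family_def by blast+

lemma close_family_exists:
  fixes z :: "real^'d"
  assumes z: "\<And>j. \<bar>z $ j\<bar> \<le> 1" and U: "finite U" "\<forall>k\<in>U. \<forall>j. k j < int M"
  shows "\<exists>xs Ts. close_family z U xs Ts"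
proof (rule family_at_scale[where z = z and U = U, OF M q \<delta> T h n time number P D, folded \<kappa>_def])
  show "\<bar>z $ j\<bar> \<le> 1" for j by (rule z)
  show "k j < int M" if "k \<in> U" for k j using U(2) that by blast
  fix xs Ts
  assume "\<And>K. K \<subseteq> U \<Longrightarrow> (field M z K, xs, Ts) \<in> \<Theta>"
    and "\<And>K K' k. K \<subseteq> U \<Longrightarrow> K' \<subseteq> U \<Longrightarrow> k \<in> U \<Longrightarrow> K - {k} = K' - {k} \<Longrightarrow>
      tilt_bounded \<kappa> (obs_law P D (field M z K, xs, Ts)) (obs_law P D (field M z K', xs, Ts))"
  then have "close_family z U xs Ts" unfolding close_family_def by blast
  then show ?thesis by blast
qed (fact U(1) | assumption)+

lemma pointwise_lower_bound:
  assumes x0: "x0 \<in> cbox 0 1" and \<kappa>: "\<kappa> \<le> 1/64" and C: "0 \<le> C"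
    and r: "r \<le> C * (\<eta> * b0 / 2 * h powr \<beta>)"
  shows "ennreal (1/4) \<le> minimax_prob P D \<Theta> (pointwise_loss x0) C r"
proof -
  \<comment> \<open>The lattice is shifted so that \<open>x0\<close> becomes the centre of the cell
    with index 0.\<close>
  define z :: "real^'d" where "z = (\<chi> j. x0 $ j - 1 / (2 * real M))"
  let ?U = "{\<lambda>_. 0} :: ('d \<Rightarrow> int) set"
  have M2: "0 < 1 / (2 * real M)" "1 / (2 * real M) \<le> 1" using M(1) by simp_all
  have z: "\<bar>z $ j\<bar> \<le> 1" for j
  proof -
    have "0 \<le> x0 $ j" "x0 $ j \<le> 1" using x0 by (auto simp: mem_box_cart)
    moreover have "z $ j = x0 $ j - 1 / (2 * real M)" by (simp add: z_def)
    ultimately show ?thesis using M2 by linarith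
  qed
  have x0_core: "x0 \<in> cell_core (real M) z (\<lambda>_. 0)"
    using M(1) by (simp add: cell_core_def mem_box_cart z_def field_simps)
  have "\<exists>xs Ts. close_family z ?U xs Ts"
    by (rule close_family_exists) (use z M(1) in auto)
  then obtain xs Ts where fam: "close_family z ?U xs Ts" by blast
  note mem = close_family_mem[OF fam] and tilt = close_family_tilt[OF fam]
  have "C * (\<eta> * b0 / 2 * h powr \<beta>) \<le> C * \<rho>" using rate_le C by (rule mult_left_mono)
  then have r': "r \<le> C * \<rho>" using r by simp
  show ?thesis
  proof (rule minimax_pointwise_two_point[where f = "field M z ?U" and f' = "field M z {}" and xs = xs and Ts = Ts
        and \<rho> = \<rho> and \<kappa> = \<kappa>])
    show "2 * \<rho> \<le> norm (field M z ?U x0 - field M z {} x0)"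
      using field_diff_norm[OF x0_core M(1), of ?U "{}"] by (simp add: \<rho>_def)
    show "tilt_bounded \<kappa> (obs_law P D (field M z ?U, xs, Ts)) (obs_law P D (field M z {}, xs, Ts))"
      by (rule tilt[of _ _ "\<lambda>_. 0"]) auto
  qed (use P mem r' C \<kappa> in auto)
qed

lemma sup_lower_bound:
  assumes card_ge: "2 \<le> ln (real (M ^ CARD('d)))" and \<kappa>: "\<kappa> \<le> ln (real (M ^ CARD('d))) / 4" and C: "0 \<le> C"
    and r: "r \<le> C * (\<eta> * b0 / 2 * h powr \<beta>)"
  shows "ennreal (1/4) \<le> minimax_prob P D \<Theta> sup_loss C r"
proof -
  let ?U = "unit_cells M :: ('d \<Rightarrow> int) set"
  let ?z = "0 :: real^'d"
  have "\<exists>xs Ts. close_family ?z ?U xs Ts"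
    by (rule close_family_exists) (auto simp: finite_unit_cells unit_cells_less)
  then obtain xs Ts where fam: "close_family ?z ?U xs Ts" by blast
  note mem = close_family_mem[OF fam] and tilt = close_family_tilt[OF fam]
  have "C * (\<eta> * b0 / 2 * h powr \<beta>) \<le> C * \<rho>" using rate_le C by (rule mult_left_mono)
  then have r': "r \<le> C * \<rho>" using r by simp
  define x :: "('d \<Rightarrow> int) \<Rightarrow> real^'d" where "x k = (\<chi> j. (of_int (k j) + 1/2) / real M)" for k
  have x: "x k \<in> cell_core (real M) ?z k" for k
    using M(1) by (auto simp: x_def cell_core_def mem_box_cart divide_right_mono)
  show ?thesis
  \<comment> \<open>The reference is the unperturbed field. It differs from each single-bump
    hypothesis in one cell, so the divergence stays that of one cell however many hypotheses there
    are.\<close>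
  proof (rule minimax_sup_many_points[where f = "\<lambda>k. field M ?z {k}" and g = "field M ?z {}" and xs = xs
        and Ts = Ts and U = ?U and \<rho> = \<rho> and \<kappa> = \<kappa> and x = x])
    show "2 * \<rho> \<le> norm (field M ?z {k} (x k) - field M ?z {j} (x k))" if "j \<noteq> k" for j k
      using field_diff_norm[OF x M(1), of "{k}" "{j}" k] that by (simp add: \<rho>_def)
    show "tilt_bounded \<kappa> (obs_law P D (field M ?z {k}, xs, Ts)) (obs_law P D (field M ?z {}, xs, Ts))"
      if "k \<in> ?U" for k
      by (rule tilt[of _ _ k]) (use that in auto)
    show "x k \<in> cbox 0 1" if "k \<in> ?U" for k
      using cell_core_subset_unit[OF that M(1)] x by blast
    show "2 \<le> ln (real (card ?U))" "\<kappa> \<le> ln (real (card ?U)) / 4"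
      using card_ge \<kappa> by (simp_all only: card_unit_cells)
    show "(field M ?z {k}, xs, Ts) \<in> \<Theta>" if "k \<in> ?U" for k using that by (intro mem) simp
  qed (use P r' C finite_unit_cells in auto)
qed

lemma Lp_lower_bound:
  assumes p: "1 \<le> p" and \<kappa>: "\<kappa> \<le> 1/64" and C: "0 < C"
    and r: "r \<le> C * (\<eta> * b0 / 2 * h powr \<beta> * ((1/2) ^ CARD('d) / 8))"
  shows "ennreal (1/4) \<le> minimax_prob P D \<Theta> (Lp_loss p) C r"
proof -
  let ?U = "unit_cells M :: ('d \<Rightarrow> int) set"
  let ?z = "0 :: real^'d" and ?S = "cell_core (real M) (0 :: real^'d)"
  have M0: "0 < real M" using M(1) by simp
  have "\<exists>xs Ts. close_family ?z ?U xs Ts"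
    by (rule close_family_exists) (auto simp: finite_unit_cells unit_cells_less)
  then obtain xs Ts where fam: "close_family ?z ?U xs Ts" by blast
  note mem = close_family_mem[OF fam] and tilt = close_family_tilt[OF fam]
  have "measure lborel (\<Union>k\<in>?U. ?S k) = (\<Sum>k\<in>?U. measure lborel (?S k))"
    using emeasure_lborel_cbox_finite
    by (intro measure_finite_Union finite_unit_cells disjoint_family_cell_core M0)
      (auto simp: cell_core_def less_top[symmetric])
  also have "\<dots> = (1/2) ^ CARD('d)"
    using M0 by (simp add: measure_cell_core card_unit_cells power_divide power_mult_distrib)
  finally have V: "(1/2) ^ CARD('d) = measure lborel (\<Union>k\<in>?U. ?S k)" ..
  have "C * (\<eta> * b0 / 2 * h powr \<beta> * ((1/2) ^ CARD('d) / 8)) \<le> C * (\<rho> * ((1/2) ^ CARD('d) / 8))"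
    using rate_le C by (intro mult_left_mono mult_right_mono) auto
  then have r': "r \<le> C * (\<rho> * ((1/2) ^ CARD('d) / 8))" using r by simp
  show ?thesis
  proof (rule minimax_Lp_hypercube[where f = "field M ?z" and xs = xs and Ts = Ts and U = ?U and S = ?S
        and \<rho> = \<rho> and \<kappa> = \<kappa>, OF P(1,2) _ finite_unit_cells field_measurable _ _ V _ _ \<rho>_pos r' C p _ \<kappa>])
    show "?S k \<subseteq> cbox 0 1" if "k \<in> ?U" for k by (rule cell_core_subset_unit[OF that M(1)])
    fix \<omega> k assume \<omega>: "\<omega> \<subseteq> ?U - {k}" and k: "k \<in> ?U"
    have fin: "finite \<omega>" using \<omega> finite_unit_cells finite_subset by blast
    show "2 * \<rho> \<le> norm (field M ?z \<omega> x - field M ?z (insert k \<omega>) x)" if "x \<in> ?S k" for x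
      using field_diff_norm'[OF that M(1) fin, of "insert k \<omega>"] fin \<omega> by (auto simp: \<rho>_def)
    show "tilt_bounded \<kappa> (obs_law P D (field M ?z \<omega>, xs, Ts)) (obs_law P D (field M ?z (insert k \<omega>), xs, Ts))"
      by (rule tilt[of _ _ k]) (use \<omega> k in auto)
  qed (auto simp: cell_core_def intro: mem)
qed

end

context snake_scale
begin

text \<open>From 2 M h \<ge> 1, ln M is at least (ln N - ln ln N)/D0 - ln 2. With y = ln N, the
  bounds ln y \<le> y/4 + 1 and y/4 \<ge> D0 + 1 show that the corrections use up at most half of ln
  N/D0.\<close>

lemma log_cells_ge:
  fixes N :: real
  assumes neq: "M \<noteq> q" and h_eq: "h = (N / ln N) powr - (1 / D0)" and N0: "0 < N" and N: "4 * D0 + 4 \<le> ln N"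
  shows "real CARD('d) * (ln N / (2 * D0)) \<le> ln (real (M ^ CARD('d)))"
proof -
  have y0: "0 < ln N" using N D0_pos by linarith
  have ln2: "ln 2 \<le> (1::real)" using ln_le_minus_one[of "2::real"] by simp
  have "ln (ln N) = ln (ln N / 4) + 2 * ln 2"
    using y0 ln_mult[of "ln N / 4" 4] ln_mult[of "2::real" 2] by simp
  also have "ln (ln N / 4) \<le> ln N / 4 - 1" using y0 by (intro ln_le_minus_one) simp
  finally have lny: "ln (ln N) \<le> ln N / 4 + 1" using ln2 by linarith
  have "0 \<le> ln (2 * (real M * h))" using M(4)[OF neq] by (intro ln_ge_zero) simp
  also have "\<dots> = ln 2 + ln (real M) + ln h" using M(1) h by (simp add: ln_mult)
  also have "ln h = - (1 / D0) * (ln N - ln (ln N))"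
    unfolding h_eq using N0 y0 by (simp add: ln_powr ln_div)
  finally have "(ln N - ln (ln N)) / D0 - 1 \<le> ln (real M)" using ln2 by simp
  moreover have "ln N / (2 * D0) \<le> (ln N - ln (ln N)) / D0 - 1"
  proof -
    have "ln N / 2 \<le> ln N - ln (ln N) - D0" using lny N by linarith
    then have "(ln N / 2) / D0 \<le> (ln N - ln (ln N) - D0) / D0" using D0_pos by (intro divide_right_mono) auto
    then show ?thesis using D0_pos by (simp add: diff_divide_distrib)
  qed
  ultimately have "ln N / (2 * D0) \<le> ln (real M)" by linarith
  then have "real CARD('d) * (ln N / (2 * D0)) \<le> real CARD('d) * ln (real M)" by (intro mult_left_mono) auto
  then show ?thesis using M(1) by (simp add: ln_realpow)
qed

text \<open>At M = q the divergence is zero and the cells only have to be numerous: M \<ge>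
  1/\<delta> turns smallness of \<delta>^(d-1) into a lower bound on M^d.\<close>

lemma log_cells_ge_fine:
  assumes eq: "M = q" and a: "\<delta> ^ (CARD('d) - 1) \<le> exp (- a)" and \<delta>1: "\<delta> \<le> 1"
  shows "a \<le> ln (real (M ^ CARD('d)))"
proof -
  have "1 / \<delta> \<le> real q"
  proof -
    have "1 \<le> \<delta> * real q" using q(1) card by linarith
    then show ?thesis using \<delta> by (simp add: pos_divide_le_eq mult.commute)
  qed
  then have "ln (1 / \<delta>) \<le> ln (real M)" using \<delta> M eq by (subst ln_le_cancel_iff) auto
  then have lnM: "- ln \<delta> \<le> ln (real M)" using \<delta> by (simp add: ln_div)
  have "ln (\<delta> ^ (CARD('d) - 1)) \<le> ln (exp (- a))" using a \<delta> by (subst ln_le_cancel_iff) auto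
  then have "a \<le> real (CARD('d) - 1) * - ln \<delta>" using \<delta> by (simp add: ln_realpow)
  also have "\<dots> \<le> real CARD('d) * ln (real M)"
    using lnM \<delta> \<delta>1 by (intro mult_mono) auto
  finally show ?thesis using M(1) by (simp add: ln_realpow)
qed

end

section \<open>Choice of the constants and assembly\<close>

lemma eventually_small_mult_le:
  fixes a b :: real
  assumes "0 < b"
  shows "eventually (\<lambda>x. x * a \<le> b) (at_right 0)" "eventually (\<lambda>x. x\<^sup>2 * a \<le> b) (at_right 0)"
proof -
  have "((\<lambda>x. x * a) \<longlongrightarrow> 0 * a) (at_right 0)" "((\<lambda>x. x\<^sup>2 * a) \<longlongrightarrow> 0\<^sup>2 * a) (at_right 0)"
    by (intro tendsto_intros)+
  then show "eventually (\<lambda>x. x * a \<le> b) (at_right 0)" "eventually (\<lambda>x. x\<^sup>2 * a \<le> b) (at_right 0)"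
    using assms by (auto dest!: order_tendstoD(2)[of _ _ _ b] elim: eventually_mono)
qed

text \<open>\<open>h\<close> solves N h^D = \<Lambda>. The level \<Lambda> = 1 keeps the divergence
  of constant order, for the pointwise and L^p losses; \<Lambda> = ln N lets it grow like the
  logarithm of the number of cells, for the supremum loss. With s = n/T, the condition N \<le> s^D
  ensures h n/T \<ge> 1.\<close>

lemma rate_scale:
  fixes N \<Lambda> D s :: real
  assumes \<Lambda>: "1 \<le> \<Lambda>" "\<Lambda> \<le> N" and D: "0 < D" and s: "0 < s" "N \<le> s powr D"
  defines "h \<equiv> (N / \<Lambda>) powr - (1 / D)"
  shows "0 < h" "h \<le> 1" "1 \<le> h * s" "N * h powr D = \<Lambda>" "h powr b = (N / \<Lambda>) powr - (b / D)"
proof -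
  have N: "0 < N" "1 \<le> N / \<Lambda>" using \<Lambda> by auto
  show h0: "0 < h" using N \<Lambda> by (simp add: h_def)
  show "h powr b = (N / \<Lambda>) powr - (b / D)" by (simp add: h_def powr_powr)
  have "h powr D = (N / \<Lambda>) powr - 1" unfolding h_def powr_powr using D by simp
  then show "N * h powr D = \<Lambda>" using N \<Lambda> by (simp add: powr_minus)
  have "(N / \<Lambda>) powr - (1 / D) \<le> (N / \<Lambda>) powr 0" using N D by (intro powr_mono) auto
  then show "h \<le> 1" using N \<Lambda> by (simp add: h_def)
  have "N / \<Lambda> \<le> N" using \<Lambda> N by (simp add: divide_le_eq)
  then have "(N / \<Lambda>) powr (1 / D) \<le> (s powr D) powr (1 / D)" using s N D by (intro powr_mono2) auto
  then have "(N / \<Lambda>) powr (1 / D) \<le> s" using s D by (simp add: powr_powr)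
  then have "h * (N / \<Lambda>) powr (1 / D) \<le> h * s" using h0 by (intro mult_left_mono) auto
  moreover have "h * (N / \<Lambda>) powr (1 / D) = 1" unfolding h_def using N \<Lambda> by (simp add: powr_minus)
  ultimately show "1 \<le> h * s" by simp
qed

theorem theorem4p7:
  fixes \<beta> L\<beta> Cnoise Ccvrtm p :: real and l :: nat and L :: "nat \<Rightarrow> real"
  assumes "CARD('d::finite) \<ge> 2" and "\<beta> \<ge> 1"
    and "real l < \<beta>" and "\<forall>k::int. real_of_int k < \<beta> \<longrightarrow> k \<le> int l"
    and "\<forall>k\<le>l. L k > 0" and "L\<beta> > 0" and "Cnoise > 0" and "Ccvrtm > 0" and "p \<ge> 1"
  shows "\<exists>C>0. \<forall>(n::nat) (\<delta>::real) (Tsum::real) (P :: (real^'d) measure) (D :: design).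
    n \<ge> 1 \<longrightarrow> \<delta> > 0 \<longrightarrow> Tsum > 0 \<longrightarrow>
    centered_noise P \<longrightarrow> noise_condition Cnoise P \<longrightarrow>
    (\<forall>(f, xs, Ts) \<in> (snake_model_class \<beta> l L L\<beta> \<delta> Tsum n :: 'd param set).
       valid_times n Ts (D Ts) \<and> cover_time Ccvrtm n Tsum Ts (D Ts)) \<longrightarrow>
    C * max ((Tsum / real n) powr (2 * \<beta> + real CARD('d) + 1)) (inverse Tsum)
      \<le> \<delta> ^ (CARD('d) - 1) \<longrightarrow>
    \<delta> ^ (CARD('d) - 1) \<le> inverse C * min 1 (real n / Tsum) \<longrightarrow>
    (let \<Theta> = snake_model_class \<beta> l L L\<beta> \<delta> Tsum n;
         N = inverse (\<delta> ^ (CARD('d) - 1)) * inverse Tsum * real n;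
         e = - (\<beta> / (2 * (\<beta> + 1) + real CARD('d)))
     in (\<forall>x0 \<in> cbox 0 1. minimax_prob P D \<Theta> (pointwise_loss x0) C (N powr e) \<ge> ennreal (1 / 4)) \<and>
        minimax_prob P D \<Theta> sup_loss C ((N / ln N) powr e) \<ge> ennreal (1 / 4) \<and>
        minimax_prob P D \<Theta> (Lp_loss p) C (N powr e) \<ge> ennreal (1 / 4))"
proof -
  let ?d = "CARD('d)" and ?D = "real CARD('d)"
  obtain i :: 'd where True by blast
  \<comment> \<open>Half of the bound \<open>L 0\<close> is for the base speed, the other half for
    the bumps.\<close>
  define c where "c = L 0 / 2"
  have c: "0 < c" "c + c = L 0" using assms(5) by (auto simp: c_def)
  obtain B where B: "1 \<le> B" "\<And>n s. n \<le> l + 2 \<Longrightarrow> \<bar>bump (l + 2) n s\<bar> \<le> B"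
    using bump_bounded[of "l + 2"] by blast
  have "\<beta> \<le> real l + 1"
  proof (rule ccontr)
    assume "\<not> \<beta> \<le> real l + 1"
    then have "real_of_int (int l + 1) < \<beta>" by simp
    then show False using assms(4) by fastforce
  qed
  define E where "E = 2 * (\<beta> + 1) + ?D"
  have E: "0 < E" using assms(2) by (simp add: E_def add_pos_nonneg)
  define A where "A = 2 * (4 * ?D) ^ (?d - 1) * (1 + Ccvrtm / c) * Cnoise / c\<^sup>2 * 2 powr E"
  \<comment> \<open>Each requirement holds for all small \<eta>. The bound 1/64 serves the two-point
    comparisons; d/(8 E) makes the divergence at most a quarter of (d/(2 E)) ln N, the lower bound
    for the logarithm of the number of cells.\<close>
  have "eventually (\<lambda>\<eta>. 0 < \<eta> \<and> \<eta> * 1 \<le> c \<and> (\<forall>k\<in>{1..l}. \<eta> * (?D ^ k * B ^ ?d) \<le> L k) \<and>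
      \<eta> * (2 * ?D ^ Suc l * B ^ ?d) \<le> L\<beta> \<and> \<eta>\<^sup>2 * A \<le> 1/64 \<and> \<eta>\<^sup>2 * A \<le> ?D / (8 * E)) (at_right 0)"
    using c assms E
    by (intro eventually_conj eventually_ball_finite eventually_small_mult_le eventually_at_right_less ballI) auto
  from eventually_happens[OF this]
  obtain \<eta> where \<eta>: "0 < \<eta>" "\<eta> \<le> c" "\<And>k. 1 \<le> k \<Longrightarrow> k \<le> l \<Longrightarrow> \<eta> * (?D ^ k * B ^ ?d) \<le> L k"
    "\<eta> * (2 * ?D ^ Suc l * B ^ ?d) \<le> L\<beta>" "\<eta>\<^sup>2 * A \<le> 1/64" "\<eta>\<^sup>2 * A \<le> ?D / (8 * E)"
    by auto
  interpret S: snake_constants \<beta> L\<beta> Cnoise Ccvrtm B \<eta> c l L i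
  proof
    show "0 < L k" if "k \<le> l" for k using assms(5) that by blast
    show "c + \<eta> \<le> L 0" using c(2) \<eta>(2) by linarith
  qed (fact assms(1-3,6-8) c(1) \<eta> B \<open>\<beta> \<le> real l + 1\<close> | assumption)+
  have A0: "S.A0 = A" and D0: "S.D0 = E" by (simp_all add: S.A0_def S.D0_def A_def E_def)
  define w where "w = \<eta> * S.b0 / 2 * ((1/2) ^ ?d / 8)"
  have "(1/2) ^ ?d \<le> (1::real)" by (intro power_le_one) auto
  then have "\<eta> * S.b0 / 2 * ((1/2) ^ ?d / 8) \<le> \<eta> * S.b0 / 2 * 1"
    using \<eta>(1) S.b0_pos by (intro mult_left_mono) auto
  then have w: "0 < w" "w \<le> \<eta> * S.b0 / 2"
    using \<eta>(1) S.b0_pos by (simp_all add: w_def)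
  \<comment> \<open>The summands in turn: 2 gives \<delta> \<le> 1 and n \<ge> 2; the exponential
    makes N and 1/\<delta>^(d-1) large; the next two provide the total time and the admissible
    number of trajectories; 1/w compensates the constants in the losses, \<open>w\<close> being the
    one of the L^p bound and the smallest.\<close>
  define C where "C = 2 + exp (4 * E + 4) + 5 * (10 * ?D) ^ (?d - 1) / c + 10 * (10 * ?D) ^ (?d - 1) + 1 / w"
  have Cterms: "0 \<le> 5 * (10 * ?D) ^ (?d - 1) / c" "0 \<le> 10 * (10 * ?D) ^ (?d - 1)" "0 \<le> 1 / w"
    using c w by auto
  have C: "2 \<le> C" "exp (4 * E + 4) \<le> C" "5 * (10 * ?D) ^ (?d - 1) / c < C" "10 * (10 * ?D) ^ (?d - 1) \<le> C" "1 / w \<le> C"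
    using Cterms exp_gt_zero[of "4 * E + 4"] unfolding C_def by linarith+
  have Cw: "1 \<le> C * w" using C(5) w(1) by (simp add: pos_divide_le_eq)
  show ?thesis
  proof (intro exI[of _ C] conjI allI impI)
    show "0 < C" using C(1) by linarith
    fix n :: nat and \<delta> T :: real and P :: "(real^'d) measure" and D :: design
    assume n: "n \<ge> 1" and \<delta>: "\<delta> > 0" and T: "T > 0" and cn: "centered_noise P" and noise: "noise_condition Cnoise P"
      and D: "\<forall>(f, xs, Ts) \<in> (snake_model_class \<beta> l L L\<beta> \<delta> T n :: 'd param set).
       valid_times n Ts (D Ts) \<and> cover_time Ccvrtm n T Ts (D Ts)"
      and lower: "C * max ((T / real n) powr (2 * \<beta> + real CARD('d) + 1)) (inverse T) \<le> \<delta> ^ (?d - 1)"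
      and upper: "\<delta> ^ (?d - 1) \<le> inverse C * min 1 (real n / T)"
    have P: "prob_space P" "sets P = sets borel" using cn by (auto simp: centered_noise_def)
    define v where "v = \<delta> ^ (?d - 1)"
    have v: "0 < v" using \<delta> by (simp add: v_def)
    define N where "N = inverse v * inverse T * real n"
    have C0: "0 < C" using C(1) by linarith
    have s0: "0 < real n / T" using n T by simp
    have "C * inverse T \<le> C * max ((T / real n) powr (2 * \<beta> + ?D + 1)) (inverse T)"
      using C0 by (intro mult_left_mono) auto
    then have "C * inverse T \<le> v" using lower by (simp add: v_def)
    then have Tv: "C \<le> T * v" using T by (simp add: divide_inverse[symmetric] pos_divide_le_eq mult.commute)
    have "inverse C * min 1 (real n / T) \<le> inverse C * 1" "inverse C * min 1 (real n / T) \<le> inverse C * (real n / T)"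
      using C0 by (intro mult_left_mono; simp)+
    then have vC: "v \<le> inverse C" "v \<le> inverse C * (real n / T)" using upper by (simp_all add: v_def)
    have \<delta>1: "\<delta> \<le> 1"
    proof (rule ccontr)
      assume "\<not> \<delta> \<le> 1"
      then have "1 \<le> v" unfolding v_def by (intro one_le_power) simp
      moreover have "inverse C < 1" using C(1) by (simp add: inverse_less_1_iff)
      ultimately show False using vC(1) by linarith
    qed
    have "C * v \<le> C * (inverse C * (real n / T))" using vC(2) C0 by (intro mult_left_mono) auto
    also have "\<dots> = real n / T" using C0 by simp
    finally have Cv: "C * v \<le> real n / T" .
    have CN: "C \<le> N"
    proof -
      have "C \<le> (real n / T) / v" unfolding pos_le_divide_eq[OF v] by (rule Cv)
      then show ?thesis by (simp add: N_def divide_inverse mult_ac)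
    qed
    have n2: "2 \<le> n"
    proof -
      have "C * v * T \<le> real n" using Cv T by (simp add: pos_le_divide_eq)
      moreover have "C * C \<le> C * (T * v)" using Tv C0 by (intro mult_left_mono) auto
      moreover have "2 * 1 \<le> C * C" using C(1) by (intro mult_mono) auto
      ultimately have "2 \<le> real n" by (simp add: mult_ac)
      then show ?thesis by simp
    qed
    \<comment> \<open>The exponent 2 \<beta> + d + 1 of the assumption is E - 1; the missing power
      is the factor n/T in N.\<close>
    have Ns: "N \<le> (real n / T) powr E"
    proof -
      let ?a = "2 * \<beta> + ?D + 1"
      have "1 * (T / real n) powr ?a \<le> C * max ((T / real n) powr ?a) (inverse T)"
        using C(1) by (intro mult_mono) auto
      then have "(T / real n) powr ?a \<le> v" using lower by (simp add: v_def)
      then have "inverse v \<le> inverse ((T / real n) powr ?a)" using T n by (intro le_imp_inverse_le) auto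
      also have "inverse ((T / real n) powr ?a) = (real n / T) powr ?a"
        using T n by (simp add: powr_divide)
      finally have "inverse v * (real n / T) \<le> (real n / T) powr ?a * (real n / T)"
        using s0 by (intro mult_right_mono) auto
      also have "\<dots> = (real n / T) powr ?a * (real n / T) powr 1" using s0 T by simp
      also have "\<dots> = (real n / T) powr E" unfolding powr_add[symmetric] by (simp add: E_def algebra_simps)
      finally show ?thesis by (simp add: N_def divide_inverse mult_ac)
    qed
    have lnN: "4 * E + 4 \<le> ln N"
    proof -
      have "exp (4 * E + 4) \<le> N" using C(2) CN by linarith
      moreover have "0 < N" using CN C0 by linarith
      ultimately show ?thesis by (simp add: ln_ge_iff)
    qed
    have N1: "1 \<le> N" "ln N \<le> N" "1 \<le> ln N"
      using CN C(1) lnN E ln_le_minus_one[of N] by linarith+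
    have time: "5 * (10 * ?D) ^ (?d - 1) / c < T * \<delta> ^ (?d - 1)" and number: "10 * (10 * ?D) ^ (?d - 1) \<le> T * \<delta> ^ (?d - 1)"
      using C(3,4) Tv unfolding v_def by linarith+
    have scale: "\<exists>M q. snake_scale \<beta> L\<beta> Cnoise Ccvrtm B \<eta> c l L M q n T \<delta> h P D"
      if h: "0 < h" "h \<le> 1" "1 \<le> h * (real n / T)" for h
    proof -
      have "1 \<le> ?d" using assms(1) by linarith
      then obtain M q :: nat where Mq: "1 \<le> M" "M \<le> q" "real M * h \<le> 1" "M \<noteq> q \<Longrightarrow> 1 \<le> 2 * (real M * h)"
        "?D \<le> \<delta> * real q" "\<delta> * real q \<le> 2 * ?D"
        using scale_choice[OF h(1,2) \<delta> \<delta>1] by blast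
      have "snake_scale \<beta> L\<beta> Cnoise Ccvrtm B \<eta> c l L M q n T \<delta> h P D"
        by (intro snake_scale.intro snake_scale_axioms.intro S.snake_constants_axioms) (fact Mq \<delta> T h n2 time number P noise D | assumption)+
      then show ?thesis by blast
    qed
    have r: "y \<le> C * (\<eta> * S.b0 / 2 * y)" "y \<le> C * (\<eta> * S.b0 / 2 * y * ((1/2) ^ ?d / 8))" if "0 \<le> y" for y
    proof -
      have "1 * y \<le> (C * w) * y" using Cw that by (rule mult_right_mono)
      then show "y \<le> C * (\<eta> * S.b0 / 2 * y * ((1/2) ^ ?d / 8))" by (simp add: w_def mult_ac)
      have "(C * w) * y \<le> (C * (\<eta> * S.b0 / 2)) * y"
        using w(2) C0 that by (intro mult_right_mono mult_left_mono) auto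
      then show "y \<le> C * (\<eta> * S.b0 / 2 * y)" using \<open>1 * y \<le> (C * w) * y\<close> by (simp add: mult_ac)
    qed
    define e where "e = - (\<beta> / E)"
    define h1 where "h1 = (N / 1) powr - (1 / E)"
    note R1 = rate_scale[of 1 N E "real n / T", OF order_refl N1(1) E s0 Ns, folded h1_def]
    obtain M1 q1 where "snake_scale \<beta> L\<beta> Cnoise Ccvrtm B \<eta> c l L M1 q1 n T \<delta> h1 P D"
      using scale[OF R1(1,2,3)] by blast
    then interpret X: snake_scale \<beta> L\<beta> Cnoise Ccvrtm B \<eta> c l L i M1 q1 n T \<delta> h1 P D .
    have \<kappa>1: "X.\<kappa> \<le> 1/64"
      using \<eta>(5) R1(4) unfolding X.\<kappa>_def A0 D0 v_def[symmetric] N_def[symmetric] by simp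
    have rate1: "h1 powr \<beta> = N powr e" using R1(5)[of \<beta>] by (simp add: e_def)
    define h2 where "h2 = (N / ln N) powr - (1 / E)"
    note R2 = rate_scale[of "ln N" N E "real n / T", OF N1(3,2) E s0 Ns, folded h2_def]
    obtain M2 q2 where "snake_scale \<beta> L\<beta> Cnoise Ccvrtm B \<eta> c l L M2 q2 n T \<delta> h2 P D"
      using scale[OF R2(1,2,3)] by blast
    then interpret Y: snake_scale \<beta> L\<beta> Cnoise Ccvrtm B \<eta> c l L i M2 q2 n T \<delta> h2 P D .
    have rate2: "h2 powr \<beta> = (N / ln N) powr e" using R2(5)[of \<beta>] by (simp add: e_def)
    have \<kappa>2: "2 \<le> ln (real (M2 ^ ?d)) \<and> Y.\<kappa> \<le> ln (real (M2 ^ ?d)) / 4"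
    proof (cases "M2 = q2")
      case True
      have "v \<le> exp (- 2)"
      proof -
        have "exp 2 \<le> C" using C(2) E by (intro order_trans[OF _ C(2)]) simp
        then have "inverse C \<le> inverse (exp 2)" by (intro le_imp_inverse_le) auto
        then show ?thesis using vC(1) by (simp add: exp_minus)
      qed
      from Y.log_cells_ge_fine[OF True this[unfolded v_def] \<delta>1]
      have "2 \<le> ln (real (M2 ^ ?d))" .
      moreover have "Y.\<kappa> = 0" unfolding Y.\<kappa>_def using True by simp
      ultimately show ?thesis by simp
    next
      case False
      have ge: "?D * (ln N / (2 * E)) \<le> ln (real (M2 ^ ?d))"
        using Y.log_cells_ge[OF False, of N] lnN N1(1) unfolding D0 h2_def by simp
      have "Y.\<kappa> = \<eta>\<^sup>2 * A * ln N"
        using False R2(4) unfolding Y.\<kappa>_def A0 D0 v_def[symmetric] N_def[symmetric] by simp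
      also have "\<dots> \<le> ?D / (8 * E) * ln N" using \<eta>(6) N1 by (intro mult_right_mono) auto
      also have "\<dots> = ?D * (ln N / (2 * E)) / 4" by simp
      also have "\<dots> \<le> ln (real (M2 ^ ?d)) / 4" using ge by (rule divide_right_mono) simp
      finally have "Y.\<kappa> \<le> ln (real (M2 ^ ?d)) / 4" .
      moreover have "2 \<le> ?D * (ln N / (2 * E))"
      proof -
        have "2 \<le> ln N / (2 * E)" using lnN E by (simp add: pos_le_divide_eq)
        then have "1 * 2 \<le> ?D * (ln N / (2 * E))" using assms(1) by (intro mult_mono) auto
        then show ?thesis by simp
      qed
      ultimately show ?thesis using order_trans[OF _ ge] by blast
    qed
    have pw: "\<forall>x0\<in>cbox 0 1. ennreal (1/4) \<le> minimax_prob P D (snake_model_class \<beta> l L L\<beta> \<delta> T n) (pointwise_loss x0) C (N powr e)"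
      using X.pointwise_lower_bound[OF _ \<kappa>1 less_imp_le[OF C0], unfolded rate1, OF _ r(1)] by simp
    have su: "ennreal (1/4) \<le> minimax_prob P D (snake_model_class \<beta> l L L\<beta> \<delta> T n) sup_loss C ((N / ln N) powr e)"
      using Y.sup_lower_bound[OF _ _ less_imp_le[OF C0], unfolded rate2, OF _ _ r(1)] \<kappa>2 by simp
    have Lp: "ennreal (1/4) \<le> minimax_prob P D (snake_model_class \<beta> l L L\<beta> \<delta> T n) (Lp_loss p) C (N powr e)"
      using X.Lp_lower_bound[OF _ \<kappa>1 C0, unfolded rate1, OF _ r(2)] assms(9) by simp
    show "let \<Theta> = snake_model_class \<beta> l L L\<beta> \<delta> T n;
         N = inverse (\<delta> ^ (CARD('d) - 1)) * inverse T * real n;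
         e = - (\<beta> / (2 * (\<beta> + 1) + real CARD('d)))
     in (\<forall>x0 \<in> cbox 0 1. minimax_prob P D \<Theta> (pointwise_loss x0) C (N powr e) \<ge> ennreal (1 / 4)) \<and>
        minimax_prob P D \<Theta> sup_loss C ((N / ln N) powr e) \<ge> ennreal (1 / 4) \<and>
        minimax_prob P D \<Theta> (Lp_loss p) C (N powr e) \<ge> ennreal (1 / 4)"
      using pw su Lp unfolding Let_def N_def v_def e_def E_def by blast
  qed
qed

end
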